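(* Let $A,\theta,\eta,f$ satisfy the assumptions (H1)--(H4) listed in the context, and let $u_0\in L^1_{loc}(\mathbb{R}^N)$. Let $\nu$ and $\sigma$ be two entropy measure-valued solutions (in the sense defined in the context) of $u_t+\operatorname{div}\Phi(x,u)\ni f$, $\Phi(x,u)=A(\theta(x,u))$, with the same right-hand side $f$ and the same initial condition $u_0$. Let $E(\xi)=|\xi|$, $Q(\lambda,\mu)=\operatorname{sgn}(\lambda-\mu)(A(\lambda)-A(\mu))$, and let $E'(\xi)=-1$ for $\xi<0$, $E'(0)=0$, $E'(\xi)=1$ for $\xi>0$. Then for all nonnegative $\psi\in\mathcal D(\mathbb{R}_+\times\mathbb{R}^N)$ $$\begin{aligned}&\int_{\mathbb{R}_+\times\mathbb{R}^N}\langle E(\eta(x,\lambda)-\eta(x,\mu)),\nu_{(t,x)}(\lambda)\otimes\sigma_{(t,x)}(\mu)\rangle\,\psi_t(t,x)\,dx\,dt\\&+\int_{\mathbb{R}_+\times\mathbb{R}^N}\langle Q(\lambda,\mu),\nu_{(t,x)}(\lambda)\otimes\sigma_{(t,x)}(\mu)\rangle\cdot\nabla\psi(t,x)\,dx\,dt\\&+\int_{\mathbb{R}_+\times\mathbb{R}^N}\langle E'(\lambda-\mu)(f(t,x,\lambda)-f(t,x,\mu)),\nu_{(t,x)}(\lambda)\otimes\sigma_{(t,x)}(\mu)\rangle\,\psi(t,x)\,dx\,dt\ \ge\ 0.\end{aligned}$$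
   Context: Notation: $N\ge1$, $\mathbb{R}_+=(0,\infty)$; $\mathcal D(\Omega)$ is the set of smooth functions with compact support in $\Omega$; $r^+=\max(r,0)$, $r^-=\max(-r,0)$; $\operatorname{sgn}0=0$; $\chi$ denotes indicator functions; $L^1_{loc}(\mathbb{R}_+\times\mathbb{R}^N)$ and $L^\infty_{loc}(\mathbb{R}_+\times\mathbb{R}^N)$ mean integrability, resp. boundedness, on $(0,T)\times K$ for all $T>0$ and compact $K\subset\mathbb{R}^N$; $\operatorname{div},\nabla$ are with respect to $x$. $\mathcal M(\mathbb{R})$ is the space of bounded Radon measures, $\mathrm{Prob}(\mathbb{R})$ the set of probability measures on $\mathbb{R}$; $\langle h,m\rangle=\int h\,dm$. A Young measure is a weak$^*$ measurable map $\nu:\mathbb{R}_+\times\mathbb{R}^N\to\mathcal M(\mathbb{R})$ with $\nu_{(t,x)}\ge0$ and $\|\nu_{(t,x)}\|_{\mathcal M(\mathbb{R})}\le1$ for a.a. $(t,x)$. Assumptions: (H1) $A:\mathbb{R}\to\mathbb{R}^N$ is continuous and $\theta:\mathbb{R}^N\times\mathbb{R}\to2^{\mathbb{R}}\setminus\{\emptyset\}$ is a multi-valued mapping such that for almost every $x\in\mathbb{R}^N$, $\theta(x,\cdot)$ is a maximal monotone operator with $0\in\theta(x,0)$. The inverse of $\theta$ with respect to $u$, denoted $\eta$ (so $u=\eta(x,s)$ iff $s\in\theta(x,u)$), is single-valued and continuous in its second argument. Moreover $\theta^*(\cdot,l)\in L^1_{loc}(\mathbb{R}^N)$ for each $l\in\mathbb{R}$,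 where $\theta^*(x,l)$ is the element of $\theta(x,l)$ of least absolute value. (H2) There exist continuous $h_1,h_2:\mathbb{R}\to\mathbb{R}$ with $\lim_{|u|\to\infty}h_1(u)=\infty$ such that $h_1(u)\le|\overline\theta|\le h_2(u)$ for all $\overline\theta\in\theta(x,u)$, almost every $x$ and all $u\in\mathbb{R}$. (H3) There exist $1\le p\le\frac{N}{N-1}$ (any finite $p\ge1$ if $N=1$) and constants $R_\infty,C_\infty>0$ such that $|A(s)|^p\le C_\infty|\eta(x,s)|$ for all $|x|>R_\infty$ and all $s\in\mathbb{R}$. (H4) $f:\mathbb{R}_+\times\mathbb{R}^N\times\mathbb{R}\to\mathbb{R}$; $f(\cdot,\cdot,u)\in L^1_{loc}(\mathbb{R}_+\times\mathbb{R}^N)$ for all $u\in\mathbb{R}$; $f(t,x,\cdot)$ is continuous and $f(t,x,0)=0$ for a.a. $(t,x)$; and $(f(t,x,u)-f(t,x,v))(u-v)\le0$ for all $u,v\in\mathbb{R}$ and a.a. $(t,x)$. Definition (entropy measure-valued solution with right-hand side $f$ and initial condition $u_0\in L^1_{loc}(\mathbb{R}^N)$). A Young measure $\nu:\mathbb{R}_+\times\mathbb{R}^N\to\mathrm{Prob}(\mathbb{R})$ such that: (a) there exists $R\in L^\infty_{loc}(\mathbb{R}_+\times\mathbb{R}^N)$ with $\operatorname{supp}\nu_{(t,x)}\subset[-R(t,x),R(t,x)]$ for a.a. $(t,x)$; (b) for all $\mu\in\mathbb{R}$ and all nonnegative $\psi\in\mathcal D(\mathbb{R}_+\times\mathbb{R}^N)$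 (all integrals over $\mathbb{R}_+\times\mathbb{R}^N$) $$\int\langle(\eta(x,\lambda)-\eta(x,\mu))^+,\nu_{(t,x)}(\lambda)\rangle\psi_t\,dx\,dt+\int\langle\chi_{\{\lambda>\mu\}}(A(\lambda)-A(\mu)),\nu_{(t,x)}(\lambda)\rangle\cdot\nabla\psi\,dx\,dt+\int\langle\chi_{\{\lambda>\mu\}}f(t,x,\lambda),\nu_{(t,x)}(\lambda)\rangle\psi\,dx\,dt\ge0$$ and $$-\int\langle(\eta(x,\lambda)-\eta(x,\mu))^-,\nu_{(t,x)}(\lambda)\rangle\psi_t\,dx\,dt+\int\langle\chi_{\{\lambda<\mu\}}(A(\lambda)-A(\mu)),\nu_{(t,x)}(\lambda)\rangle\cdot\nabla\psi\,dx\,dt+\int\langle\chi_{\{\lambda<\mu\}}f(t,x,\lambda),\nu_{(t,x)}(\lambda)\rangle\psi\,dx\,dt\le0;$$ (c) for all compact $K\subset\mathbb{R}^N$, $\operatorname{ess}\lim_{t\to0_+}\int_K\langle|\eta(x,\lambda)-u_0(x)|,\nu_{(t,x)}(\lambda)\rangle\,dx=0$. *)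

theory Defs
  imports "HOL-Probability.Probability"
begin

section \<open>Domain, local function spaces, test functions\<close>

text \<open>
  Space dimension is \<open>N = CARD('n)\<close>. Functions on the half space are total functions on
  \<open>real \<times> (real^'n)\<close> of which only the values at \<open>t > 0\<close> are ever used. ``Almost everywhere'' and
  integrals refer to (complete) Lebesgue measure.
\<close>

definition half_space :: "(real \<times> (real^'n)) set" where
  "half_space = {0<..} \<times> UNIV"

definition L1_loc_space :: "(real^'n \<Rightarrow> real) \<Rightarrow> bool" where
  "L1_loc_space g \<longleftrightarrow> (\<forall>K. compact K \<longrightarrow> g absolutely_integrable_on K)"

text \<open>Local in \<open>x\<close> only: the slabs \<open>(0,T) \<times> K\<close> reach down to \<open>t = 0\<close>.\<close>

definition L1_loc :: "(real \<times> (real^'n) \<Rightarrow> real) \<Rightarrow> bool" where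
  "L1_loc g \<longleftrightarrow>
     (\<forall>T K. 0 < T \<longrightarrow> compact K \<longrightarrow> g absolutely_integrable_on ({0<..<T} \<times> K))"

definition Linf_loc :: "(real \<times> (real^'n) \<Rightarrow> real) \<Rightarrow> bool" where
  "Linf_loc g \<longleftrightarrow>
     (\<forall>T K. 0 < T \<longrightarrow> compact K \<longrightarrow>
        g \<in> borel_measurable (lebesgue_on ({0<..<T} \<times> K)) \<and>
        (\<exists>C. AE z in lebesgue_on ({0<..<T} \<times> K). \<bar>g z\<bar> \<le> C))"

primrec Ck :: "nat \<Rightarrow> ('a::euclidean_space \<Rightarrow> real) \<Rightarrow> bool" where
  "Ck 0 g \<longleftrightarrow> continuous_on UNIV g"
| "Ck (Suc k) g \<longleftrightarrow>
     (\<forall>z. g differentiable (at z)) \<and> (\<forall>v. Ck k (\<lambda>z. frechet_derivative g (at z) v))"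

definition smooth :: "('a::euclidean_space \<Rightarrow> real) \<Rightarrow> bool" where
  "smooth g \<longleftrightarrow> (\<forall>k. Ck k g)"

text \<open>\<open>\<D>(\<Omega>)\<close>, its elements being identified with their extensions by zero to the whole space.\<close>

definition test_functions :: "'a::euclidean_space set \<Rightarrow> ('a \<Rightarrow> real) set" where
  "test_functions \<Omega> =
     {\<psi>. smooth \<psi> \<and> compact (closure {z. \<psi> z \<noteq> 0}) \<and> closure {z. \<psi> z \<noteq> 0} \<subseteq> \<Omega>}"

definition dt :: "(real \<times> (real^'n) \<Rightarrow> real) \<Rightarrow> real \<times> (real^'n) \<Rightarrow> real" where
  "dt \<psi> = (\<lambda>(t, x). deriv (\<lambda>s. \<psi> (s, x)) t)"

definition grad_x :: "(real \<times> (real^'n) \<Rightarrow> real) \<Rightarrow> real \<times> (real^'n) \<Rightarrow> real^'n" where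
  "grad_x \<psi> = (\<lambda>(t, x). THE D. GDERIV (\<lambda>y. \<psi> (t, y)) x :> D)"

definition ess_lim_0_right :: "(real \<Rightarrow> real) \<Rightarrow> real \<Rightarrow> bool" where
  "ess_lim_0_right g L \<longleftrightarrow>
     (\<forall>e>0. \<exists>d>0. AE t in lebesgue_on {0<..<d}. \<bar>g t - L\<bar> < e)"

section \<open>Structural assumptions\<close>

definition monotone_operator :: "(real \<Rightarrow> real set) \<Rightarrow> bool" where
  "monotone_operator S \<longleftrightarrow> (\<forall>u v. \<forall>a\<in>S u. \<forall>b\<in>S v. 0 \<le> (a - b) * (u - v))"

definition maximal_monotone :: "(real \<Rightarrow> real set) \<Rightarrow> bool" where
  "maximal_monotone S \<longleftrightarrow>
     monotone_operator S \<and>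
     (\<forall>S'. monotone_operator S' \<and> (\<forall>u. S u \<subseteq> S' u) \<longrightarrow> S' = S)"

text \<open>
  The values \<open>\<theta> x l\<close> of a maximal monotone operator are closed and convex, so for almost every
  \<open>x\<close> the element of least absolute value exists and is unique.
\<close>

definition least_abs_selection ::
    "(real^'n \<Rightarrow> real \<Rightarrow> real set) \<Rightarrow> real^'n \<Rightarrow> real \<Rightarrow> real" where
  "least_abs_selection \<theta> x l = arg_min_on abs (\<theta> x l)"

definition flux_structure ::
    "(real \<Rightarrow> real^'n) \<Rightarrow> (real^'n \<Rightarrow> real \<Rightarrow> real set) \<Rightarrow> (real^'n \<Rightarrow> real \<Rightarrow> real) \<Rightarrow> bool" where
  "flux_structure A \<theta> \<eta> \<longleftrightarrow>
     continuous_on UNIV A \<and>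
     (\<forall>x u. \<theta> x u \<noteq> {}) \<and>
     (AE x in lebesgue. maximal_monotone (\<theta> x) \<and> 0 \<in> \<theta> x 0) \<and>
     (AE x in lebesgue. (\<forall>u s. u = \<eta> x s \<longleftrightarrow> s \<in> \<theta> x u) \<and> continuous_on UNIV (\<eta> x)) \<and>
     (\<forall>l. L1_loc_space (\<lambda>x. least_abs_selection \<theta> x l))"

definition two_sided_growth :: "(real^'n \<Rightarrow> real \<Rightarrow> real set) \<Rightarrow> bool" where
  "two_sided_growth \<theta> \<longleftrightarrow>
     (\<exists>h\<^sub>1 h\<^sub>2 :: real \<Rightarrow> real.
        continuous_on UNIV h\<^sub>1 \<and> continuous_on UNIV h\<^sub>2 \<and>
        filterlim h\<^sub>1 at_top at_infinity \<and>
        (AE x in lebesgue. \<forall>u. \<forall>s\<in>\<theta> x u. h\<^sub>1 u \<le> \<bar>s\<bar> \<and> \<bar>s\<bar> \<le> h\<^sub>2 u))"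

definition flux_dominated ::
    "(real \<Rightarrow> real^'n) \<Rightarrow> (real^'n \<Rightarrow> real \<Rightarrow> real) \<Rightarrow> bool" where
  "flux_dominated A \<eta> \<longleftrightarrow>
     (\<exists>p R\<^sub>i C\<^sub>i :: real.
        1 \<le> p \<and>
        (1 < CARD('n) \<longrightarrow> p \<le> real CARD('n) / (real CARD('n) - 1)) \<and>
        0 < R\<^sub>i \<and> 0 < C\<^sub>i \<and>
        (\<forall>x s. R\<^sub>i < norm x \<longrightarrow> norm (A s) powr p \<le> C\<^sub>i * \<bar>\<eta> x s\<bar>))"

definition dissipative_source :: "(real \<Rightarrow> real^'n \<Rightarrow> real \<Rightarrow> real) \<Rightarrow> bool" where
  "dissipative_source f \<longleftrightarrow>
     (\<forall>u. L1_loc (\<lambda>(t, x). f t x u)) \<and>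
     (AE (t, x) in lebesgue_on half_space. continuous_on UNIV (f t x) \<and> f t x 0 = 0) \<and>
     (AE (t, x) in lebesgue_on half_space. \<forall>u v. (f t x u - f t x v) * (u - v) \<le> 0)"

section \<open>Young measures and entropy measure-valued solutions\<close>

definition C0_functions :: "(real \<Rightarrow> real) set" where
  "C0_functions = {\<phi>. continuous_on UNIV \<phi> \<and> (\<phi> \<longlongrightarrow> 0) at_infinity}"

definition weak_star_measurable :: "(real \<times> (real^'n) \<Rightarrow> real measure) \<Rightarrow> bool" where
  "weak_star_measurable \<nu> \<longleftrightarrow>
     (\<forall>\<phi>\<in>C0_functions.
        (\<lambda>z. \<integral>l. \<phi> l \<partial>\<nu> z) \<in> borel_measurable (lebesgue_on half_space))"

text \<open>
  Nonnegativity is built into the type of measures, and every bounded Borel measure on the line is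
  Radon, so the nonnegative elements of norm at most one in \<open>\<M>(\<real>)\<close> are exactly the
  Borel sub-probability measures.
\<close>

definition young_measure :: "(real \<times> (real^'n) \<Rightarrow> real measure) \<Rightarrow> bool" where
  "young_measure \<nu> \<longleftrightarrow>
     weak_star_measurable \<nu> \<and>
     (AE z in lebesgue_on half_space. \<nu> z \<in> space (subprob_algebra borel))"

definition measure_support :: "real measure \<Rightarrow> real set" where
  "measure_support M = {r. \<forall>U. open U \<longrightarrow> r \<in> U \<longrightarrow> emeasure M U \<noteq> 0}"

definition entropy_mv_solution ::
    "(real \<Rightarrow> real^'n) \<Rightarrow> (real^'n \<Rightarrow> real \<Rightarrow> real) \<Rightarrow> (real \<Rightarrow> real^'n \<Rightarrow> real \<Rightarrow> real) \<Rightarrow>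
     (real^'n \<Rightarrow> real) \<Rightarrow> (real \<times> (real^'n) \<Rightarrow> real measure) \<Rightarrow> bool" where
  "entropy_mv_solution A \<eta> f u\<^sub>0 \<nu> \<longleftrightarrow>
     young_measure \<nu> \<and>
     (AE z in lebesgue_on half_space. \<nu> z \<in> space (prob_algebra borel)) \<and>
     (\<exists>R. Linf_loc R \<and>
        (AE z in lebesgue_on half_space. measure_support (\<nu> z) \<subseteq> {- R z..R z})) \<and>
     (\<forall>\<mu>. \<forall>\<psi>\<in>test_functions half_space. (\<forall>z. 0 \<le> \<psi> z) \<longrightarrow>
        (\<integral>(t, x). (\<integral>l. max (\<eta> x l - \<eta> x \<mu>) 0 \<partial>\<nu> (t, x)) * dt \<psi> (t, x)
           \<partial>lebesgue_on half_space)
      + (\<integral>(t, x). (\<integral>l. indicator {\<mu><..} l *\<^sub>R (A l - A \<mu>) \<partial>\<nu> (t, x)) \<bullet> grad_x \<psi> (t, x)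
           \<partial>lebesgue_on half_space)
      + (\<integral>(t, x). (\<integral>l. indicator {\<mu><..} l * f t x l \<partial>\<nu> (t, x)) * \<psi> (t, x)
           \<partial>lebesgue_on half_space) \<ge> 0 \<and>
      - (\<integral>(t, x). (\<integral>l. max (- (\<eta> x l - \<eta> x \<mu>)) 0 \<partial>\<nu> (t, x)) * dt \<psi> (t, x)
           \<partial>lebesgue_on half_space)
      + (\<integral>(t, x). (\<integral>l. indicator {..<\<mu>} l *\<^sub>R (A l - A \<mu>) \<partial>\<nu> (t, x)) \<bullet> grad_x \<psi> (t, x)
           \<partial>lebesgue_on half_space)
      + (\<integral>(t, x). (\<integral>l. indicator {..<\<mu>} l * f t x l \<partial>\<nu> (t, x)) * \<psi> (t, x)
           \<partial>lebesgue_on half_space) \<le> 0) \<and>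
     (\<forall>K. compact K \<longrightarrow>
        ess_lim_0_right
          (\<lambda>t. \<integral>x. (\<integral>l. \<bar>\<eta> x l - u\<^sub>0 x\<bar> \<partial>\<nu> (t, x)) \<partial>lebesgue_on K) 0)"

section \<open>The Kruzhkov entropy and its flux\<close>

definition kruzhkov_entropy :: "real \<Rightarrow> real" where
  "kruzhkov_entropy \<xi> = \<bar>\<xi>\<bar>"

definition kruzhkov_flux :: "(real \<Rightarrow> real^'n) \<Rightarrow> real \<Rightarrow> real \<Rightarrow> real^'n" where
  "kruzhkov_flux A l \<mu> = sgn (l - \<mu>) *\<^sub>R (A l - A \<mu>)"

definition kruzhkov_entropy_deriv :: "real \<Rightarrow> real" where
  "kruzhkov_entropy_deriv \<xi> = (if \<xi> < 0 then - 1 else if \<xi> = 0 then 0 else 1)"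

end

theory Submission
  imports Defs
begin

text \<open>
  This is Kruzhkov's doubling of variables for measure-valued solutions of a conservation law whose
  flux \<open>A(\<theta>(x,u))\<close> is discontinuous in space. Written in the variable \<open>\<lambda> \<in> \<theta>(x,u)\<close> the flux
  \<open>A(\<lambda>)\<close> no longer depends on \<open>x\<close>; the dependence has moved into the conserved quantity
  \<open>\<eta>(x,\<lambda>)\<close>, which is independent of time. The two one-sided entropy inequalities combine into
  Kruzhkov's inequality with the entropy \<open>\<bar>\<eta>(x,\<lambda>) - \<eta>(x,\<mu>)\<bar>\<close>
  (\<open>kruzhkov_inequality\<close>).

  Let \<open>z = (t,x)\<close> and \<open>z' = (s,y)\<close>. The inequality for \<open>\<nu>\<close> is tested with
  \<open>z \<mapsto> \<psi>(z) K(z - z')\<close> and integrated against \<open>\<sigma>\<close> at \<open>z'\<close>, the one for \<open>\<sigma>\<close> is tested with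
  \<open>z' \<mapsto> \<psi>(z) K(z - z')\<close> and integrated against \<open>\<nu>\<close> at \<open>z\<close>. When they are added
  (\<open>kruzhkov_integrand_doubling\<close>), the terms with the gradient of \<open>K\<close> cancel, because the flux is the
  same at both points. The terms with the time derivative of \<open>K\<close> do not: they carry the factor
  \<open>\<bar>\<eta>(x,\<lambda>) - \<eta>(x,\<mu>)\<bar> - \<bar>\<eta>(y,\<lambda>) - \<eta>(y,\<mu>)\<bar>\<close>. But this factor compares different points in
  space only, so it disappears if the spatial scale of \<open>K\<close> tends to zero much faster than the temporal
  one (\<open>mollifier_sequence\<close>). In the source term, adding and subtracting \<open>f(z,\<mu>)\<close> leaves
  \<open>- \<bar>f(z,\<lambda>) - f(z,\<mu>)\<bar>\<close> by monotonicity, and an oscillation of \<open>f\<close> between \<open>z\<close> and \<open>z'\<close>.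

  What remains is to replace the pair of measures at \<open>(z,z')\<close> by the pair at one point. All
  integrands are now continuous in the states and merely integrable in \<open>z\<close>, while the Young measures
  have no regularity in \<open>z\<close>. Hence the base point of the integrand is moved, not that of the measure:
  for a function that is integrable in \<open>z\<close> and continuous in the state, the supremum over the states
  of its difference at \<open>z\<close> and \<open>z'\<close> tends to zero in the mean under a concentrating kernel
  (\<open>sup_diff_mollify\<close>, from the scalar case \<open>mean_oscillation_tendsto_0\<close>). The same lemma controls
  the oscillations of \<open>\<eta>\<close> and of \<open>f\<close>. The total error of one kernel is \<open>doubling_estimate\<close>, and the
  limit is \<open>comparison_inequality\<close>.

  The rest prepares the data. On a bounded box the supports of the Young measures lie in a fixed
  interval \<open>[-C, C]\<close>, so all functions of the state can be clipped to it; the growth condition bounds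
  \<open>\<eta>\<close> there, and its measurability in \<open>x\<close> comes from that of the least-absolute-value selection of
  \<open>\<theta>\<close> (\<open>level_of_inverse\<close>). Weak-star measurability makes the Young measures probability kernels
  (\<open>restricted_kernel_measurable\<close>), and the exceptional null sets are discarded.
\<close>

section \<open>Calculus of test functions\<close>

lemma has_derivative_frechet:
  "g differentiable (at z) \<Longrightarrow> (g has_derivative frechet_derivative g (at z)) (at z)"
  by (simp add: frechet_derivative_works)

lemma Ck_Suc_imp_Ck: "Ck (Suc k) g \<Longrightarrow> Ck k g"
proof (induction k arbitrary: g)
  case 0
  then show ?case
    by (auto simp: continuous_on_eq_continuous_within intro: differentiable_imp_continuous_within)
next
  case (Suc k)
  show ?case unfolding Ck.simps(2)[of k]
  proof (intro conjI allI)
    show "g differentiable (at z)" for z using Suc.prems by simp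
    show "Ck k (\<lambda>z. frechet_derivative g (at z) v)" for v
      using Suc.prems unfolding Ck.simps(2)[of "Suc k"] by (intro Suc.IH) blast
  qed
qed

lemma Ck_add: "Ck k g \<Longrightarrow> Ck k h \<Longrightarrow> Ck k (\<lambda>z. g z + h z)"
proof (induction k arbitrary: g h)
  case 0 then show ?case by (simp add: continuous_on_add continuous_on_mult)
next
  case (Suc k)
  have d: "g differentiable (at z)" "h differentiable (at z)" for z using Suc.prems by auto
  have "frechet_derivative (\<lambda>z. g z + h z) (at z) v
      = frechet_derivative g (at z) v + frechet_derivative h (at z) v" for z v
    using frechet_derivative_at[OF has_derivative_add[OF has_derivative_frechet[OF d(1)]
      has_derivative_frechet[OF d(2)]], symmetric, of z] by simp
  moreover have "(\<lambda>z. g z + h z) differentiable (at z)" for z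
    using d by (intro differentiable_add)
  ultimately show ?case using Suc by simp
qed

lemma frechet_derivative_mult_at:
  fixes g h :: "'a::euclidean_space \<Rightarrow> real"
  assumes "g differentiable (at z)" "h differentiable (at z)"
  shows "frechet_derivative (\<lambda>z. g z * h z) (at z) v
      = frechet_derivative g (at z) v * h z + g z * frechet_derivative h (at z) v"
  using frechet_derivative_at[OF has_derivative_mult[OF has_derivative_frechet[OF assms(1)]
      has_derivative_frechet[OF assms(2)]], symmetric] by (simp add: mult.commute add.commute)

lemma Ck_mult: "Ck k g \<Longrightarrow> Ck k h \<Longrightarrow> Ck k (\<lambda>z. g z * h z)"
proof (induction k arbitrary: g h)
  case 0 then show ?case by (simp add: continuous_on_add continuous_on_mult)
next
  case (Suc k)
  have d: "g differentiable (at z)" "h differentiable (at z)" for z using Suc.prems by auto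
  have "Ck k (\<lambda>z. frechet_derivative g (at z) v * h z + g z * frechet_derivative h (at z) v)" for v
    by (intro Ck_add Suc.IH Ck_Suc_imp_Ck[OF Suc.prems(1)] Ck_Suc_imp_Ck[OF Suc.prems(2)])
       (use Suc.prems in auto)
  moreover have "(\<lambda>z. g z * h z) differentiable (at z)" for z
    using d by (intro differentiable_mult)
  ultimately show ?case by (simp add: frechet_derivative_mult_at[OF d])
qed

lemma frechet_derivative_affine:
  fixes g :: "'a::euclidean_space \<Rightarrow> real" and L :: "'b::euclidean_space \<Rightarrow> 'a"
  assumes "\<And>z. g differentiable (at z)" "bounded_linear L"
  shows "(\<lambda>z. g (c + L z)) differentiable (at z)"
    and "frechet_derivative (\<lambda>z. g (c + L z)) (at z) v = frechet_derivative g (at (c + L z)) (L v)"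
proof -
  have "((\<lambda>z. c + L z) has_derivative L) (at z)"
    using bounded_linear.has_derivative[OF assms(2) has_derivative_ident]
    by (auto intro!: derivative_eq_intros)
  then have *: "((\<lambda>z. g (c + L z)) has_derivative (\<lambda>v. frechet_derivative g (at (c + L z)) (L v))) (at z)"
    using has_derivative_compose[OF _ has_derivative_frechet[OF assms(1)]] by blast
  show "(\<lambda>z. g (c + L z)) differentiable (at z)" using * by (auto simp: differentiable_def)
  show "frechet_derivative (\<lambda>z. g (c + L z)) (at z) v = frechet_derivative g (at (c + L z)) (L v)"
    using frechet_derivative_at[OF *, symmetric] by simp
qed

lemma Ck_affine:
  fixes g :: "'a::euclidean_space \<Rightarrow> real" and L :: "'b::euclidean_space \<Rightarrow> 'a"
  assumes "bounded_linear L"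
  shows "Ck k g \<Longrightarrow> Ck k (\<lambda>z. g (c + L z))"
proof (induction k arbitrary: g)
  case 0
  then have "continuous_on UNIV g" by simp
  then show ?case
    using linear_continuous_on[OF assms]
    by (auto intro!: continuous_on_compose2[of UNIV g] continuous_intros)
next
  case (Suc k)
  have d: "g differentiable (at z)" for z using Suc.prems by auto
  have "Ck k (\<lambda>z. frechet_derivative g (at (c + L z)) (L v))" if "Ck k (\<lambda>z. frechet_derivative g (at z) (L v))" for v
    using Suc.IH[OF that] .
  then show ?case using frechet_derivative_affine[OF d assms] Suc.prems by simp
qed

lemma smooth_mult: "smooth g \<Longrightarrow> smooth h \<Longrightarrow> smooth (\<lambda>z. g z * h z)"
  by (auto simp: smooth_def Ck_mult)

lemma smooth_affine:
  fixes g :: "'a::euclidean_space \<Rightarrow> real" and L :: "'b::euclidean_space \<Rightarrow> 'a"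
  shows "bounded_linear L \<Longrightarrow> smooth g \<Longrightarrow> smooth (\<lambda>z. g (c + L z))"
  by (auto simp: smooth_def Ck_affine)

lemma Ck_const: "Ck k (\<lambda>z. c)"
proof (induction k arbitrary: c)
  case (Suc k) then show ?case by (simp add: frechet_derivative_const)
qed auto

lemma smooth_cmult: "smooth g \<Longrightarrow> smooth (\<lambda>z. c * g z)"
  by (auto simp: smooth_def Ck_mult Ck_const)

lemma smooth_imp:
  assumes "smooth g"
  shows "g differentiable (at z)" "continuous_on UNIV g"
    "continuous_on UNIV (\<lambda>z. frechet_derivative g (at z) v)"
  using assms[unfolded smooth_def, rule_format, of 1] assms[unfolded smooth_def, rule_format, of 0]
  by auto

text \<open>Partial derivatives read off from the total derivative; the gradient with respect to the
  space variable makes sense in any Euclidean space.\<close>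

definition Dt :: "(real \<times> 'b::euclidean_space \<Rightarrow> real) \<Rightarrow> real \<times> 'b \<Rightarrow> real" where
  "Dt g z = frechet_derivative g (at z) (1, 0)"

definition Dx :: "(real \<times> 'b::euclidean_space \<Rightarrow> real) \<Rightarrow> real \<times> 'b \<Rightarrow> 'b" where
  "Dx g z = (\<Sum>b\<in>Basis. frechet_derivative g (at z) (0, b) *\<^sub>R b)"

lemma dt_eq_Dt:
  assumes "smooth g" shows "dt g z = Dt g z"
proof -
  obtain t x where z: "z = (t, x)" by (cases z)
  have "((\<lambda>s. (s, x)) has_derivative (\<lambda>h. (h, 0))) (at t)"
    by (auto intro!: derivative_eq_intros)
  from has_derivative_compose[OF this has_derivative_frechet[OF smooth_imp(1)[OF assms]]]
  have h: "((\<lambda>s. g (s, x)) has_derivative (\<lambda>h. frechet_derivative g (at (t, x)) (h, 0))) (at t)" .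
  have lin: "linear (frechet_derivative g (at (t, x)))"
    using linear_frechet_derivative smooth_imp(1)[OF assms] by blast
  have "frechet_derivative g (at (t, x)) (h, 0) = h * Dt g z" for h :: real
    using linear_cmul[OF lin, of h "(1, 0)"] by (simp add: Dt_def z)
  then have "(\<lambda>h. frechet_derivative g (at (t, x)) (h, 0)) = (*) (Dt g z)"
    by (simp add: fun_eq_iff)
  with h have "((\<lambda>s. g (s, x)) has_field_derivative Dt g z) (at t)"
    by (simp add: has_field_derivative_def)
  then show ?thesis by (simp add: z dt_def DERIV_imp_deriv)
qed

lemma grad_x_eq_Dx:
  assumes "smooth g" shows "grad_x g z = Dx g z"
proof -
  obtain t x where z: "z = (t, x)" by (cases z)
  have "((\<lambda>y. (t, y)) has_derivative (\<lambda>h. (0, h))) (at x)"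
    by (auto intro!: derivative_eq_intros)
  from has_derivative_compose[OF this has_derivative_frechet[OF smooth_imp(1)[OF assms]]]
  have h: "((\<lambda>y. g (t, y)) has_derivative (\<lambda>h. frechet_derivative g (at (t, x)) (0, h))) (at x)" .
  have lin: "linear (\<lambda>h. frechet_derivative g (at (t, x)) (0, h))"
    using h has_derivative_linear by blast
  have "frechet_derivative g (at (t, x)) (0, h) = h \<bullet> Dx g z" for h
  proof -
    have "frechet_derivative g (at (t, x)) (0, h)
        = (\<Sum>b\<in>Basis. (h \<bullet> b) *\<^sub>R frechet_derivative g (at (t, x)) (0, b))"
      using linear_sum[OF lin, of "\<lambda>b. (h \<bullet> b) *\<^sub>R b" Basis] linear_cmul[OF lin]
      by (simp add: euclidean_representation)
    then show ?thesis by (simp add: Dx_def z inner_sum_right mult.commute)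
  qed
  with h have G: "GDERIV (\<lambda>y. g (t, y)) x :> Dx g z" by (simp add: gderiv_def)
  have "D = Dx g z" if "GDERIV (\<lambda>y. g (t, y)) x :> D" for D
  proof -
    have "(\<lambda>h. h \<bullet> D) = (\<lambda>h. h \<bullet> Dx g z)"
      using that G has_derivative_unique unfolding gderiv_def by blast
    then have "\<forall>h. h \<bullet> D = h \<bullet> Dx g z" by (simp add: fun_eq_iff)
    then show ?thesis by (simp only: vector_eq_ldot)
  qed
  with G have "(THE D. GDERIV (\<lambda>y. g (t, y)) x :> D) = Dx g z" by (rule the_equality)
  then show ?thesis by (simp add: z grad_x_def)
qed

lemma
  assumes "smooth g" "smooth h"
  shows Dt_mult: "Dt (\<lambda>z. g z * h z) z = Dt g z * h z + g z * Dt h z"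
    and Dx_mult: "Dx (\<lambda>z. g z * h z) z = h z *\<^sub>R Dx g z + g z *\<^sub>R Dx h z"
  unfolding Dt_def Dx_def
  by (simp_all add: frechet_derivative_mult_at assms[THEN smooth_imp(1)] scaleR_sum_right
      sum.distrib scaleR_add_left mult.commute)

lemma
  assumes "smooth g"
  shows Dt_cmult: "Dt (\<lambda>z. c * g z) z = c * Dt g z"
    and Dx_cmult: "Dx (\<lambda>z. c * g z) z = c *\<^sub>R Dx g z"
proof -
  have "smooth (\<lambda>z::real \<times> 'a. c)" by (simp add: smooth_def Ck_const)
  from Dt_mult[OF this assms] Dx_mult[OF this assms] 
  show "Dt (\<lambda>z. c * g z) z = c * Dt g z" "Dx (\<lambda>z. c * g z) z = c *\<^sub>R Dx g z"
    by (simp_all add: Dt_def[of "\<lambda>_. c"] Dx_def[of "\<lambda>_. c"] frechet_derivative_const)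
qed

lemma bounded_linear_diagonal:
  "bounded_linear (\<lambda>z::real \<times> 'b::euclidean_space. (a * fst z, b *\<^sub>R snd z))"
  by (rule bounded_linear_Pair)
    (rule bounded_linear_compose[OF bounded_linear_mult_right bounded_linear_fst]
      bounded_linear_compose[OF bounded_linear_scaleR_right bounded_linear_snd])+

lemma
  fixes g :: "real \<times> 'b::euclidean_space \<Rightarrow> real"
  assumes "smooth g"
  shows Dt_scale: "Dt (\<lambda>z. g (c + (a * fst z, b *\<^sub>R snd z))) z = a * Dt g (c + (a * fst z, b *\<^sub>R snd z))"
    and Dx_scale: "Dx (\<lambda>z. g (c + (a * fst z, b *\<^sub>R snd z))) z = b *\<^sub>R Dx g (c + (a * fst z, b *\<^sub>R snd z))"
proof -
  have L: "bounded_linear (\<lambda>z::real \<times> 'b. (a * fst z, b *\<^sub>R snd z))"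
    by (rule bounded_linear_diagonal)
  note d = frechet_derivative_affine(2)[OF smooth_imp(1)[OF assms] L]
  have lin: "linear (frechet_derivative g (at z))" for z
    using linear_frechet_derivative smooth_imp(1)[OF assms] by blast
  show "Dt (\<lambda>z. g (c + (a * fst z, b *\<^sub>R snd z))) z = a * Dt g (c + (a * fst z, b *\<^sub>R snd z))"
    using linear_cmul[OF lin, of _ a "(1, 0)"] by (simp add: Dt_def d)
  show "Dx (\<lambda>z. g (c + (a * fst z, b *\<^sub>R snd z))) z = b *\<^sub>R Dx g (c + (a * fst z, b *\<^sub>R snd z))"
    unfolding Dx_def d scaleR_sum_right
  proof (rule sum.cong)
    fix u :: 'b
    have "frechet_derivative g (at w) (0, b *\<^sub>R u) = b * frechet_derivative g (at w) (0, u)" for w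
      using linear_cmul[OF lin, of w b "(0, u)"] by simp
    then show "frechet_derivative g (at (c + (a * fst z, b *\<^sub>R snd z))) (a * fst (0::real, u), b *\<^sub>R snd (0::real, u)) *\<^sub>R u
      = b *\<^sub>R frechet_derivative g (at (c + (a * fst z, b *\<^sub>R snd z))) (0, u) *\<^sub>R u"
      by simp
  qed simp
qed

lemma smooth_scale:
  fixes g :: "real \<times> 'b::euclidean_space \<Rightarrow> real"
  assumes "smooth g" shows "smooth (\<lambda>z. g (c + (a * fst z, b *\<^sub>R snd z)))"
  by (rule smooth_affine[OF _ assms])
    (rule bounded_linear_diagonal)

lemma continuous_Dt: "smooth g \<Longrightarrow> continuous_on UNIV (Dt g)"
  and continuous_Dx: "smooth g \<Longrightarrow> continuous_on UNIV (Dx g)"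
  unfolding Dt_def[abs_def] Dx_def[abs_def]
  by (intro continuous_on_sum continuous_on_scaleR continuous_on_const smooth_imp(3); assumption)+

lemma Dt_Dx_eq_0_outside_support:
  assumes "z \<notin> closure {z. g z \<noteq> 0}"
  shows "Dt g z = 0" "Dx g z = 0"
proof -
  have "((\<lambda>_. 0) has_derivative (\<lambda>_. 0)) (at z)" by simp
  then have "(g has_derivative (\<lambda>_. 0)) (at z)"
    by (rule has_derivative_transform_within_open[where s="- closure {z. g z \<noteq> 0}"])
       (use assms closure_subset[of "{z. g z \<noteq> 0}"] in auto)
  from frechet_derivative_at[OF this] have "frechet_derivative g (at z) = (\<lambda>_. 0)" by simp
  then show "Dt g z = 0" "Dx g z = 0" by (simp_all add: Dt_def Dx_def)
qed

lemma compact_support_bounded: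
  fixes g :: "'a::euclidean_space \<Rightarrow> 'c::real_normed_vector"
  assumes "continuous_on UNIV g" "compact S" "\<And>z. z \<notin> S \<Longrightarrow> g z = 0"
  obtains M where "0 < M" "\<And>z. norm (g z) \<le> M"
proof -
  have "bounded (g ` S)"
    using assms(1,2) by (meson compact_continuous_image compact_imp_bounded continuous_on_subset subset_UNIV)
  then obtain M where M: "\<forall>z\<in>S. norm (g z) \<le> M" by (auto simp: bounded_iff)
  have "norm (g z) \<le> max M 1" for z
    using M assms(3)[of z] by (cases "z \<in> S") force+
  then show thesis by (intro that[of "max M 1"]) auto
qed

section \<open>Mollification in the mean\<close>

lemma sigma_finite_lebesgue: "sigma_finite_measure (lebesgue :: 'a::euclidean_space measure)"
proof -
  obtain A :: "'a set set" where A: "countable A" "A \<subseteq> sets lborel" "\<Union>A = space lborel"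
    "\<forall>a\<in>A. emeasure lborel a \<noteq> \<infinity>"
    using lborel.sigma_finite_countable by metis
  have "a \<in> sets lebesgue" "emeasure lebesgue a \<noteq> \<infinity>" if "a \<in> A" for a
    using A that sets_completionI_sets[of a lborel] emeasure_completion[of a lborel] main_part_sets[of a lborel]
    by auto
  with A show ?thesis
    by (intro sigma_finite_measure.intro exI[of _ A] conjI ballI subsetI) auto
qed

interpretation leb: sigma_finite_measure "lebesgue :: 'a::euclidean_space measure"
  by (rule sigma_finite_lebesgue)

interpretation leb_pair: pair_sigma_finite
  "lebesgue :: 'a::euclidean_space measure" "lebesgue :: 'b::euclidean_space measure"
  by (simp add: pair_sigma_finite_def sigma_finite_lebesgue)

lemma measurable_fst_lebesgue [measurable]:
    "(\<lambda>z. fst z) \<in> (lebesgue :: 'a::euclidean_space measure) \<Otimes>\<^sub>M N \<rightarrow>\<^sub>M borel"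
  and measurable_snd_lebesgue [measurable]:
    "(\<lambda>z. snd z) \<in> N \<Otimes>\<^sub>M (lebesgue :: 'a::euclidean_space measure) \<rightarrow>\<^sub>M borel"
  by (rule measurable_compose[OF measurable_fst] measurable_compose[OF measurable_snd];
      simp add: measurable_completion)+

lemma borel_imp_lebesgue_measurable:
  "f \<in> borel_measurable borel \<Longrightarrow> f \<in> borel_measurable (lebesgue :: 'a::euclidean_space measure)"
  by (rule measurable_completion) simp

lemma lborel_reflect:
  fixes t :: "'a::euclidean_space"
  shows "distr lborel borel (\<lambda>x. t - x) = lborel"
proof -
  have "(\<lambda>x. t + - 1 *\<^sub>R x) = (\<lambda>x. t - x)" by auto
  then show ?thesis
  using lborel_affine[of "-1" t] by (simp add: density_1)
qed

lemma nn_integral_reflect: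
  fixes t :: "'a::euclidean_space"
  assumes [measurable]: "F \<in> borel_measurable borel"
  shows "(\<integral>\<^sup>+x. F (t - x) \<partial>lebesgue) = (\<integral>\<^sup>+x. F x \<partial>lborel)"
    and "(\<integral>\<^sup>+x. F (x - t) \<partial>lebesgue) = (\<integral>\<^sup>+x. F x \<partial>lborel)"
proof -
  have "(\<integral>\<^sup>+x. F (t - x) \<partial>lborel) = (\<integral>\<^sup>+x. F x \<partial>distr lborel borel (\<lambda>x. t - x))"
    by (subst nn_integral_distr) auto
  then show "(\<integral>\<^sup>+x. F (t - x) \<partial>lebesgue) = (\<integral>\<^sup>+x. F x \<partial>lborel)"
    by (simp add: lborel_reflect nn_integral_completion)
  have "(\<integral>\<^sup>+x. F (x - t) \<partial>lborel) = (\<integral>\<^sup>+x. F x \<partial>distr lborel borel (\<lambda>x. - t + x))"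
    by (subst nn_integral_distr) auto
  then show "(\<integral>\<^sup>+x. F (x - t) \<partial>lebesgue) = (\<integral>\<^sup>+x. F x \<partial>lborel)"
    by (simp only: lborel_distr_plus nn_integral_completion)
qed

lemma nn_integral_add_iterated:
  assumes u: "(\<lambda>(z, z'). u z z') \<in> borel_measurable ((lebesgue :: 'a::euclidean_space measure) \<Otimes>\<^sub>M (lebesgue :: 'b::euclidean_space measure))"
    and v: "(\<lambda>(z, z'). v z z') \<in> borel_measurable (lebesgue \<Otimes>\<^sub>M lebesgue)"
  shows "(\<integral>\<^sup>+z. \<integral>\<^sup>+z'. u z z' + v z z' \<partial>lebesgue \<partial>lebesgue)
    = (\<integral>\<^sup>+z. \<integral>\<^sup>+z'. u z z' \<partial>lebesgue \<partial>lebesgue) + (\<integral>\<^sup>+z. \<integral>\<^sup>+z'. v z z' \<partial>lebesgue \<partial>lebesgue)"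
proof -
  have "(\<integral>\<^sup>+z. \<integral>\<^sup>+z'. u z z' + v z z' \<partial>lebesgue \<partial>lebesgue)
      = (\<integral>\<^sup>+z. (\<integral>\<^sup>+z'. u z z' \<partial>lebesgue) + (\<integral>\<^sup>+z'. v z z' \<partial>lebesgue) \<partial>lebesgue)"
    by (intro nn_integral_cong nn_integral_add) (use measurable_Pair2[OF u] measurable_Pair2[OF v] in auto)
  also have "\<dots> = (\<integral>\<^sup>+z. \<integral>\<^sup>+z'. u z z' \<partial>lebesgue \<partial>lebesgue) + (\<integral>\<^sup>+z. \<integral>\<^sup>+z'. v z z' \<partial>lebesgue \<partial>lebesgue)"
    by (intro nn_integral_add)
      (use leb.borel_measurable_nn_integral[OF u] leb.borel_measurable_nn_integral[OF v] in auto)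
  finally show ?thesis .
qed

text \<open>Only a common bound on the masses is required, not mass one: besides mollifiers, the notion has to
  cover the multiples of spatial averages that dominate time derivatives of mollifiers.\<close>

definition approximate_kernel :: "(nat \<Rightarrow> 'a::euclidean_space \<Rightarrow> ennreal) \<Rightarrow> real \<Rightarrow> bool" where
  "approximate_kernel K M \<longleftrightarrow> (\<forall>n. K n \<in> borel_measurable borel) \<and>
    (\<forall>n. (\<integral>\<^sup>+z. K n z \<partial>lborel) \<le> ennreal M) \<and>
    (\<forall>r>0. \<forall>\<^sub>F n in sequentially. \<forall>z. K n z \<noteq> 0 \<longrightarrow> norm z < r)"

lemma approximate_kernel_uminus:
  assumes "approximate_kernel K M" shows "approximate_kernel (\<lambda>n z. K n (- z)) M"
proof -
  have [measurable]: "K n \<in> borel_measurable borel" for n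
    using assms by (simp add: approximate_kernel_def)
  have "(\<integral>\<^sup>+z. K n (- z) \<partial>lborel) = (\<integral>\<^sup>+z. K n z \<partial>lborel)" for n
    using nn_integral_reflect(1)[of "K n" 0] by (simp add: nn_integral_completion)
  moreover have "\<forall>\<^sub>F n in sequentially. \<forall>z. K n (- z) \<noteq> 0 \<longrightarrow> norm z < r" if "0 < r" for r
  proof -
    have "\<forall>\<^sub>F n in sequentially. \<forall>z. K n z \<noteq> 0 \<longrightarrow> norm z < r"
      using assms that by (simp add: approximate_kernel_def)
    then show ?thesis by eventually_elim (metis norm_minus_cancel)
  qed
  ultimately show ?thesis
    using assms by (auto simp: approximate_kernel_def)
qed

text \<open>Around a point of \<open>U\<close> the kernels eventually do not reach the complement of \<open>U\<close>; dominated
  convergence does the rest, the domination being the measure of \<open>U\<close> times the mass.\<close>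

lemma open_set_leak:
  fixes U :: "'a::euclidean_space set"
  assumes K: "approximate_kernel K M" and U: "open U" "emeasure lborel U < \<infinity>"
  shows "(\<lambda>n. \<integral>\<^sup>+z. \<integral>\<^sup>+z'. indicator U z * (indicator (- U) z' * K n (z - z')) \<partial>lebesgue \<partial>lebesgue)
    \<longlonglongrightarrow> 0"
proof -
  have [measurable]: "K n \<in> borel_measurable borel" for n
    using K by (simp add: approximate_kernel_def)
  have [measurable]: "U \<in> sets borel" using U by auto
  let ?q = "\<lambda>n z. \<integral>\<^sup>+z'. indicator (- U) z' * K n (z - z') \<partial>lborel"
  let ?u = "\<lambda>n z. indicator U z * ?q n z"
  have M: "?q n z \<le> ennreal M" for n z
  proof -
    have "?q n z \<le> (\<integral>\<^sup>+z'. K n (z - z') \<partial>lborel)"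
      by (intro nn_integral_mono) (auto simp: indicator_def)
    also have "\<dots> \<le> ennreal M"
      using K nn_integral_reflect(1)[of "K n" z] by (simp add: approximate_kernel_def nn_integral_completion)
    finally show ?thesis .
  qed
  have "(\<lambda>n. \<integral>\<^sup>+z. ?u n z \<partial>lborel) \<longlonglongrightarrow> (\<integral>\<^sup>+z. 0 \<partial>(lborel :: 'a measure))"
  proof (rule nn_integral_dominated_convergence[where w="\<lambda>z. indicator U z * ennreal M"])
    show "?u n \<in> borel_measurable lborel" for n by measurable
    show "AE z in lborel. ?u n z \<le> indicator U z * ennreal M" for n
      using M by (intro AE_I2 mult_left_mono) auto
    show "(\<integral>\<^sup>+z. indicator U z * ennreal M \<partial>lborel) < \<infinity>"
      using U(2) by (simp add: nn_integral_multc ennreal_mult_less_top)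
    show "AE z in lborel. (\<lambda>n. ?u n z) \<longlonglongrightarrow> 0"
    proof (rule AE_I2)
      fix z
      show "(\<lambda>n. ?u n z) \<longlonglongrightarrow> 0"
      proof (cases "z \<in> U")
        case True
        then obtain r where r: "0 < r" "ball z r \<subseteq> U" using U(1) openE by blast
        have "\<forall>\<^sub>F n in sequentially. \<forall>z. K n z \<noteq> 0 \<longrightarrow> norm z < r"
          using K r by (simp add: approximate_kernel_def)
        then have "\<forall>\<^sub>F n in sequentially. ?u n z = 0"
        proof eventually_elim
          case (elim n)
          have "indicator (- U) z' * K n (z - z') = 0" for z'
            using elim[rule_format, of "z - z'"] r(2) by (force simp: indicator_def dist_norm)
          then have "?q n z = (\<integral>\<^sup>+z'. 0 \<partial>(lborel :: 'a measure))" by (intro nn_integral_cong)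
          then show ?case by simp
        qed
        then show ?thesis by (rule tendsto_eventually)
      qed simp
    qed
  qed auto
  then show ?thesis by (simp add: nn_integral_completion nn_integral_cmult)
qed

text \<open>The \<open>L\<^sup>1\<close> distance between a function and its translates, averaged over translations with
  the weight \<open>K\<close>.\<close>

definition mean_oscillation :: "('a::euclidean_space \<Rightarrow> ennreal) \<Rightarrow> ('a \<Rightarrow> real) \<Rightarrow> ennreal" where
  "mean_oscillation K a = (\<integral>\<^sup>+z. \<integral>\<^sup>+z'. ennreal \<bar>a z - a z'\<bar> * K (z - z') \<partial>lebesgue \<partial>lebesgue)"

context
  fixes K :: "'a::euclidean_space \<Rightarrow> ennreal"
  assumes K [measurable]: "K \<in> borel_measurable borel"
begin

lemma borel_measurable_kernel_pair [measurable]: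
  "(\<lambda>p. K (fst p - snd p)) \<in> borel_measurable (lebesgue \<Otimes>\<^sub>M lebesgue)"
  by measurable

lemma mean_oscillation_integrand_measurable [measurable]:
  assumes [measurable]: "a \<in> borel_measurable lebesgue"
  shows "(\<lambda>(z, z'). ennreal \<bar>a z - a z'\<bar> * K (z - z')) \<in> borel_measurable (lebesgue \<Otimes>\<^sub>M lebesgue)"
proof -
  note [measurable] = borel_measurable_kernel_pair
  show ?thesis unfolding split_beta by measurable
qed

lemma mean_oscillation_add:
  assumes [measurable]: "a \<in> borel_measurable lebesgue" "b \<in> borel_measurable lebesgue"
  shows "mean_oscillation K (\<lambda>z. a z + b z) \<le> mean_oscillation K a + mean_oscillation K b"
proof -
  note m = mean_oscillation_integrand_measurable
  have "mean_oscillation K (\<lambda>z. a z + b z) \<le>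
    (\<integral>\<^sup>+z. \<integral>\<^sup>+z'. ennreal \<bar>a z - a z'\<bar> * K (z - z') + ennreal \<bar>b z - b z'\<bar> * K (z - z')
      \<partial>lebesgue \<partial>lebesgue)"
    unfolding mean_oscillation_def
    by (intro nn_integral_mono)
       (auto simp: ring_distribs(2)[symmetric] simp flip: ennreal_plus
         intro!: mult_right_mono ennreal_leI)
  also have "\<dots> = mean_oscillation K a + mean_oscillation K b"
    unfolding mean_oscillation_def by (intro nn_integral_add_iterated m assms)
  finally show ?thesis .
qed

lemma nn_integral_kernel:
  fixes u :: "'a \<Rightarrow> ennreal"
  assumes [measurable]: "u \<in> borel_measurable lebesgue"
  shows "(\<integral>\<^sup>+z. \<integral>\<^sup>+z'. u z * K (z - z') \<partial>lebesgue \<partial>lebesgue)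
      = (\<integral>\<^sup>+z. K z \<partial>lborel) * (\<integral>\<^sup>+z. u z \<partial>lebesgue)" (is ?fst)
    and "(\<integral>\<^sup>+z. \<integral>\<^sup>+z'. u z' * K (z - z') \<partial>lebesgue \<partial>lebesgue)
      = (\<integral>\<^sup>+z. K z \<partial>lborel) * (\<integral>\<^sup>+z. u z \<partial>lebesgue)" (is ?snd)
proof -
  note [measurable] = borel_measurable_kernel_pair
  have k: "(\<lambda>z'. K (z - z')) \<in> borel_measurable lebesgue" "(\<lambda>z'. K (z' - z)) \<in> borel_measurable lebesgue" for z
    by (rule borel_imp_lebesgue_measurable; measurable)+
  have m: "(\<lambda>(z, z'). u z' * K (z - z')) \<in> borel_measurable (lebesgue \<Otimes>\<^sub>M lebesgue)"
    unfolding split_beta by measurable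
  show ?fst
    by (simp add: nn_integral_cmult nn_integral_multc k nn_integral_reflect(1) K mult.commute)
  have "(\<integral>\<^sup>+z. \<integral>\<^sup>+z'. u z' * K (z - z') \<partial>lebesgue \<partial>lebesgue)
      = (\<integral>\<^sup>+z'. \<integral>\<^sup>+z. u z' * K (z - z') \<partial>lebesgue \<partial>lebesgue)"
    by (rule leb_pair.Fubini'[symmetric, OF m])
  then show ?snd
    by (simp add: nn_integral_cmult nn_integral_multc k nn_integral_reflect(2) K mult.commute)
qed

text \<open>Each of the two terms of \<open>\<bar>a z - a z'\<bar> \<le> \<bar>a z\<bar> + \<bar>a z'\<bar>\<close> contributes the mass of the kernel.\<close>

lemma nn_integral_kernel_symmetric:
  assumes [measurable]: "u \<in> borel_measurable lebesgue"
  shows "(\<integral>\<^sup>+z. \<integral>\<^sup>+z'. (u z + u z') * K (z - z') \<partial>lebesgue \<partial>lebesgue)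
    = 2 * (\<integral>\<^sup>+z. K z \<partial>lborel) * (\<integral>\<^sup>+z. u z \<partial>lebesgue)"
proof -
  note [measurable] = borel_measurable_kernel_pair
  have m1: "(\<lambda>(z, z'). u z * K (z - z')) \<in> borel_measurable (lebesgue \<Otimes>\<^sub>M lebesgue)"
    and m2: "(\<lambda>(z, z'). u z' * K (z - z')) \<in> borel_measurable (lebesgue \<Otimes>\<^sub>M lebesgue)"
    unfolding split_beta by measurable
  show ?thesis
    unfolding ring_distribs(2) nn_integral_add_iterated[OF m1 m2] nn_integral_kernel[OF assms]
    by (simp only: mult_2 ring_distribs)
qed

lemma mean_oscillation_le:
  assumes a [measurable]: "a \<in> borel_measurable lebesgue" and M: "(\<integral>\<^sup>+z. K z \<partial>lborel) \<le> ennreal M"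
  shows "mean_oscillation K a \<le> 2 * ennreal M * (\<integral>\<^sup>+z. ennreal \<bar>a z\<bar> \<partial>lebesgue)"
proof -
  have "mean_oscillation K a
      \<le> (\<integral>\<^sup>+z. \<integral>\<^sup>+z'. (ennreal \<bar>a z\<bar> + ennreal \<bar>a z'\<bar>) * K (z - z') \<partial>lebesgue \<partial>lebesgue)"
    unfolding mean_oscillation_def
    by (intro nn_integral_mono mult_right_mono) (auto simp flip: ennreal_plus intro!: ennreal_leI)
  also have "\<dots> = 2 * (\<integral>\<^sup>+z. K z \<partial>lborel) * (\<integral>\<^sup>+z. ennreal \<bar>a z\<bar> \<partial>lebesgue)"
    by (rule nn_integral_kernel_symmetric) measurable
  also have "\<dots> \<le> 2 * ennreal M * (\<integral>\<^sup>+z. ennreal \<bar>a z\<bar> \<partial>lebesgue)"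
    by (intro mult_right_mono mult_left_mono M) auto
  finally show ?thesis .
qed

lemma mean_oscillation_cmult:
  assumes [measurable]: "a \<in> borel_measurable lebesgue"
  shows "mean_oscillation K (\<lambda>z. a z * c) = ennreal \<bar>c\<bar> * mean_oscillation K a"
proof -
  note m = mean_oscillation_integrand_measurable
  have "mean_oscillation K (\<lambda>z. a z * c)
      = (\<integral>\<^sup>+z. \<integral>\<^sup>+z'. ennreal \<bar>c\<bar> * (ennreal \<bar>a z - a z'\<bar> * K (z - z')) \<partial>lebesgue \<partial>lebesgue)"
    unfolding mean_oscillation_def
    by (intro nn_integral_cong) (simp add: abs_mult ennreal_mult' mult_ac flip: left_diff_distrib right_diff_distrib)
  also have "\<dots> = ennreal \<bar>c\<bar> * mean_oscillation K a"
    unfolding mean_oscillation_def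
    using measurable_Pair2[OF m[of a]] leb.borel_measurable_nn_integral[OF m[of a]]
    by (simp add: nn_integral_cmult)
  finally show ?thesis .
qed

end

text \<open>The indicators at \<open>z\<close> and \<open>z'\<close> differ only if one point lies in \<open>U\<close> and the other outside, so
  the oscillation is the leakage of the kernel plus that of its reflection.\<close>

lemma open_set_mean_oscillation:
  fixes U :: "'a::euclidean_space set"
  assumes K: "approximate_kernel K M" and U: "open U" "emeasure lborel U < \<infinity>"
  shows "(\<lambda>n. mean_oscillation (K n) (indicator U)) \<longlonglongrightarrow> 0"
proof -
  have k[measurable]: "K n \<in> borel_measurable borel" for n
    using K by (simp add: approximate_kernel_def)
  have [measurable]: "U \<in> sets borel" using U by auto
  have [measurable]: "U \<in> sets lebesgue" using U by auto
  note [measurable] = borel_measurable_kernel_pair[OF k]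
  let ?a = "\<lambda>n z z'. indicator U z * (indicator (- U) z' * K n (z - z'))"
  let ?b = "\<lambda>n z z'. indicator U z' * (indicator (- U) z * K n (z - z'))"
  have ma: "(\<lambda>(z, z'). ?a n z z') \<in> borel_measurable (lebesgue \<Otimes>\<^sub>M lebesgue)"
    and mb: "(\<lambda>(z, z'). ?b n z z') \<in> borel_measurable (lebesgue \<Otimes>\<^sub>M lebesgue)" for n
    unfolding split_beta by measurable
  have eq: "mean_oscillation (K n) (indicator U) =
    (\<integral>\<^sup>+z. \<integral>\<^sup>+z'. ?a n z z' \<partial>lebesgue \<partial>lebesgue) + (\<integral>\<^sup>+z'. \<integral>\<^sup>+z. ?b n z z' \<partial>lebesgue \<partial>lebesgue)" for n
  proof -
  have pt: "ennreal \<bar>indicator U z - indicator U z'\<bar> * K n (z - z') = ?a n z z' + ?b n z z'" for z z'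
      by (cases "z \<in> U"; cases "z' \<in> U") simp_all
    have "mean_oscillation (K n) (indicator U) = (\<integral>\<^sup>+z. \<integral>\<^sup>+z'. ?a n z z' + ?b n z z' \<partial>lebesgue \<partial>lebesgue)"
      unfolding mean_oscillation_def pt ..
    also have "\<dots> = (\<integral>\<^sup>+z. \<integral>\<^sup>+z'. ?a n z z' \<partial>lebesgue \<partial>lebesgue) + (\<integral>\<^sup>+z. \<integral>\<^sup>+z'. ?b n z z' \<partial>lebesgue \<partial>lebesgue)"
      by (rule nn_integral_add_iterated[OF ma[of n] mb[of n]])
    also have "(\<integral>\<^sup>+z. \<integral>\<^sup>+z'. ?b n z z' \<partial>lebesgue \<partial>lebesgue) = (\<integral>\<^sup>+z'. \<integral>\<^sup>+z. ?b n z z' \<partial>lebesgue \<partial>lebesgue)"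
      by (rule leb_pair.Fubini'[symmetric, OF mb[of n]])
    finally show "mean_oscillation (K n) (indicator U) =
      (\<integral>\<^sup>+z. \<integral>\<^sup>+z'. ?a n z z' \<partial>lebesgue \<partial>lebesgue) + (\<integral>\<^sup>+z'. \<integral>\<^sup>+z. ?b n z z' \<partial>lebesgue \<partial>lebesgue)" .
    qed
  have "(\<lambda>n. (\<integral>\<^sup>+z. \<integral>\<^sup>+z'. ?a n z z' \<partial>lebesgue \<partial>lebesgue) + (\<integral>\<^sup>+z'. \<integral>\<^sup>+z. ?b n z z' \<partial>lebesgue \<partial>lebesgue))
      \<longlonglongrightarrow> 0 + 0"
    using open_set_leak[OF K U] open_set_leak[OF approximate_kernel_uminus[OF K] U]
    by (intro tendsto_add) auto
  then show ?thesis by (simp add: eq)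
qed

text \<open>Outer regularity passes from open sets to measurable sets of finite measure, and density of
  simple functions from these to integrable functions.\<close>

theorem mean_oscillation_tendsto_0:
  fixes a :: "'a::euclidean_space \<Rightarrow> real"
  assumes K: "approximate_kernel K M" and a: "integrable lebesgue a" and M: "0 < M"
  shows "(\<lambda>n. mean_oscillation (K n) a) \<longlonglongrightarrow> 0"
proof -
  have k: "K n \<in> borel_measurable borel" and mass: "(\<integral>\<^sup>+z. K n z \<partial>lborel) \<le> ennreal M" for n
    using K by (simp_all add: approximate_kernel_def)
  define P :: "('a \<Rightarrow> real) \<Rightarrow> bool"
    where "P a \<longleftrightarrow> (\<forall>e>0. \<forall>\<^sub>F n in sequentially. mean_oscillation (K n) a < ennreal e)" for a
  have P_iff: "P a \<longleftrightarrow> (\<lambda>n. mean_oscillation (K n) a) \<longlonglongrightarrow> 0" for a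
  proof
    assume P: "P a"
    show "(\<lambda>n. mean_oscillation (K n) a) \<longlonglongrightarrow> 0"
    proof (rule order_tendstoI)
      fix y :: ennreal assume "0 < y"
      then obtain x where x: "0 < x" "x < y" using dense by blast
      define e where "e = enn2real x"
      have e: "ennreal e = x"
        using x by (auto simp: e_def intro!: ennreal_enn2real order.strict_trans2[OF _ top_greatest])
      then have "0 < e" using x by (simp flip: ennreal_less_zero_iff)
      with P have "\<forall>\<^sub>F n in sequentially. mean_oscillation (K n) a < ennreal e" by (auto simp: P_def)
      then show "\<forall>\<^sub>F n in sequentially. mean_oscillation (K n) a < y"
        by eventually_elim (use e x in auto)
    qed auto
  next
    assume "(\<lambda>n. mean_oscillation (K n) a) \<longlonglongrightarrow> 0"
    then show "P a" unfolding P_def by (auto intro: order_tendstoD(2))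
  qed
  have P_add: "P (\<lambda>z. f z + g z)"
    if "f \<in> borel_measurable lebesgue" "g \<in> borel_measurable lebesgue" "P f" "P g" for f g
  proof -
    have "(\<lambda>n. mean_oscillation (K n) f + mean_oscillation (K n) g) \<longlonglongrightarrow> 0 + 0"
      using that unfolding P_iff by (intro tendsto_add)
    then have lim: "(\<lambda>n. mean_oscillation (K n) f + mean_oscillation (K n) g) \<longlonglongrightarrow> 0"
      by simp
    have "(\<lambda>n. mean_oscillation (K n) (\<lambda>z. f z + g z)) \<longlonglongrightarrow> 0"
      by (rule tendsto_sandwich[OF _ _ tendsto_const lim])
         (simp_all add: mean_oscillation_add[OF k that(1,2)])
    then show ?thesis by (simp add: P_iff)
  qed
  \<comment> \<open>The property is closed under \<open>L\<^sup>1\<close> approximation, since the kernels have bounded mass.\<close>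
  have P_lim: "P f" if f [measurable]: "f \<in> borel_measurable lebesgue"
    and *: "\<And>e. 0 < e \<Longrightarrow> \<exists>g. g \<in> borel_measurable lebesgue \<and> P g \<and>
        (\<integral>\<^sup>+z. ennreal \<bar>f z - g z\<bar> \<partial>lebesgue) < ennreal e" for f
    unfolding P_def
  proof (intro allI impI)
    fix e :: real assume e: "0 < e"
    then have "0 < e / (4 * M)" using M by simp
    from *[OF this] obtain g where g [measurable]: "g \<in> borel_measurable lebesgue" and "P g"
      and fg: "(\<integral>\<^sup>+z. ennreal \<bar>f z - g z\<bar> \<partial>lebesgue) < ennreal (e / (4 * M))" by blast
    have "\<forall>\<^sub>F n in sequentially. mean_oscillation (K n) g < ennreal (e / 2)"
      using \<open>P g\<close> e by (simp add: P_def)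
    then show "\<forall>\<^sub>F n in sequentially. mean_oscillation (K n) f < ennreal e"
    proof eventually_elim
      case (elim n)
      have "mean_oscillation (K n) f \<le> mean_oscillation (K n) g + mean_oscillation (K n) (\<lambda>z. f z - g z)"
        using mean_oscillation_add[OF k g borel_measurable_diff[OF f g]] by simp
      also have "mean_oscillation (K n) (\<lambda>z. f z - g z) \<le> 2 * ennreal M * (\<integral>\<^sup>+z. ennreal \<bar>f z - g z\<bar> \<partial>lebesgue)"
        by (rule mean_oscillation_le[OF k _ mass]) measurable
      also have "\<dots> \<le> 2 * ennreal M * ennreal (e / (4 * M))"
        using fg by (intro mult_left_mono) auto
      also have "\<dots> = ennreal (e / 2)"
        using M e by (simp flip: ennreal_numeral ennreal_mult)
      finally have "mean_oscillation (K n) f \<le> mean_oscillation (K n) g + ennreal (e / 2)"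
        by (simp add: add_left_mono)
      also have "\<dots> < ennreal (e / 2) + ennreal (e / 2)"
        using elim by (simp add: ennreal_add_left_cancel_less add.commute)
      also have "\<dots> = ennreal e" using e by (simp flip: ennreal_plus)
      finally show ?case .
    qed
  qed
  have "P a" using a
  proof (induction rule: integrable_induct)
    case (base A c)
    have [measurable]: "A \<in> sets lebesgue" by fact
    have "P (indicator A)"
    proof (rule P_lim)
      fix e :: real assume "0 < e"
      from sets_lebesgue_outer_open[OF base(1) this]
      obtain U where U: "open U" "A \<subseteq> U" "U - A \<in> lmeasurable" "emeasure lebesgue (U - A) < ennreal e" .
      have [measurable]: "U \<in> sets lebesgue" using U by auto
      have "emeasure lebesgue U \<le> emeasure lebesgue (U - A) + emeasure lebesgue A"
        using emeasure_subadditive[of "U - A" lebesgue A] U(2) by (simp add: Un_absorb2)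
      also have "\<dots> < \<infinity>"
        using order.strict_trans[OF U(4) ennreal_less_top] base(2) by (simp only: ennreal_add_less_top infinity_ennreal_def)
      finally have "P (indicator U)"
        using open_set_mean_oscillation[OF K U(1)] U(1) by (simp add: P_iff)
      moreover have "(\<integral>\<^sup>+z. ennreal \<bar>indicator A z - indicator U z\<bar> \<partial>lebesgue)
          = (\<integral>\<^sup>+z. indicator (U - A) z \<partial>lebesgue)"
        using U(2) by (intro nn_integral_cong) (auto simp: indicator_def)
      then have "(\<integral>\<^sup>+z. ennreal \<bar>indicator A z - indicator U z\<bar> \<partial>lebesgue) = emeasure lebesgue (U - A)"
        by (simp only: nn_integral_indicator fmeasurableD[OF U(3)])
      ultimately show "\<exists>g. g \<in> borel_measurable lebesgue \<and> P g \<and>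
        (\<integral>\<^sup>+z. ennreal \<bar>indicator A z - g z\<bar> \<partial>lebesgue) < ennreal e"
        using U(4) by (intro exI[of _ "indicator U"]) auto
    qed measurable
    then have "(\<lambda>n. ennreal \<bar>c\<bar> * mean_oscillation (K n) (indicator A)) \<longlonglongrightarrow> ennreal \<bar>c\<bar> * 0"
      unfolding P_iff by (intro tendsto_mult_ennreal tendsto_const) auto
    then show ?case using mean_oscillation_cmult[OF k borel_measurable_indicator[OF \<open>A \<in> sets lebesgue\<close>]] by (simp add: P_iff)
  next
    case (add f g)
    then show ?case by (intro P_add) auto
  next
    case (lim f s)
    have [measurable]: "f \<in> borel_measurable lebesgue" "\<And>i. s i \<in> borel_measurable lebesgue"
      using lim by auto
    show ?case
    proof (rule P_lim)
      fix e :: real assume e: "0 < e"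
      have "(\<lambda>i. \<integral>\<^sup>+z. ennreal \<bar>f z - s i z\<bar> \<partial>lebesgue) \<longlonglongrightarrow> (\<integral>\<^sup>+z. 0 \<partial>(lebesgue :: 'a measure))"
      proof (rule nn_integral_dominated_convergence[where w="\<lambda>z. ennreal (3 * \<bar>f z\<bar>)"])
        show "AE z in lebesgue. ennreal \<bar>f z - s i z\<bar> \<le> ennreal (3 * \<bar>f z\<bar>)" for i
        proof (intro AE_I2 ennreal_leI)
          fix z :: 'a
          show "\<bar>f z - s i z\<bar> \<le> 3 * \<bar>f z\<bar>" using lim.hyps(3)[of z i] by auto
        qed
        have "integrable lebesgue (\<lambda>z. 3 * \<bar>f z\<bar>)" using lim by auto
        then show "(\<integral>\<^sup>+z. ennreal (3 * \<bar>f z\<bar>) \<partial>lebesgue) < \<infinity>"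
          unfolding integrable_iff_bounded by simp
        show "AE z in lebesgue. (\<lambda>i. ennreal \<bar>f z - s i z\<bar>) \<longlonglongrightarrow> 0"
        proof (rule AE_I2)
          fix z :: 'a
          have "(\<lambda>i. \<bar>f z - s i z\<bar>) \<longlonglongrightarrow> \<bar>f z - f z\<bar>"
            using lim.hyps(2)[of z] by (intro tendsto_intros) auto
          then show "(\<lambda>i. ennreal \<bar>f z - s i z\<bar>) \<longlonglongrightarrow> 0"
            using tendsto_ennrealI by fastforce
        qed
      qed auto
      then have "\<forall>\<^sub>F i in sequentially. (\<integral>\<^sup>+z. ennreal \<bar>f z - s i z\<bar> \<partial>lebesgue) < ennreal e"
        using e by (intro order_tendstoD(2)) auto
      then obtain i where "(\<integral>\<^sup>+z. ennreal \<bar>f z - s i z\<bar> \<partial>lebesgue) < ennreal e"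
        by (auto simp: eventually_sequentially)
      then show "\<exists>g. g \<in> borel_measurable lebesgue \<and> P g \<and>
        (\<integral>\<^sup>+z. ennreal \<bar>f z - g z\<bar> \<partial>lebesgue) < ennreal e"
        using lim.IH by (intro exI[of _ "s i"]) auto
    qed measurable
  qed
  then show ?thesis by (simp add: P_iff)
qed

section \<open>Mollification of Caratheodory functions\<close>

definition clip :: "real \<Rightarrow> real \<Rightarrow> real" where
  "clip C l = max (- C) (min C l)"

lemma clip_eq: "\<bar>l\<bar> \<le> C \<Longrightarrow> clip C l = l"
  and clip_bound: "0 \<le> C \<Longrightarrow> \<bar>clip C l\<bar> \<le> C"
  and clip_idem: "clip C (clip C l) = clip C l"
  and clip_mono: "l \<le> m \<Longrightarrow> clip C l \<le> clip C m"
  by (auto simp: clip_def max_def min_def abs_le_iff)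

lemma continuous_on_clip: "continuous_on S (clip C)"
  unfolding clip_def[abs_def] by (intro continuous_intros)

text \<open>The second argument is a state variable that matters only within \<open>[-C, C]\<close>; composing with
  the clipping function turns local bounds in the state into global ones.\<close>

definition caratheodory :: "real \<Rightarrow> ('a::euclidean_space \<Rightarrow> real) \<Rightarrow> ('a \<Rightarrow> real \<Rightarrow> real) \<Rightarrow> bool" where
  "caratheodory C F g \<longleftrightarrow> integrable lebesgue F \<and>
     (\<forall>z. continuous_on UNIV (g z)) \<and> (\<forall>l. (\<lambda>z. g z l) \<in> borel_measurable lebesgue) \<and>
     (\<forall>z l. \<bar>g z l\<bar> \<le> F z) \<and> (\<forall>z l. g z (clip C l) = g z l)"

lemma floor_grid_near:
  fixes a :: real
  assumes "0 < a" shows "\<bar>of_int \<lfloor>a * l\<rfloor> / a - l\<bar> \<le> 1 / a"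
proof -
  have "of_int \<lfloor>a * l\<rfloor> / a - l = (of_int \<lfloor>a * l\<rfloor> - a * l) / a"
    using assms by (simp add: diff_divide_distrib)
  then have "\<bar>of_int \<lfloor>a * l\<rfloor> / a - l\<bar> = \<bar>of_int \<lfloor>a * l\<rfloor> - a * l\<bar> / a"
    using assms by (simp add: abs_divide)
  also have "\<dots> \<le> 1 / a"
    using assms by (intro divide_right_mono) linarith+
  finally show ?thesis .
qed

text \<open>A separately measurable and continuous function is the pointwise limit of its discretisations
  in the continuous variable.\<close>

lemma borel_measurable_continuous_in_second:
  fixes g :: "'a \<Rightarrow> real \<Rightarrow> real"
  assumes [measurable]: "\<And>l. (\<lambda>z. g z l) \<in> borel_measurable M"
    and cont: "\<And>z. continuous_on UNIV (g z)"
  shows "(\<lambda>(z, l). g z l) \<in> borel_measurable (M \<Otimes>\<^sub>M borel)"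
proof -
  define r :: "nat \<Rightarrow> real \<Rightarrow> real" where "r n l = of_int \<lfloor>real (Suc n) * l\<rfloor> / real (Suc n)" for n l
  have lim: "(\<lambda>n. r n l) \<longlonglongrightarrow> l" for l
  proof (rule LIMSEQ_I)
    fix e :: real assume "0 < e"
    then obtain N where N: "inverse (real (Suc N)) < e" using reals_Archimedean by blast
    show "\<exists>N. \<forall>n\<ge>N. norm (r n l - l) < e"
    proof (intro exI allI impI)
      fix n assume "N \<le> n"
      have "\<bar>r n l - l\<bar> \<le> inverse (real (Suc n))"
        using floor_grid_near[of "real (Suc n)" l] by (simp add: r_def inverse_eq_divide)
      also have "\<dots> \<le> inverse (real (Suc N))" using \<open>N \<le> n\<close> by (intro le_imp_inverse_le) auto
      finally show "norm (r n l - l) < e" using N by simp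
    qed
  qed
  have "(\<lambda>p. g (fst p) (r n (snd p))) \<in> borel_measurable (M \<Otimes>\<^sub>M borel)" for n
  proof -
    have "(\<lambda>p. (\<lambda>k::int. g (fst p) (of_int k / real (Suc n))) (\<lfloor>real (Suc n) * snd p\<rfloor>)) \<in> borel_measurable (M \<Otimes>\<^sub>M borel)"
      by (rule measurable_compose_countable[where f="\<lambda>k p. g (fst p) (of_int k / real (Suc n))"])
        measurable
    then show ?thesis by (simp add: r_def)
  qed
  moreover have "(\<lambda>n. g (fst p) (r n (snd p))) \<longlonglongrightarrow> g (fst p) (snd p)" for p
    using continuous_on_tendsto_compose[OF cont lim] by simp
  ultimately show ?thesis
    unfolding split_beta
    by (rule borel_measurable_LIMSEQ_real[of _ "\<lambda>n p. g (fst p) (r n (snd p))", rotated])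
qed

lemma caratheodory_measurable:
  assumes "caratheodory C F g"
  shows "(\<lambda>(z, l). g z l) \<in> borel_measurable (lebesgue \<Otimes>\<^sub>M borel)"
  using assms by (intro borel_measurable_continuous_in_second) (auto simp: caratheodory_def)

text \<open>The rationals make the supremum measurable; by continuity it is the supremum over all states.\<close>

definition sup_diff :: "('a \<Rightarrow> real \<Rightarrow> real) \<Rightarrow> 'a \<Rightarrow> 'a \<Rightarrow> real" where
  "sup_diff g z z' = (SUP q\<in>\<rat>. \<bar>g z q - g z' q\<bar>)"

lemma closure_Rats: "closure (\<rat> :: real set) = UNIV"
proof -
  have "x \<in> closure (\<rat> :: real set)" for x
    unfolding closure_approachable
  proof (intro allI impI)
    fix e :: real assume "0 < e"
    then obtain q where "q \<in> \<rat>" "x < q" "q < x + e" using Rats_dense_in_real[of x "x + e"] by auto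
    then show "\<exists>y\<in>\<rat>. dist y x < e" by (intro bexI[of _ q]) (auto simp: dist_real_def)
  qed
  then show ?thesis by auto
qed

context
  fixes C :: real and F :: "'a::euclidean_space \<Rightarrow> real" and g :: "'a \<Rightarrow> real \<Rightarrow> real"
  assumes g: "caratheodory C F g"
begin

lemma caratheodory_diff_le: "\<bar>g z q - g z' q\<bar> \<le> F z + F z'"
proof -
  have "\<bar>g z q\<bar> \<le> F z" "\<bar>g z' q\<bar> \<le> F z'" using g by (auto simp: caratheodory_def)
  then show ?thesis by linarith
qed

lemma bdd_above_diff: "bdd_above ((\<lambda>q. \<bar>g z q - g z' q\<bar>) ` \<rat>)"
  using caratheodory_diff_le by (auto simp: bdd_above_def)

lemma sup_diff_upper: "\<bar>g z l - g z' l\<bar> \<le> sup_diff g z z'"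
proof -
  have cg: "continuous_on UNIV (g z)" for z using g by (simp add: caratheodory_def)
  have "continuous_on (closure \<rat>) (\<lambda>l. \<bar>g z l - g z' l\<bar>)"
    unfolding closure_Rats by (intro continuous_intros cg)
  then show ?thesis
    by (rule continuous_le_on_closure)
       (auto simp: closure_Rats sup_diff_def intro!: cSUP_upper bdd_above_diff)
qed

lemma sup_diff_nonneg: "0 \<le> sup_diff g z z'"
  using sup_diff_upper[of z 0 z'] by linarith

lemma sup_diff_measurable [measurable]:
  "(\<lambda>(z, z'). sup_diff g z z') \<in> borel_measurable (lebesgue \<Otimes>\<^sub>M lebesgue)"
proof -
  have [measurable]: "(\<lambda>z. g z l) \<in> borel_measurable lebesgue" for l
    using g by (simp add: caratheodory_def)
  have "(\<lambda>p. SUP q\<in>\<rat>. \<bar>g (fst p) q - g (snd p) q\<bar>) \<in> borel_measurable (lebesgue \<Otimes>\<^sub>M lebesgue)"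
    by (rule borel_measurable_cSUP[OF countable_rat]) (measurable, rule bdd_above_diff)
  then show ?thesis by (simp add: sup_diff_def split_beta)
qed

text \<open>Discretise the state with mesh \<open>1/(k+1)\<close>: on the finitely many grid values the scalar
  mollification result applies, and the discretisation error is dominated by \<open>2 F\<close> and tends to
  zero pointwise by uniform continuity.\<close>

theorem sup_diff_mollify:
  assumes K: "approximate_kernel K M" and M: "0 < M" and C: "0 \<le> C"
  shows "(\<lambda>n. \<integral>\<^sup>+z. \<integral>\<^sup>+z'. ennreal (sup_diff g z z') * K n (z - z') \<partial>lebesgue \<partial>lebesgue) \<longlonglongrightarrow> 0"
proof -
  have gF: "integrable lebesgue F" and gc: "continuous_on UNIV (g z)"
    and gm [measurable]: "(\<lambda>z. g z l) \<in> borel_measurable lebesgue" and gb: "\<bar>g z l\<bar> \<le> F z"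
    and gclip: "g z (clip C l) = g z l" for z l
    using g by (auto simp: caratheodory_def)
  have k: "K n \<in> borel_measurable borel" and mass: "(\<integral>\<^sup>+z. K n z \<partial>lborel) \<le> ennreal M" for n
    using K by (simp_all add: approximate_kernel_def)
  note [measurable] = borel_measurable_kernel_pair[OF k]
  have F0: "0 \<le> F z" for z using gb[of z 0] by linarith
  define r :: "nat \<Rightarrow> real \<Rightarrow> real"
    where "r j l = of_int \<lfloor>real (Suc j) * clip C l\<rfloor> / real (Suc j)" for j l
  define R where "R j = range (r j)" for j
  define w where "w j z = (SUP q\<in>\<rat>. \<bar>g z q - g z (r j q)\<bar>)" for j z
  have r_near: "\<bar>r j l - clip C l\<bar> \<le> 1 / real (Suc j)" for j l
    unfolding r_def by (rule floor_grid_near) simp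
  have finR: "finite (R j)" for j
  proof -
    have "R j \<subseteq> (\<lambda>i. of_int i / real (Suc j)) ` {\<lfloor>- (real (Suc j) * C)\<rfloor>..\<lfloor>real (Suc j) * C\<rfloor>}"
    proof (clarsimp simp: R_def)
      fix l
      have "- C \<le> clip C l" "clip C l \<le> C" using clip_bound[OF C, of l] by linarith+
      then have "real (Suc j) * (- C) \<le> real (Suc j) * clip C l" "real (Suc j) * clip C l \<le> real (Suc j) * C"
        by (intro mult_left_mono; simp)+
      then show "r j l \<in> (\<lambda>i. of_int i / (1 + real j)) ` {\<lfloor>- ((1 + real j) * C)\<rfloor>..\<lfloor>(1 + real j) * C\<rfloor>}"
        unfolding r_def by (intro image_eqI[of _ _ "\<lfloor>real (Suc j) * clip C l\<rfloor>"]) (auto intro!: floor_mono)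
    qed
    then show ?thesis by (rule finite_subset) auto
  qed
  have wb: "\<bar>g z q - g z (r j q)\<bar> \<le> 2 * F z" for z q j
    using gb[of z q] gb[of z "r j q"] by linarith
  have bdd: "bdd_above ((\<lambda>q. \<bar>g z q - g z (r j q)\<bar>) ` \<rat>)" for z j
    using wb by (auto simp: bdd_above_def)
  have w_upper: "\<bar>g z q - g z (r j q)\<bar> \<le> w j z" if "q \<in> \<rat>" for z j q
    unfolding w_def using that bdd by (intro cSUP_upper)
  have w_le: "w j z \<le> 2 * F z" for j z
    unfolding w_def using wb by (intro cSUP_least) auto
  have w0: "0 \<le> w j z" for j z using w_upper[of 0 z j] by auto
  have w_meas [measurable]: "w j \<in> borel_measurable lebesgue" for j
    unfolding w_def[abs_def] by (rule borel_measurable_cSUP[OF countable_rat]) (measurable, rule bdd)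
  have w_lim: "(\<lambda>j. w j z) \<longlonglongrightarrow> 0" for z
  proof (rule LIMSEQ_I)
    fix e :: real assume e: "0 < e"
    have "uniformly_continuous_on {- C - 1..C + 1} (g z)"
      by (intro compact_uniformly_continuous continuous_on_subset[OF gc]) auto
    then obtain d where d: "0 < d" and
      *: "\<And>l m. l \<in> {- C - 1..C + 1} \<Longrightarrow> m \<in> {- C - 1..C + 1} \<Longrightarrow> dist m l < d \<Longrightarrow> dist (g z m) (g z l) < e / 2"
      unfolding uniformly_continuous_on_def using e by (meson half_gt_zero)
    obtain N where N: "inverse (real (Suc N)) < d" using reals_Archimedean d by blast
    show "\<exists>N. \<forall>j\<ge>N. norm (w j z - 0) < e"
    proof (intro exI allI impI)
      fix j assume "N \<le> j"
      then have "inverse (real (Suc j)) \<le> inverse (real (Suc N))" by (intro le_imp_inverse_le) auto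
      with N have jd: "1 / real (Suc j) < d" by (simp add: inverse_eq_divide)
      have "w j z \<le> e / 2" unfolding w_def
      proof (rule cSUP_least)
        fix q :: real assume "q \<in> \<rat>"
        have "1 / real (Suc j) \<le> 1" by simp
        with r_near[of j q] have "\<bar>r j q - clip C q\<bar> \<le> 1" by linarith
        then have "dist (g z (clip C q)) (g z (r j q)) < e / 2"
          using clip_bound[OF C, of q] r_near[of j q] jd
          by (intro *) (auto simp: dist_real_def abs_le_iff)
        then show "\<bar>g z q - g z (r j q)\<bar> \<le> e / 2" by (simp add: dist_real_def gclip)
      qed auto
      then show "norm (w j z - 0) < e" using e w0[of j z] by simp
    qed
  qed
  have w_int: "(\<lambda>j. \<integral>\<^sup>+z. ennreal (w j z) \<partial>lebesgue) \<longlonglongrightarrow> 0"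
  proof -
    have "(\<lambda>j. \<integral>\<^sup>+z. ennreal (w j z) \<partial>lebesgue) \<longlonglongrightarrow> (\<integral>\<^sup>+z. 0 \<partial>(lebesgue :: 'a measure))"
    proof (rule nn_integral_dominated_convergence[where w="\<lambda>z. ennreal (2 * F z)"])
      have "integrable lebesgue (\<lambda>z. 2 * F z)" using gF by simp
      then show "(\<integral>\<^sup>+z. ennreal (2 * F z) \<partial>lebesgue) < \<infinity>"
        unfolding integrable_iff_bounded using F0 by simp
      have "(\<lambda>j. ennreal (w j z)) \<longlonglongrightarrow> ennreal 0" for z
        using w_lim by (intro tendsto_ennrealI)
      then show "AE z in lebesgue. (\<lambda>j. ennreal (w j z)) \<longlonglongrightarrow> 0" by simp
      have [measurable]: "F \<in> borel_measurable lebesgue" using gF by auto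
      show "(\<lambda>z. ennreal (2 * F z)) \<in> borel_measurable lebesgue" by measurable
    qed (use w_le in \<open>auto intro!: ennreal_leI\<close>)
    then show ?thesis by simp
  qed
  have split: "sup_diff g z z' \<le> (w j z + w j z') + (\<Sum>p\<in>R j. \<bar>g z p - g z' p\<bar>)" for z z' j
    unfolding sup_diff_def
  proof (rule cSUP_least)
    fix q :: real assume q: "q \<in> \<rat>"
    have "\<bar>g z (r j q) - g z' (r j q)\<bar> \<le> (\<Sum>p\<in>R j. \<bar>g z p - g z' p\<bar>)"
      using finR by (intro member_le_sum[where f="\<lambda>p. \<bar>g z p - g z' p\<bar>"]) (auto simp: R_def)
    with w_upper[OF q, of z j] w_upper[OF q, of z' j]
    show "\<bar>g z q - g z' q\<bar> \<le> (w j z + w j z') + (\<Sum>p\<in>R j. \<bar>g z p - g z' p\<bar>)" by linarith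
  qed auto
  have bound: "(\<integral>\<^sup>+z. \<integral>\<^sup>+z'. ennreal (sup_diff g z z') * K n (z - z') \<partial>lebesgue \<partial>lebesgue)
      \<le> 2 * ennreal M * (\<integral>\<^sup>+z. ennreal (w j z) \<partial>lebesgue) + (\<Sum>p\<in>R j. mean_oscillation (K n) (\<lambda>z. g z p))" for n j
  proof -
    have m1: "(\<lambda>(z, z'). (ennreal (w j z) + ennreal (w j z')) * K n (z - z')) \<in> borel_measurable (lebesgue \<Otimes>\<^sub>M lebesgue)"
      unfolding split_beta by measurable
    have m2: "(\<lambda>(z, z'). \<Sum>p\<in>S. ennreal \<bar>g z p - g z' p\<bar> * K n (z - z')) \<in> borel_measurable (lebesgue \<Otimes>\<^sub>M lebesgue)" for S
      unfolding split_beta by measurable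
    have m3: "(\<lambda>(z, z'). ennreal \<bar>g z p - g z' p\<bar> * K n (z - z')) \<in> borel_measurable (lebesgue \<Otimes>\<^sub>M lebesgue)" for p
      unfolding split_beta by measurable
    have sum: "(\<integral>\<^sup>+z. \<integral>\<^sup>+z'. (\<Sum>p\<in>S. ennreal \<bar>g z p - g z' p\<bar> * K n (z - z')) \<partial>lebesgue \<partial>lebesgue)
        = (\<Sum>p\<in>S. mean_oscillation (K n) (\<lambda>z. g z p))" if "finite S" for S
      using that
    proof (induction S rule: finite_induct)
      case (insert p S)
      then show ?case
        using nn_integral_add_iterated[OF m3[of p] m2[of S]] by (simp add: mean_oscillation_def)
    qed simp
    have "(\<integral>\<^sup>+z. \<integral>\<^sup>+z'. ennreal (sup_diff g z z') * K n (z - z') \<partial>lebesgue \<partial>lebesgue)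
      \<le> (\<integral>\<^sup>+z. \<integral>\<^sup>+z'. (ennreal (w j z) + ennreal (w j z')) * K n (z - z') +
           (\<Sum>p\<in>R j. ennreal \<bar>g z p - g z' p\<bar> * K n (z - z')) \<partial>lebesgue \<partial>lebesgue)"
    proof (intro nn_integral_mono)
      fix z z' :: 'a
      have "ennreal (sup_diff g z z') \<le> (ennreal (w j z) + ennreal (w j z')) + (\<Sum>p\<in>R j. ennreal \<bar>g z p - g z' p\<bar>)"
        using split[of z z' j] by (simp add: w0 sum_nonneg sum_ennreal ennreal_leI flip: ennreal_plus)
      then have "ennreal (sup_diff g z z') * K n (z - z')
        \<le> ((ennreal (w j z) + ennreal (w j z')) + (\<Sum>p\<in>R j. ennreal \<bar>g z p - g z' p\<bar>)) * K n (z - z')"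
        by (intro mult_right_mono) auto
      then show "ennreal (sup_diff g z z') * K n (z - z')
        \<le> (ennreal (w j z) + ennreal (w j z')) * K n (z - z') + (\<Sum>p\<in>R j. ennreal \<bar>g z p - g z' p\<bar> * K n (z - z'))"
        by (simp only: ring_distribs(2)[of "_ + _"] sum_distrib_right)
    qed
    also have "\<dots> = (\<integral>\<^sup>+z. \<integral>\<^sup>+z'. (ennreal (w j z) + ennreal (w j z')) * K n (z - z') \<partial>lebesgue \<partial>lebesgue)
        + (\<Sum>p\<in>R j. mean_oscillation (K n) (\<lambda>z. g z p))"
      unfolding nn_integral_add_iterated[OF m1 m2] sum[OF finR] ..
    also have "(\<integral>\<^sup>+z. \<integral>\<^sup>+z'. (ennreal (w j z) + ennreal (w j z')) * K n (z - z') \<partial>lebesgue \<partial>lebesgue)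
        = 2 * (\<integral>\<^sup>+z. K n z \<partial>lborel) * (\<integral>\<^sup>+z. ennreal (w j z) \<partial>lebesgue)"
      by (rule nn_integral_kernel_symmetric[OF k]) measurable
    also have "\<dots> \<le> 2 * ennreal M * (\<integral>\<^sup>+z. ennreal (w j z) \<partial>lebesgue)"
      by (intro mult_right_mono mult_left_mono mass) auto
    finally show ?thesis by (simp add: add_right_mono)
  qed
  show ?thesis
  proof (rule order_tendstoI)
    fix y :: ennreal assume y: "0 < y"
    have "(\<lambda>j. 2 * ennreal M * (\<integral>\<^sup>+z. ennreal (w j z) \<partial>lebesgue)) \<longlonglongrightarrow> 2 * ennreal M * 0"
      by (intro tendsto_mult_ennreal tendsto_const w_int) (auto simp: ennreal_mult_eq_top_iff)
    then have "\<forall>\<^sub>F j in sequentially. 2 * ennreal M * (\<integral>\<^sup>+z. ennreal (w j z) \<partial>lebesgue) < y"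
      using y by (intro order_tendstoD(2)) auto
    then obtain j where j: "2 * ennreal M * (\<integral>\<^sup>+z. ennreal (w j z) \<partial>lebesgue) < y"
      by (auto simp: eventually_sequentially)
    have "(\<lambda>n. mean_oscillation (K n) (\<lambda>z. g z p)) \<longlonglongrightarrow> 0" for p
    proof (rule mean_oscillation_tendsto_0[OF K _ M])
      show "integrable lebesgue (\<lambda>z. g z p)"
        by (rule Bochner_Integration.integrable_bound[OF gF]) (use gb F0 in auto)
    qed
    then have "(\<lambda>n. \<Sum>p\<in>R j. mean_oscillation (K n) (\<lambda>z. g z p)) \<longlonglongrightarrow> (\<Sum>p\<in>R j. 0)"
      by (intro tendsto_sum)
    then have "(\<lambda>n. 2 * ennreal M * (\<integral>\<^sup>+z. ennreal (w j z) \<partial>lebesgue) + (\<Sum>p\<in>R j. mean_oscillation (K n) (\<lambda>z. g z p)))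
      \<longlonglongrightarrow> 2 * ennreal M * (\<integral>\<^sup>+z. ennreal (w j z) \<partial>lebesgue) + 0"
      by (intro tendsto_add tendsto_const) simp
    then have "\<forall>\<^sub>F n in sequentially. 2 * ennreal M * (\<integral>\<^sup>+z. ennreal (w j z) \<partial>lebesgue) + (\<Sum>p\<in>R j. mean_oscillation (K n) (\<lambda>z. g z p)) < y"
      using j by (intro order_tendstoD(2)) auto
    then show "\<forall>\<^sub>F n in sequentially. (\<integral>\<^sup>+z. \<integral>\<^sup>+z'. ennreal (sup_diff g z z') * K n (z - z') \<partial>lebesgue \<partial>lebesgue) < y"
      by eventually_elim (rule order.strict_trans1[OF bound[of _ j]])
  qed auto
qed

end

section \<open>Integration against products of Young measures\<close>

lemma integrable_product_functions:
  fixes u :: "'a::euclidean_space \<Rightarrow> real" and v :: "'b::euclidean_space \<Rightarrow> real"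
  assumes u: "integrable lebesgue u" and v: "integrable lebesgue v"
  shows "integrable (lebesgue \<Otimes>\<^sub>M lebesgue) (\<lambda>(z, z'). u z * v z')"
proof -
  have [measurable]: "u \<in> borel_measurable lebesgue" "v \<in> borel_measurable lebesgue"
    using u v by auto
  show ?thesis
  proof (rule leb_pair.Fubini_integrable)
    show "(\<lambda>(z, z'). u z * v z') \<in> borel_measurable (lebesgue \<Otimes>\<^sub>M lebesgue)" by measurable
    have "integrable lebesgue (\<lambda>z. \<bar>u z\<bar> * (\<integral>z'. \<bar>v z'\<bar> \<partial>lebesgue))" using u by auto
    then show "integrable lebesgue (\<lambda>z. \<integral>z'. norm (case (z, z') of (z, z') \<Rightarrow> u z * v z') \<partial>lebesgue)"
      by (simp add: abs_mult)
    show "AE z in lebesgue. integrable lebesgue (\<lambda>z'. case (z, z') of (z, z') \<Rightarrow> u z * v z')"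
      using v by auto
  qed
qed

lemma prob_kernelD:
  assumes "N \<in> M \<rightarrow>\<^sub>M prob_algebra R" "z \<in> space M"
  shows "prob_space (N z)" "sets (N z) = sets R" "space (N z) = space R"
  using measurable_space[OF assms] by (auto simp: space_prob_algebra dest: sets_eq_imp_space_eq)

lemma integral_prob_bound:
  fixes h :: "'a \<Rightarrow> real"
  assumes "prob_space M" "\<And>x. \<bar>h x\<bar> \<le> b"
  shows "\<bar>\<integral>x. h x \<partial>M\<bar> \<le> b"
proof -
  interpret prob_space M by fact
  have b: "0 \<le> b" using assms(2)[of undefined] by linarith
  show ?thesis
  proof (cases "integrable M h")
    case True
    have "\<bar>\<integral>x. h x \<partial>M\<bar> \<le> (\<integral>x. \<bar>h x\<bar> \<partial>M)"
      using integral_norm_bound[of M h] by simp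
    also have "\<dots> \<le> (\<integral>x. b \<partial>M)"
      using True assms(2) by (intro integral_mono) auto
    finally show ?thesis by (simp add: prob_space)
  qed (simp add: not_integrable_integral_eq b)
qed

lemma integrable_prob_bounded:
  fixes h :: "'a \<Rightarrow> real"
  assumes "prob_space M" "h \<in> borel_measurable M" "\<And>x. \<bar>h x\<bar> \<le> b"
  shows "integrable M h"
proof -
  interpret prob_space M by fact
  show ?thesis using assms by (intro integrable_const_bound[of _ b]) auto
qed

text \<open>The integrand may depend on the base point as well; pushing the measure forward to the product
  reduces this to the integral of a fixed function.\<close>

lemma borel_measurable_kernel_integral:
  fixes h :: "'a \<Rightarrow> 'b \<Rightarrow> real"
  assumes "N \<in> M \<rightarrow>\<^sub>M prob_algebra R" "(\<lambda>(x, y). h x y) \<in> borel_measurable (M \<Otimes>\<^sub>M R)"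
  shows "(\<lambda>x. \<integral>y. h x y \<partial>N x) \<in> borel_measurable M"
proof -
  note [measurable] = measurable_prob_algebraD[OF assms(1)] assms(2)
  have "(\<lambda>x. distr (N x) (M \<Otimes>\<^sub>M R) (\<lambda>y. (x, y))) \<in> M \<rightarrow>\<^sub>M subprob_algebra (M \<Otimes>\<^sub>M R)"
    by (rule measurable_distr2[OF _ measurable_prob_algebraD[OF assms(1)]]) measurable
  from measurable_compose[OF this integral_measurable_subprob_algebra[OF assms(2)]]
  show ?thesis
  proof (rule measurable_cong[THEN iffD1, rotated])
    fix x assume "x \<in> space M"
    have "Pair x \<in> N x \<rightarrow>\<^sub>M M \<Otimes>\<^sub>M R"
      using measurable_Pair1'[OF \<open>x \<in> space M\<close>, of R] prob_kernelD(2)[OF assms(1) \<open>x \<in> space M\<close>]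
      by (simp cong: measurable_cong_sets)
    then show "(\<integral>p. (case p of (x, y) \<Rightarrow> h x y) \<partial>distr (N x) (M \<Otimes>\<^sub>M R) (Pair x)) = (\<integral>y. h x y \<partial>N x)"
      by (subst integral_distr[OF _ assms(2)]) simp_all
  qed
qed

context
  fixes N S :: "'a::euclidean_space \<Rightarrow> real measure"
  assumes N [measurable]: "N \<in> lebesgue \<rightarrow>\<^sub>M prob_algebra borel"
    and S [measurable]: "S \<in> lebesgue \<rightarrow>\<^sub>M prob_algebra borel"
begin

text \<open>The Young measures at two points are independent of each other: the pair of states at
  \<open>(z, z')\<close> is distributed according to the product of the measures at \<open>z\<close> and at \<open>z'\<close>.\<close>

lemma product_kernel_measurable [measurable]:
  "(\<lambda>p. N (fst p) \<Otimes>\<^sub>M S (snd p)) \<in> lebesgue \<Otimes>\<^sub>M lebesgue \<rightarrow>\<^sub>M prob_algebra (borel \<Otimes>\<^sub>M borel)"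
  by (intro measurable_pair_prob measurable_compose[OF measurable_fst N] measurable_compose[OF measurable_snd S])

lemma kernel_space [simp]: "prob_space (N z)" "prob_space (S z)"
    "sets (N z) = sets borel" "sets (S z) = sets borel" "space (N z) = UNIV" "space (S z) = UNIV"
  using prob_kernelD[OF N, of z] prob_kernelD[OF S, of z] by auto

lemma product_integral_measurable:
  fixes P :: "'a \<Rightarrow> 'a \<Rightarrow> real \<Rightarrow> real \<Rightarrow> real"
  assumes "(\<lambda>(p, q). P (fst p) (snd p) (fst q) (snd q)) \<in> borel_measurable ((lebesgue \<Otimes>\<^sub>M lebesgue) \<Otimes>\<^sub>M (borel \<Otimes>\<^sub>M borel))"
  shows "(\<lambda>p. \<integral>q. P (fst p) (snd p) (fst q) (snd q) \<partial>(N (fst p) \<Otimes>\<^sub>M S (snd p))) \<in> borel_measurable (lebesgue \<Otimes>\<^sub>M lebesgue)"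
  using borel_measurable_kernel_integral[OF product_kernel_measurable, of "\<lambda>p q. P (fst p) (snd p) (fst q) (snd q)"] assms
  by (simp add: case_prod_unfold)

lemma product_integral_integrable:
  fixes P :: "'a \<Rightarrow> 'a \<Rightarrow> real \<Rightarrow> real \<Rightarrow> real"
  assumes Pm: "(\<lambda>(p, q). P (fst p) (snd p) (fst q) (snd q)) \<in> borel_measurable ((lebesgue \<Otimes>\<^sub>M lebesgue) \<Otimes>\<^sub>M (borel \<Otimes>\<^sub>M borel))"
    and Pb: "\<And>z z' l m. \<bar>P z z' l m\<bar> \<le> b z z'"
    and b: "integrable (lebesgue \<Otimes>\<^sub>M lebesgue) (\<lambda>(z, z'). b z z')"
  shows "integrable (lebesgue \<Otimes>\<^sub>M lebesgue) (\<lambda>p. \<integral>q. P (fst p) (snd p) (fst q) (snd q) \<partial>(N (fst p) \<Otimes>\<^sub>M S (snd p)))"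
proof (rule Bochner_Integration.integrable_bound[OF b])
  show "(\<lambda>p. \<integral>q. P (fst p) (snd p) (fst q) (snd q) \<partial>(N (fst p) \<Otimes>\<^sub>M S (snd p))) \<in> borel_measurable (lebesgue \<Otimes>\<^sub>M lebesgue)"
    by (rule product_integral_measurable[OF Pm])
  have "\<bar>\<integral>q. P z z' (fst q) (snd q) \<partial>(N z \<Otimes>\<^sub>M S z')\<bar> \<le> \<bar>b z z'\<bar>" for z z'
    by (rule integral_prob_bound) (auto intro: prob_space_pair order_trans[OF Pb])
  then show "AE p in lebesgue \<Otimes>\<^sub>M lebesgue. norm (\<integral>q. P (fst p) (snd p) (fst q) (snd q) \<partial>(N (fst p) \<Otimes>\<^sub>M S (snd p)))
      \<le> norm (case p of (z, z') \<Rightarrow> b z z')"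
    by (auto simp: case_prod_unfold)
qed

text \<open>The inequality for the first solution is known for each fixed \<open>z'\<close> and each fixed comparison
  state \<open>m\<close>. Integrating it in \<open>m\<close> against the second Young measure at \<open>z'\<close>, and then in \<open>z'\<close>,
  gives the doubled inequality once the integrals are put in the right order.\<close>

lemma doubled_integral_nonneg:
  fixes P :: "'a \<Rightarrow> 'a \<Rightarrow> real \<Rightarrow> real \<Rightarrow> real"
  assumes Pm: "(\<lambda>(p, q). P (fst p) (snd p) (fst q) (snd q)) \<in> borel_measurable ((lebesgue \<Otimes>\<^sub>M lebesgue) \<Otimes>\<^sub>M (borel \<Otimes>\<^sub>M borel))"
    and Pb: "\<And>z z' l m. \<bar>P z z' l m\<bar> \<le> b z z'"
    and b: "integrable (lebesgue \<Otimes>\<^sub>M lebesgue) (\<lambda>(z, z'). b z z')"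
    and nonneg: "\<And>z'. AE m in S z'. 0 \<le> (\<integral>z. (\<integral>l. P z z' l m \<partial>N z) \<partial>lebesgue)"
  shows "0 \<le> (\<integral>p. (\<integral>q. P (fst p) (snd p) (fst q) (snd q) \<partial>(N (fst p) \<Otimes>\<^sub>M S (snd p))) \<partial>(lebesgue \<Otimes>\<^sub>M lebesgue))"
proof -
  let ?p = "\<lambda>z z'. \<integral>q. P z z' (fst q) (snd q) \<partial>(N z \<Otimes>\<^sub>M S z')"
  have int: "integrable (lebesgue \<Otimes>\<^sub>M lebesgue) (\<lambda>(z, z'). ?p z z')"
    using product_integral_integrable[OF Pm Pb b] by (simp add: case_prod_unfold)
  have "AE z' in lebesgue. integrable lebesgue (\<lambda>z. b z z')"
    using leb_pair.AE_integrable_snd[OF b] by simp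
  then have "AE z' in lebesgue. 0 \<le> (\<integral>z. ?p z z' \<partial>lebesgue)"
  proof eventually_elim
    case (elim z')
    interpret S: prob_space "S z'" by simp
    interpret X: pair_sigma_finite "lebesgue :: 'a measure" "S z'"
      by (simp add: pair_sigma_finite_def sigma_finite_lebesgue S.sigma_finite_measure_axioms)
    have Pm3: "(\<lambda>(w, l). P (fst w) z' l (snd w)) \<in> borel_measurable ((lebesgue \<Otimes>\<^sub>M borel) \<Otimes>\<^sub>M borel)"
    proof -
      have "(\<lambda>w. ((fst (fst w), z'), (snd w, snd (fst w)))) \<in>
          (lebesgue \<Otimes>\<^sub>M borel) \<Otimes>\<^sub>M borel \<rightarrow>\<^sub>M (lebesgue \<Otimes>\<^sub>M lebesgue) \<Otimes>\<^sub>M (borel \<Otimes>\<^sub>M borel)"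
        by (intro measurable_Pair measurable_compose[OF measurable_fst measurable_fst]
             measurable_compose[OF measurable_fst measurable_snd] measurable_snd measurable_const) auto
      from measurable_compose[OF this Pm] show ?thesis by (simp add: case_prod_unfold)
    qed
    have Pm2: "(\<lambda>q. P z z' (fst q) (snd q)) \<in> borel_measurable (borel \<Otimes>\<^sub>M borel)" for z
    proof -
      have "(\<lambda>q. ((z, z'), q)) \<in> borel \<Otimes>\<^sub>M borel \<rightarrow>\<^sub>M (lebesgue \<Otimes>\<^sub>M lebesgue) \<Otimes>\<^sub>M (borel \<Otimes>\<^sub>M borel)"
        by (intro measurable_Pair measurable_const) (auto simp: space_pair_measure)
      from measurable_compose[OF this Pm] show ?thesis by (simp add: case_prod_unfold)
    qed
    have Pm2': "(\<lambda>q. P z z' (fst q) (snd q)) \<in> borel_measurable (N z \<Otimes>\<^sub>M S z')" for z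
      using Pm2[of z] by (simp cong: measurable_cong_sets sets_pair_measure_cong)
    let ?q = "\<lambda>z m. \<integral>l. P z z' l m \<partial>N z"
    have q_meas: "(\<lambda>w. ?q (fst w) (snd w)) \<in> borel_measurable (lebesgue \<Otimes>\<^sub>M borel)"
      by (rule borel_measurable_kernel_integral[OF measurable_compose[OF measurable_fst N] Pm3])
    have "?p z z' = (\<integral>m. ?q z m \<partial>S z')" for z
    proof -
      interpret N: prob_space "N z" by simp
      interpret Y: pair_sigma_finite "N z" "S z'"
        by (simp add: pair_sigma_finite_def N.sigma_finite_measure_axioms S.sigma_finite_measure_axioms)
      have "integrable (N z \<Otimes>\<^sub>M S z') (\<lambda>q. P z z' (fst q) (snd q))"
        by (rule integrable_prob_bounded[OF _ Pm2' Pb]) (simp add: prob_space_pair)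
      from Y.integral_snd[of "\<lambda>l m. P z z' l m"] this show ?thesis by (simp add: case_prod_unfold)
    qed
    then have "(\<integral>z. ?p z z' \<partial>lebesgue) = (\<integral>z. (\<integral>m. ?q z m \<partial>S z') \<partial>lebesgue)" by simp
    also have "\<dots> = (\<integral>m. (\<integral>z. ?q z m \<partial>lebesgue) \<partial>S z')"
    proof (rule X.Fubini_integral[symmetric])
      have q_meas': "(\<lambda>(z, m). ?q z m) \<in> borel_measurable (lebesgue \<Otimes>\<^sub>M S z')"
        using q_meas by (simp add: case_prod_unfold cong: measurable_cong_sets sets_pair_measure_cong)
      have qb: "\<bar>?q z m\<bar> \<le> b z z'" for z m
        by (rule integral_prob_bound) (auto intro: Pb)
      show "integrable (lebesgue \<Otimes>\<^sub>M S z') (\<lambda>(z, m). ?q z m)"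
      proof (rule X.Fubini_integrable[OF q_meas'])
        have q2: "(\<lambda>m. ?q z m) \<in> borel_measurable (S z')" for z
          using measurable_Pair2[OF q_meas', of z] by simp
        show "AE z in lebesgue. integrable (S z') (\<lambda>m. case (z, m) of (z, m) \<Rightarrow> ?q z m)"
          using integrable_prob_bounded[OF _ q2 qb] by simp
        show "integrable lebesgue (\<lambda>z. \<integral>m. norm (case (z, m) of (z, m) \<Rightarrow> ?q z m) \<partial>S z')"
        proof (rule Bochner_Integration.integrable_bound[OF elim])
          have "(\<lambda>(z, m). norm (?q z m)) \<in> borel_measurable (lebesgue \<Otimes>\<^sub>M S z')"
            using measurable_compose[OF q_meas' borel_measurable_norm] by (simp add: case_prod_unfold)
          from S.borel_measurable_lebesgue_integral[OF this]
          show "(\<lambda>z. \<integral>m. norm (case (z, m) of (z, m) \<Rightarrow> ?q z m) \<partial>S z') \<in> borel_measurable lebesgue"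
            by simp
          have "\<bar>\<integral>m. \<bar>?q z m\<bar> \<partial>S z'\<bar> \<le> \<bar>b z z'\<bar>" for z
            by (rule integral_prob_bound) (auto intro: order_trans[OF qb])
          then show "AE z in lebesgue. norm (\<integral>m. norm (case (z, m) of (z, m) \<Rightarrow> ?q z m) \<partial>S z') \<le> norm (b z z')"
            by simp
        qed
      qed
    qed
    also have "\<dots> \<ge> 0" by (intro integral_nonneg_AE nonneg)
    finally show ?case .
  qed
  then have "0 \<le> (\<integral>z'. (\<integral>z. ?p z z' \<partial>lebesgue) \<partial>lebesgue)" by (rule integral_nonneg_AE)
  also have "\<dots> = (\<integral>p. (case p of (z, z') \<Rightarrow> ?p z z') \<partial>(lebesgue \<Otimes>\<^sub>M lebesgue))"
    by (rule leb_pair.integral_snd[OF int])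
  finally show ?thesis by (simp add: case_prod_unfold)
qed

end

text \<open>The same for the second solution, by exchanging the roles of the two points and of the two states.\<close>

lemma doubled_integral_nonneg':
  fixes P :: "'a::euclidean_space \<Rightarrow> 'a \<Rightarrow> real \<Rightarrow> real \<Rightarrow> real"
  assumes N: "N \<in> lebesgue \<rightarrow>\<^sub>M prob_algebra borel" and S: "S \<in> lebesgue \<rightarrow>\<^sub>M prob_algebra borel"
    and Pm: "(\<lambda>(p, q). P (fst p) (snd p) (fst q) (snd q)) \<in> borel_measurable ((lebesgue \<Otimes>\<^sub>M lebesgue) \<Otimes>\<^sub>M (borel \<Otimes>\<^sub>M borel))"
    and Pb: "\<And>z z' l m. \<bar>P z z' l m\<bar> \<le> b z z'"
    and b: "integrable (lebesgue \<Otimes>\<^sub>M lebesgue) (\<lambda>(z, z'). b z z')"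
    and nonneg: "\<And>z. AE l in N z. 0 \<le> (\<integral>z'. (\<integral>m. P z z' l m \<partial>S z') \<partial>lebesgue)"
  shows "0 \<le> (\<integral>p. (\<integral>q. P (fst p) (snd p) (fst q) (snd q) \<partial>(N (fst p) \<Otimes>\<^sub>M S (snd p))) \<partial>(lebesgue \<Otimes>\<^sub>M lebesgue))"
proof -
  note sp [simp] = kernel_space[OF N S]
  have sw: "(\<lambda>w. ((snd (fst w), fst (fst w)), (snd (snd w), fst (snd w)))) \<in>
      (lebesgue \<Otimes>\<^sub>M lebesgue) \<Otimes>\<^sub>M (borel \<Otimes>\<^sub>M borel) \<rightarrow>\<^sub>M (lebesgue \<Otimes>\<^sub>M lebesgue) \<Otimes>\<^sub>M (borel \<Otimes>\<^sub>M borel)"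
    by (intro measurable_Pair measurable_compose[OF measurable_fst measurable_fst]
         measurable_compose[OF measurable_fst measurable_snd] measurable_compose[OF measurable_snd measurable_fst]
         measurable_compose[OF measurable_snd measurable_snd])
  have Pm': "(\<lambda>(p, q). P (snd p) (fst p) (snd q) (fst q)) \<in> borel_measurable ((lebesgue \<Otimes>\<^sub>M lebesgue) \<Otimes>\<^sub>M (borel \<Otimes>\<^sub>M borel))"
    using measurable_compose[OF sw Pm] by (simp add: case_prod_unfold)
  have b': "integrable (lebesgue \<Otimes>\<^sub>M lebesgue) (\<lambda>(z', z). b z z')"
    using leb_pair.integrable_product_swap[OF b] by simp
  have "0 \<le> (\<integral>p. (\<integral>q. P (snd p) (fst p) (snd q) (fst q) \<partial>(S (fst p) \<Otimes>\<^sub>M N (snd p))) \<partial>(lebesgue \<Otimes>\<^sub>M lebesgue))"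
    by (rule doubled_integral_nonneg[OF S N, of "\<lambda>z' z m l. P z z' l m", OF Pm' Pb b' nonneg])
  also have "(\<lambda>p. \<integral>q. P (snd p) (fst p) (snd q) (fst q) \<partial>(S (fst p) \<Otimes>\<^sub>M N (snd p)))
      = (\<lambda>(z', z). \<integral>q. P z z' (fst q) (snd q) \<partial>(N z \<Otimes>\<^sub>M S z'))"
  proof (rule ext, clarsimp simp: case_prod_unfold)
    fix z' z
    interpret N: prob_space "N z" by simp
    interpret S: prob_space "S z'" by simp
    interpret Y: pair_sigma_finite "N z" "S z'"
      by (simp add: pair_sigma_finite_def N.sigma_finite_measure_axioms S.sigma_finite_measure_axioms)
    have "(\<lambda>q. ((z, z'), q)) \<in> borel \<Otimes>\<^sub>M borel \<rightarrow>\<^sub>M (lebesgue \<Otimes>\<^sub>M lebesgue) \<Otimes>\<^sub>M (borel \<Otimes>\<^sub>M borel)"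
      by (intro measurable_Pair measurable_const) (auto simp: space_pair_measure)
    from measurable_compose[OF this Pm]
    have "(\<lambda>(l, m). P z z' l m) \<in> borel_measurable (N z \<Otimes>\<^sub>M S z')"
      by (simp add: case_prod_unfold cong: measurable_cong_sets sets_pair_measure_cong)
    from Y.integral_product_swap[OF this]
    show "(\<integral>q. P z z' (snd q) (fst q) \<partial>(S z' \<Otimes>\<^sub>M N z)) = (\<integral>q. P z z' (fst q) (snd q) \<partial>(N z \<Otimes>\<^sub>M S z'))"
      by (simp add: case_prod_unfold)
  qed
  also have "(\<integral>p. (case p of (z', z) \<Rightarrow> \<integral>q. P z z' (fst q) (snd q) \<partial>(N z \<Otimes>\<^sub>M S z')) \<partial>(lebesgue \<Otimes>\<^sub>M lebesgue))
    = (\<integral>p. (\<integral>q. P (fst p) (snd p) (fst q) (snd q) \<partial>(N (fst p) \<Otimes>\<^sub>M S (snd p))) \<partial>(lebesgue \<Otimes>\<^sub>M lebesgue))"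
    using leb_pair.integral_product_swap[OF product_integral_measurable[OF N S Pm]] by (simp add: case_prod_unfold)
  finally show ?thesis .
qed

section \<open>Product structure of Lebesgue measure on space-time\<close>

text \<open>Lebesgue measure on the product is the completion of the product of the Borel measures, so that a
  Lebesgue measurable factor has to be replaced by a Borel representative before Fubini applies.\<close>

lemma null_sets_vimage_snd:
  assumes "n \<in> null_sets (lborel :: 'b::euclidean_space measure)"
  shows "(UNIV :: 'c::euclidean_space set) \<times> n \<in> null_sets lborel"
proof -
  have n: "n \<in> sets borel" "emeasure lborel n = 0" using assms by (auto simp: null_sets_def)
  have "emeasure (lborel \<Otimes>\<^sub>M lborel) ((UNIV :: 'c set) \<times> n) = emeasure lborel (UNIV :: 'c set) * emeasure lborel n"
    using n by (intro lborel.emeasure_pair_measure_Times) auto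
  then show ?thesis using n by (auto simp: lborel_prod null_sets_def borel_Times)
qed

lemma AE_lebesgue_snd:
  assumes "AE x in lebesgue. P (x :: 'b::euclidean_space)"
  shows "AE z in lebesgue. P (snd (z :: 'c::euclidean_space \<times> 'b))"
proof -
  have "AE x in lborel. P x" using assms by (simp add: AE_completion_iff)
  from AE_E[OF this] obtain n where "{x \<in> space lborel. \<not> P x} \<subseteq> n" "emeasure lborel n = 0" "n \<in> sets lborel" .
  then have n: "n \<in> null_sets lborel" "{x. \<not> P x} \<subseteq> n" by auto
  have "AE z in lborel. z \<notin> (UNIV :: 'c set) \<times> n"
    by (rule AE_not_in[OF null_sets_vimage_snd[OF n(1)]])
  then have "AE z in lborel. P (snd (z :: 'c \<times> 'b))"
    by eventually_elim (use n(2) in auto)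
  then show ?thesis by (rule AE_completion)
qed

lemma measurable_snd_lebesgue_lebesgue [measurable]:
  "snd \<in> (lebesgue :: ('c::euclidean_space \<times> 'b::euclidean_space) measure) \<rightarrow>\<^sub>M lebesgue"
proof (rule measurableI)
  fix A :: "'b set" assume "A \<in> sets lebesgue"
  then obtain S N N' where A: "A = S \<union> N" "N \<subseteq> N'" "N' \<in> null_sets lborel" "S \<in> sets lborel"
    by (rule sets_completionE)
  have "(snd :: 'c \<times> 'b \<Rightarrow> 'b) -` A = UNIV \<times> S \<union> UNIV \<times> N" using A(1) by auto
  moreover have "UNIV \<times> S \<union> UNIV \<times> N \<in> sets (lebesgue :: ('c \<times> 'b) measure)"
    by (rule sets_completionI[OF refl _ null_sets_vimage_snd[OF A(3)]]) (use A in \<open>auto simp: borel_Times\<close>)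
  ultimately show "(snd :: 'c \<times> 'b \<Rightarrow> 'b) -` A \<inter> space lebesgue \<in> sets lebesgue" by simp
qed auto

lemma nn_integral_lebesgue_product:
  fixes u :: "'c::euclidean_space \<Rightarrow> ennreal" and v :: "'b::euclidean_space \<Rightarrow> ennreal"
  assumes u [measurable]: "u \<in> borel_measurable borel" and v: "v \<in> borel_measurable lebesgue"
  shows "(\<integral>\<^sup>+z. u (fst z) * v (snd z) \<partial>lebesgue) = (\<integral>\<^sup>+t. u t \<partial>lebesgue) * (\<integral>\<^sup>+x. v x \<partial>lebesgue)"
proof -
  obtain v' where v' [measurable]: "v' \<in> borel_measurable lborel" and eq: "AE x in lborel. v x = v' x"
    using completion_ex_borel_measurable[OF v] by blast
  have [measurable]: "v' \<in> borel_measurable borel" using v' by simp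
  have "AE z in (lebesgue :: ('c \<times> 'b) measure). v (snd z) = v' (snd z)"
    by (rule AE_lebesgue_snd[OF AE_completion[OF eq]])
  then have "(\<integral>\<^sup>+z. u (fst z) * v (snd z) \<partial>lebesgue) = (\<integral>\<^sup>+z. u (fst z) * v' (snd z) \<partial>(lebesgue :: ('c \<times> 'b) measure))"
    by (intro nn_integral_cong_AE) auto
  also have "\<dots> = (\<integral>\<^sup>+z. u (fst z) * v' (snd z) \<partial>(lborel \<Otimes>\<^sub>M lborel))"
    by (simp only: nn_integral_completion lborel_prod)
  also have "\<dots> = (\<integral>\<^sup>+t. \<integral>\<^sup>+x. u t * v' x \<partial>lborel \<partial>lborel)"
    by (subst lborel.nn_integral_fst[symmetric]) auto
  also have "\<dots> = (\<integral>\<^sup>+t. u t \<partial>lborel) * (\<integral>\<^sup>+x. v' x \<partial>lborel)"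
    by (simp add: nn_integral_cmult nn_integral_multc)
  also have "(\<integral>\<^sup>+x. v' x \<partial>lborel) = (\<integral>\<^sup>+x. v x \<partial>lebesgue)"
    using eq by (auto simp: nn_integral_completion intro!: nn_integral_cong_AE)
  finally show ?thesis by (simp add: nn_integral_completion)
qed

section \<open>The doubled entropy inequality\<close>

text \<open>The integrand of Kruzhkov's entropy inequality for the state \<open>l\<close>, the comparison state \<open>m\<close> and a
  test function with value \<open>\<phi>\<close>, time derivative \<open>\<phi>t\<close> and spatial gradient \<open>\<phi>x\<close> at the point.\<close>

definition kruzhkov_integrand ::
    "(real \<Rightarrow> 'b::euclidean_space) \<Rightarrow> (real \<Rightarrow> real) \<Rightarrow> (real \<Rightarrow> real) \<Rightarrow> real \<Rightarrow> 'b \<Rightarrow> real \<Rightarrow> real \<Rightarrow> real \<Rightarrow> real" where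
  "kruzhkov_integrand A e f \<phi>t \<phi>x \<phi> l m =
     \<bar>e l - e m\<bar> * \<phi>t + (sgn (l - m) *\<^sub>R (A l - A m)) \<bullet> \<phi>x + sgn (l - m) * f l * \<phi>"

text \<open>The integrand that remains when the two points coincide. For a nonincreasing source
  \<open>sgn (l - m) * (f l - f m) = - \<bar>f l - f m\<bar>\<close>, which unlike the single terms is continuous
  across the diagonal \<open>l = m\<close>.\<close>

definition comparison_integrand ::
    "(real \<Rightarrow> 'b::euclidean_space) \<Rightarrow> (real \<Rightarrow> real) \<Rightarrow> (real \<Rightarrow> real) \<Rightarrow> real \<Rightarrow> 'b \<Rightarrow> real \<Rightarrow> real \<Rightarrow> real \<Rightarrow> real" where
  "comparison_integrand A e f \<phi>t \<phi>x \<phi> l m =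
     \<bar>e l - e m\<bar> * \<phi>t + (sgn (l - m) *\<^sub>R (A l - A m)) \<bullet> \<phi>x - \<bar>f l - f m\<bar> * \<phi>"

text \<open>The Kruzhkov flux has no jump on the diagonal.\<close>

lemma kruzhkov_flux_max_min: "sgn (l - m) *\<^sub>R (A l - A m) = A (max l m) - A (min l m :: real)"
  for A :: "real \<Rightarrow> 'b::real_vector"
  by (cases l m rule: linorder_cases) (auto simp: max_def min_def)

lemma abs_sgn_le_1: "\<bar>sgn (x::real)\<bar> \<le> 1"
  by (simp add: abs_sgn_eq)

lemma flux_term_bound:
  fixes A :: "real \<Rightarrow> 'b::euclidean_space"
  assumes "\<And>l. norm (A l) \<le> Q"
  shows "\<bar>(sgn (l - m) *\<^sub>R (A l - A m)) \<bullet> w\<bar> \<le> 2 * Q * norm w"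
proof -
  have "norm (A l - A m) \<le> 2 * Q"
    using norm_triangle_ineq4[of "A l" "A m"] assms[of l] assms[of m] by linarith
  then have "\<bar>sgn (l - m)\<bar> * norm (A l - A m) \<le> 1 * (2 * Q)"
    by (intro mult_mono abs_sgn_le_1) auto
  then have "norm (sgn (l - m) *\<^sub>R (A l - A m)) * norm w \<le> 2 * Q * norm w"
    by (intro mult_right_mono) auto
  then show ?thesis using Cauchy_Schwarz_ineq2[of "sgn (l - m) *\<^sub>R (A l - A m)" w] by linarith
qed

lemma diff_term_bound:
  fixes e :: "real \<Rightarrow> real"
  assumes "\<And>l. \<bar>e l\<bar> \<le> B" shows "\<bar>\<bar>e l - e m\<bar> * w\<bar> \<le> 2 * B * \<bar>w\<bar>"
  unfolding abs_mult using assms[of l] assms[of m] by (intro mult_right_mono) linarith+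

lemma kruzhkov_integrand_bound:
  fixes A :: "real \<Rightarrow> 'b::euclidean_space"
  assumes "\<And>l. \<bar>e l\<bar> \<le> B" "\<And>l. norm (A l) \<le> Q" "\<And>l. \<bar>f l\<bar> \<le> F"
  shows "\<bar>kruzhkov_integrand A e f \<phi>t \<phi>x \<phi> l m\<bar> \<le> 2 * B * \<bar>\<phi>t\<bar> + 2 * Q * norm \<phi>x + F * \<bar>\<phi>\<bar>"
proof -
  have "\<bar>sgn (l - m) * f l\<bar> \<le> 1 * F"
    unfolding abs_mult using assms(3)[of l] by (intro mult_mono abs_sgn_le_1) auto
  then have "\<bar>sgn (l - m) * f l * \<phi>\<bar> \<le> F * \<bar>\<phi>\<bar>"
    unfolding abs_mult[of _ \<phi>] by (intro mult_right_mono) auto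
  with diff_term_bound[of e B l m \<phi>t] flux_term_bound[of A Q l m \<phi>x] assms show ?thesis
    unfolding kruzhkov_integrand_def by (smt (verit))
qed

lemma comparison_integrand_bound:
  fixes A :: "real \<Rightarrow> 'b::euclidean_space"
  assumes "\<And>l. \<bar>e l\<bar> \<le> B" "\<And>l. norm (A l) \<le> Q" "\<And>l. \<bar>f l\<bar> \<le> F"
  shows "\<bar>comparison_integrand A e f \<phi>t \<phi>x \<phi> l m\<bar> \<le> 2 * B * \<bar>\<phi>t\<bar> + 2 * Q * norm \<phi>x + 2 * F * \<bar>\<phi>\<bar>"
  using diff_term_bound[of e B l m \<phi>t] flux_term_bound[of A Q l m \<phi>x] diff_term_bound[of f F l m \<phi>] assms
  unfolding comparison_integrand_def by (smt (verit))

lemma kruzhkov_integrand_measurable: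
  fixes A :: "real \<Rightarrow> 'b::euclidean_space"
  assumes [measurable]: "A \<in> borel_measurable borel"
    "(\<lambda>p. e (fst p) (snd p)) \<in> borel_measurable (M \<Otimes>\<^sub>M borel)"
    "(\<lambda>p. f (fst p) (snd p)) \<in> borel_measurable (M \<Otimes>\<^sub>M borel)"
    "\<phi>t \<in> borel_measurable M" "\<phi>x \<in> borel_measurable M" "\<phi> \<in> borel_measurable M"
    "l \<in> R \<rightarrow>\<^sub>M borel" "m \<in> R \<rightarrow>\<^sub>M borel"
  shows "(\<lambda>(w, q). kruzhkov_integrand A (e w) (f w) (\<phi>t w) (\<phi>x w) (\<phi> w) (l q) (m q)) \<in> borel_measurable (M \<Otimes>\<^sub>M R)"
    and "(\<lambda>(w, q). comparison_integrand A (e w) (f w) (\<phi>t w) (\<phi>x w) (\<phi> w) (l q) (m q)) \<in> borel_measurable (M \<Otimes>\<^sub>M R)"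
proof -
  have el [measurable]: "(\<lambda>p. e (fst p) (k (snd p))) \<in> borel_measurable (M \<Otimes>\<^sub>M R)"
    and fl [measurable]: "(\<lambda>p. f (fst p) (k (snd p))) \<in> borel_measurable (M \<Otimes>\<^sub>M R)"
    if [measurable]: "k \<in> R \<rightarrow>\<^sub>M borel" for k :: "_ \<Rightarrow> real"
  proof -
    have m: "(\<lambda>p. (fst p, k (snd p))) \<in> M \<Otimes>\<^sub>M R \<rightarrow>\<^sub>M M \<Otimes>\<^sub>M borel" by measurable
    show "(\<lambda>p. e (fst p) (k (snd p))) \<in> borel_measurable (M \<Otimes>\<^sub>M R)"
      "(\<lambda>p. f (fst p) (k (snd p))) \<in> borel_measurable (M \<Otimes>\<^sub>M R)"
      using measurable_compose[OF m assms(2)] measurable_compose[OF m assms(3)] by simp_all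
  qed
  show "(\<lambda>(w, q). kruzhkov_integrand A (e w) (f w) (\<phi>t w) (\<phi>x w) (\<phi> w) (l q) (m q)) \<in> borel_measurable (M \<Otimes>\<^sub>M R)"
    "(\<lambda>(w, q). comparison_integrand A (e w) (f w) (\<phi>t w) (\<phi>x w) (\<phi> w) (l q) (m q)) \<in> borel_measurable (M \<Otimes>\<^sub>M R)"
    unfolding kruzhkov_integrand_def comparison_integrand_def case_prod_unfold sgn_real_def by measurable
qed

lemma comparison_integrand_continuous:
  fixes A :: "real \<Rightarrow> 'b::euclidean_space"
  assumes "continuous_on UNIV A" "continuous_on UNIV e" "continuous_on UNIV f"
  shows "continuous_on UNIV (comparison_integrand A e f \<phi>t \<phi>x \<phi> l)"
proof -
  have "continuous_on UNIV (\<lambda>m. A (max l m))" "continuous_on UNIV (\<lambda>m. A (min l m))"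
    by (auto intro!: continuous_on_compose2[OF assms(1)] continuous_intros)
  then show ?thesis
    unfolding comparison_integrand_def[abs_def] kruzhkov_flux_max_min
    by (intro continuous_intros assms(2,3))
qed

lemma comparison_integrand_clip:
  fixes A :: "real \<Rightarrow> 'b::euclidean_space"
  assumes "\<And>l. A (clip C l) = A l" "\<And>l. e (clip C l) = e l" "\<And>l. f (clip C l) = f l"
  shows "comparison_integrand A e f \<phi>t \<phi>x \<phi> l (clip C m) = comparison_integrand A e f \<phi>t \<phi>x \<phi> l m"
proof -
  have "clip C (max l (clip C m)) = clip C (max l m)" "clip C (min l (clip C m)) = clip C (min l m)"
    by (auto simp: clip_def max_def min_def)
  then have "A (max l (clip C m)) = A (max l m)" "A (min l (clip C m)) = A (min l m)"
    using assms(1) by metis+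
  then show ?thesis
    unfolding comparison_integrand_def kruzhkov_flux_max_min by (simp add: assms)
qed

text \<open>The algebra of doubling. The gradient of the kernel cancels because the flux does not depend
  on the space variable; its time derivative survives only against the \<open>x\<close>-oscillation of
  \<open>\<eta>\<close>. In the source term \<open>f(z,\<mu>)\<close> is added and subtracted, so that the jump of the
  sign function is always multiplied by a difference of values at the same \<open>z\<close> or by the
  oscillation of \<open>f\<close> in \<open>z\<close>.\<close>

lemma kruzhkov_integrand_doubling:
  fixes A :: "real \<Rightarrow> 'b::euclidean_space"
  assumes anti: "\<And>l m. l \<le> m \<Longrightarrow> f m \<le> f l"
    and De: "\<And>l. \<bar>e l - e' l\<bar> \<le> De" and Df: "\<And>l. \<bar>f l - f' l\<bar> \<le> Df"
    and "0 \<le> \<psi>" "0 \<le> k"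
  shows "kruzhkov_integrand A e f (\<psi>t * k + \<psi> * kt) (k *\<^sub>R \<psi>x + \<psi> *\<^sub>R kx) (\<psi> * k) l m
     + kruzhkov_integrand A e' f' (- (\<psi> * kt)) (- (\<psi> *\<^sub>R kx)) (\<psi> * k) m l
    \<le> comparison_integrand A e f \<psi>t \<psi>x \<psi> l m * k + 2 * De * \<psi> * \<bar>kt\<bar> + Df * \<psi> * k"
proof -
  have s: "sgn (m - l) = - sgn (l - m)" by (simp add: sgn_real_def)
  have "(\<bar>e l - e m\<bar> - \<bar>e' m - e' l\<bar>) * (\<psi> * kt) \<le> \<bar>\<bar>e l - e m\<bar> - \<bar>e' m - e' l\<bar>\<bar> * \<bar>\<psi> * kt\<bar>"
    by (metis abs_ge_self abs_mult)
  also have "\<dots> \<le> (2 * De) * (\<psi> * \<bar>kt\<bar>)"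
    using De[of l] De[of m] \<open>0 \<le> \<psi>\<close> by (intro mult_mono) (auto simp: abs_mult)
  finally have 1: "(\<bar>e l - e m\<bar> - \<bar>e' m - e' l\<bar>) * (\<psi> * kt) \<le> 2 * De * \<psi> * \<bar>kt\<bar>" by simp
  have "sgn (l - m) * (f l - f m) = - \<bar>f l - f m\<bar>"
    using anti[of l m] anti[of m l] by (auto simp: sgn_real_def)
  moreover have "sgn (l - m) * (f m - f' m) \<le> \<bar>sgn (l - m)\<bar> * \<bar>f m - f' m\<bar>"
    by (metis abs_ge_self abs_mult)
  moreover have "\<bar>sgn (l - m)\<bar> * \<bar>f m - f' m\<bar> \<le> 1 * Df"
    using Df[of m] by (intro mult_mono abs_sgn_le_1) auto
  ultimately have "sgn (l - m) * (f l - f' m) \<le> - \<bar>f l - f m\<bar> + Df"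
    by (simp add: algebra_simps)
  then have "sgn (l - m) * (f l - f' m) * (\<psi> * k) \<le> (- \<bar>f l - f m\<bar> + Df) * (\<psi> * k)"
    using assms(4,5) by (intro mult_right_mono) auto
  with 1 show ?thesis
    unfolding kruzhkov_integrand_def comparison_integrand_def s
    by (simp add: inner_add_right inner_diff_left inner_diff_right algebra_simps)
qed

text \<open>The data after regularisation: everything is clipped to states in \<open>[-C, C]\<close> and defined at every
  point, the Young measures are probability kernels, and \<open>W\<close> is a bounded box in which all points
  that interact stay. The function \<open>\<eta>\<close> depends on space only; this is what allows the spatial
  scale to be sent to zero before the temporal one.\<close>

locale kruzhkov_doubling =
  fixes A :: "real \<Rightarrow> 'b::euclidean_space" and eta :: "'b \<Rightarrow> real \<Rightarrow> real"
    and f :: "real \<times> 'b \<Rightarrow> real \<Rightarrow> real" and N S :: "real \<times> 'b \<Rightarrow> real measure"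
    and \<psi> \<psi>t :: "real \<times> 'b \<Rightarrow> real" and \<psi>x :: "real \<times> 'b \<Rightarrow> 'b"
    and C B Q H :: real and Feta :: "'b \<Rightarrow> real" and F :: "real \<times> 'b \<Rightarrow> real" and W :: "(real \<times> 'b) set"
  assumes C: "0 < C"
    and A_cont: "continuous_on UNIV A" and A_bound: "\<And>l. norm (A l) \<le> Q" and A_clip: "\<And>l. A (clip C l) = A l"
    and eta: "caratheodory C Feta eta" and eta_bound: "\<And>x l. \<bar>eta x l\<bar> \<le> B"
    and f: "caratheodory C F f" and f_anti: "\<And>z l m. l \<le> m \<Longrightarrow> f z m \<le> f z l"
    and N [measurable]: "N \<in> lebesgue \<rightarrow>\<^sub>M prob_algebra borel"
    and S [measurable]: "S \<in> lebesgue \<rightarrow>\<^sub>M prob_algebra borel"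
    and N_bound: "\<And>z. AE l in N z. \<bar>l\<bar> \<le> C" and S_bound: "\<And>z. AE l in S z. \<bar>l\<bar> \<le> C"
    and psi_cont: "continuous_on UNIV \<psi>" "continuous_on UNIV \<psi>t" "continuous_on UNIV \<psi>x"
    and psi_nonneg: "\<And>z. 0 \<le> \<psi> z"
    and psi_bound: "\<And>z. \<psi> z \<le> H" "\<And>z. \<bar>\<psi>t z\<bar> \<le> H" "\<And>z. norm (\<psi>x z) \<le> H"
    and W: "bounded W" "W \<in> sets borel"
    and psi_W: "\<And>z. z \<notin> W \<Longrightarrow> \<psi> z = 0 \<and> \<psi>t z = 0 \<and> \<psi>x z = 0"
begin

abbreviation G :: "real \<times> 'b \<Rightarrow> real \<Rightarrow> real \<Rightarrow> real" where
  "G z \<equiv> comparison_integrand A (eta (snd z)) (f z) (\<psi>t z) (\<psi>x z) (\<psi> z)"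

text \<open>Averaging the comparison integrand over the first Young measure leaves a function of the point and
  of the second state. It inherits continuity in the second state, which is all that is needed to
  move its base point from \<open>z\<close> to \<open>z'\<close> under a concentrating kernel; no regularity of the Young
  measures in space and time is involved.\<close>

definition g :: "real \<times> 'b \<Rightarrow> real \<Rightarrow> real" where
  "g z m = (\<integral>l. G z l m \<partial>N z)"

definition G_bound :: "real \<times> 'b \<Rightarrow> real" where
  "G_bound z = 2 * B * \<bar>\<psi>t z\<bar> + 2 * Q * norm (\<psi>x z) + 2 * F z * \<bar>\<psi> z\<bar>"

lemma f_bound: "\<bar>f z l\<bar> \<le> F z" and F_integrable: "integrable lebesgue F"
  and f_cont: "continuous_on UNIV (f z)" and f_clip: "f z (clip C l) = f z l"
  and eta_cont: "continuous_on UNIV (eta x)" and eta_clip: "eta x (clip C l) = eta x l"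
  using f eta unfolding caratheodory_def by blast+

lemma F_nonneg: "0 \<le> F z"
  by (rule order_trans[OF abs_ge_zero f_bound])

lemma bounds_nonneg: "0 \<le> B" "0 \<le> Q" "0 \<le> H"
  using eta_bound[of undefined undefined] A_bound[of undefined] psi_bound(2)[of undefined]
  by (auto intro: order_trans[OF norm_ge_zero] order_trans[OF abs_ge_zero])

lemma kernels [simp]: "prob_space (N z)" "prob_space (S z)" "sets (N z) = sets borel" "sets (S z) = sets borel"
    "space (N z) = UNIV" "space (S z) = UNIV"
  by (rule kernel_space[OF N S])+

lemma borel_data [measurable]: "A \<in> borel_measurable borel" "\<psi> \<in> borel_measurable borel"
    "\<psi>t \<in> borel_measurable borel" "\<psi>x \<in> borel_measurable borel"
  by (rule borel_measurable_continuous_onI, rule A_cont psi_cont)+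

lemma lebesgue_data [measurable]: "\<psi> \<in> borel_measurable lebesgue"
    "\<psi>t \<in> borel_measurable lebesgue" "\<psi>x \<in> borel_measurable lebesgue" "F \<in> borel_measurable lebesgue"
  by (rule borel_imp_lebesgue_measurable[OF borel_data(2)] borel_imp_lebesgue_measurable[OF borel_data(3)]
      measurable_completion borel_measurable_integrable[OF F_integrable] | simp)+

lemma eta_measurable [measurable]: "(\<lambda>z. eta (snd z) l) \<in> borel_measurable (lebesgue :: (real \<times> 'b) measure)"
  using eta by (intro measurable_compose[OF measurable_snd_lebesgue_lebesgue]) (simp add: caratheodory_def)

lemma f_measurable [measurable]: "(\<lambda>z. f z l) \<in> borel_measurable lebesgue"
  using f by (simp add: caratheodory_def)

lemma eta_pair: "(\<lambda>p. eta (snd (h (fst p))) (snd p)) \<in> borel_measurable (M \<Otimes>\<^sub>M borel)"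
  and f_pair: "(\<lambda>p. f (h (fst p)) (snd p)) \<in> borel_measurable (M \<Otimes>\<^sub>M borel)"
  if "h \<in> M \<rightarrow>\<^sub>M lebesgue"
  using borel_measurable_continuous_in_second[of "\<lambda>w l. eta (snd (h w)) l" M]
    borel_measurable_continuous_in_second[of "\<lambda>w l. f (h w) l" M]
    measurable_compose[OF that eta_measurable] measurable_compose[OF that f_measurable] eta_cont f_cont
  by (auto simp: case_prod_unfold)

lemma G_measurable:
  assumes h: "h \<in> M \<rightarrow>\<^sub>M lebesgue" and lm: "l \<in> R \<rightarrow>\<^sub>M borel" "m \<in> R \<rightarrow>\<^sub>M borel"
  shows "(\<lambda>(w, q). G (h w) (l q) (m q)) \<in> borel_measurable (M \<Otimes>\<^sub>M R)"
  by (rule kruzhkov_integrand_measurable(2)[where e="\<lambda>w. eta (snd (h w))" and f="\<lambda>w. f (h w)"])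
    (use h lm in \<open>auto intro!: eta_pair f_pair measurable_compose[OF h]\<close>)

lemma G_le: "\<bar>G z l m\<bar> \<le> G_bound z"
  unfolding G_bound_def by (intro comparison_integrand_bound eta_bound A_bound f_bound)

lemma W_finite: "emeasure lborel W < \<infinity>"
  using W emeasure_bounded_finite by blast

lemma W_lebesgue [measurable]: "W \<in> sets lebesgue" using W by auto

lemma W_integrable: "integrable lebesgue (indicat_real W)"
  using W_finite W by (auto simp: integrable_completion intro!: integrable_real_indicator)

lemma G_bound_integrable: "integrable lebesgue G_bound"
proof -
  have "integrable lebesgue (\<lambda>z. (2 * B * H + 2 * Q * H) * indicator W z + 2 * H * F z)"
    using W_integrable F_integrable by auto
  then show ?thesis
  proof (rule Bochner_Integration.integrable_bound)
    show "G_bound \<in> borel_measurable lebesgue" unfolding G_bound_def[abs_def] by measurable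
    have "\<bar>G_bound z\<bar> \<le> (2 * B * H + 2 * Q * H) * indicator W z + 2 * H * F z" for z
    proof (cases "z \<in> W")
      case True
      have "2 * B * \<bar>\<psi>t z\<bar> \<le> 2 * B * H" "2 * Q * norm (\<psi>x z) \<le> 2 * Q * H" "2 * F z * \<bar>\<psi> z\<bar> \<le> 2 * F z * H"
        using psi_bound[of z] psi_nonneg[of z] bounds_nonneg F_nonneg[of z] by (auto intro!: mult_left_mono)
      moreover have "0 \<le> 2 * B * \<bar>\<psi>t z\<bar>" "0 \<le> 2 * Q * norm (\<psi>x z)" "0 \<le> 2 * F z * \<bar>\<psi> z\<bar>"
        using bounds_nonneg F_nonneg[of z] by auto
      ultimately show ?thesis using True by (simp add: G_bound_def algebra_simps)
    next
      case False
      then show ?thesis using psi_W[of z] F_nonneg[of z] bounds_nonneg by (simp add: G_bound_def)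
    qed
    then show "AE z in lebesgue. norm (G_bound z) \<le> norm ((2 * B * H + 2 * Q * H) * indicator W z + 2 * H * F z)"
      by (intro AE_I2) (smt (verit) real_norm_def)
  qed
qed

lemma g_caratheodory: "caratheodory C G_bound g"
  unfolding caratheodory_def
proof (intro conjI allI)
  show "integrable lebesgue G_bound" by (rule G_bound_integrable)
  show "\<bar>g z l\<bar> \<le> G_bound z" for z l
    unfolding g_def by (rule integral_prob_bound) (auto intro: G_le)
  show "g z (clip C l) = g z l" for z l
    unfolding g_def using comparison_integrand_clip[of A C "eta (snd z)" "f z", OF A_clip eta_clip f_clip] by simp
  show "(\<lambda>z. g z m) \<in> borel_measurable lebesgue" for m
    unfolding g_def
    by (rule borel_measurable_kernel_integral[OF N])
      (rule G_measurable[where h="\<lambda>z. z" and l="\<lambda>l. l" and m="\<lambda>_. m"]; simp)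
  show "continuous_on UNIV (g z)" for z
  proof (clarsimp simp: continuous_on_eq_continuous_at continuous_at_sequentially)
    fix m and u :: "nat \<Rightarrow> real" assume u: "u \<longlonglongrightarrow> m"
    interpret Nz: prob_space "N z" by simp
    have G1: "(\<lambda>l. G z l k) \<in> borel_measurable (N z)" for k
    proof -
      have "(\<lambda>(z, l). G z l k) \<in> borel_measurable (lebesgue \<Otimes>\<^sub>M borel)"
        by (rule G_measurable[where h="\<lambda>z. z" and l="\<lambda>l. l" and m="\<lambda>_. k"]; simp)
      from measurable_Pair2[OF this, of z] show ?thesis by (simp cong: measurable_cong_sets)
    qed
    have "(\<lambda>n. \<integral>l. G z l (u n) \<partial>N z) \<longlonglongrightarrow> (\<integral>l. G z l m \<partial>N z)"
    proof (rule integral_dominated_convergence[where w="\<lambda>_. G_bound z"])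
      show "AE l in N z. (\<lambda>n. G z l (u n)) \<longlonglongrightarrow> G z l m"
        using continuous_on_tendsto_compose[OF comparison_integrand_continuous[OF A_cont eta_cont f_cont] u]
        by auto
    qed (use G1 G_le in auto)
    then show "(g z \<circ> u) \<longlonglongrightarrow> g z m" by (simp add: g_def o_def)
  qed
qed

definition I :: "real \<times> 'b \<Rightarrow> real" where
  "I z = (\<integral>q. G z (fst q) (snd q) \<partial>(N z \<Otimes>\<^sub>M S z))"

lemma pair_integral_G: "(\<integral>q. G z (fst q) (snd q) \<partial>(N z \<Otimes>\<^sub>M S z')) = (\<integral>m. g z m \<partial>S z')"
  and pair_integrable_G: "integrable (N z \<Otimes>\<^sub>M S z') (\<lambda>q. G z (fst q) (snd q))"
proof -
  interpret N: prob_space "N z" by simp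
  interpret S: prob_space "S z'" by simp
  interpret Y: pair_sigma_finite "N z" "S z'"
    by (simp add: pair_sigma_finite_def N.sigma_finite_measure_axioms S.sigma_finite_measure_axioms)
  have "(\<lambda>(w, q). G w (fst q) (snd q)) \<in> borel_measurable (lebesgue \<Otimes>\<^sub>M (borel \<Otimes>\<^sub>M borel))"
    by (rule G_measurable[where h="\<lambda>z. z" and l=fst and m=snd]; simp)
  from measurable_Pair2[OF this, of z]
  have "(\<lambda>q. G z (fst q) (snd q)) \<in> borel_measurable (N z \<Otimes>\<^sub>M S z')"
    by (simp cong: measurable_cong_sets sets_pair_measure_cong)
  from integrable_prob_bounded[OF _ this G_le]
  show int: "integrable (N z \<Otimes>\<^sub>M S z') (\<lambda>q. G z (fst q) (snd q))" by (simp add: prob_space_pair)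
  then show "(\<integral>q. G z (fst q) (snd q) \<partial>(N z \<Otimes>\<^sub>M S z')) = (\<integral>m. g z m \<partial>S z')"
    using Y.integral_snd[of "\<lambda>l m. G z l m"] by (simp add: case_prod_unfold g_def)
qed

lemma I_eq: "I z = (\<integral>m. g z m \<partial>S z)"
  by (simp add: I_def pair_integral_G)

lemma I_integrable: "integrable lebesgue I"
proof (rule Bochner_Integration.integrable_bound[OF G_bound_integrable])
  show "I \<in> borel_measurable lebesgue"
    unfolding I_eq[abs_def]
    by (rule borel_measurable_kernel_integral[OF S caratheodory_measurable[OF g_caratheodory]])
  have gb: "\<bar>g z m\<bar> \<le> \<bar>G_bound z\<bar>" for z m
    using g_caratheodory unfolding caratheodory_def by (meson abs_ge_self order_trans)
  show "AE z in lebesgue. norm (I z) \<le> norm (G_bound z)"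
    unfolding I_eq by (auto intro!: integral_prob_bound gb)
qed

end

context kruzhkov_doubling
begin

text \<open>One kernel \<open>K\<close>, with time derivative \<open>Kt\<close> and spatial gradient \<open>Kx\<close>. The doubled test function
  is \<open>\<psi>(z) K(z - z')\<close>; \<open>ineq_N\<close> is the inequality for the first solution with test function
  in \<open>z\<close>, and \<open>ineq_S\<close> that for the second solution with test function in \<open>z'\<close>.\<close>

context
  fixes K Kt :: "real \<times> 'b \<Rightarrow> real" and Kx :: "real \<times> 'b \<Rightarrow> 'b" and H' :: real
  assumes K_cont: "continuous_on UNIV K" "continuous_on UNIV Kt" "continuous_on UNIV Kx"
    and K_nonneg: "\<And>h. 0 \<le> K h"
    and K_bound: "\<And>h. K h \<le> H'" "\<And>h. \<bar>Kt h\<bar> \<le> H'" "\<And>h. norm (Kx h) \<le> H'"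
    and K_mass: "(\<integral>\<^sup>+h. ennreal (K h) \<partial>lborel) = 1"
    and K_W: "\<And>z z'. \<psi> z \<noteq> 0 \<or> \<psi>t z \<noteq> 0 \<or> \<psi>x z \<noteq> 0 \<Longrightarrow> z' \<notin> W \<Longrightarrow>
        K (z - z') = 0 \<and> Kt (z - z') = 0 \<and> Kx (z - z') = 0"
    and ineq_N: "\<And>z' m. \<bar>m\<bar> \<le> C \<Longrightarrow> 0 \<le> (\<integral>z. (\<integral>l. kruzhkov_integrand A (eta (snd z)) (f z)
        (\<psi>t z * K (z - z') + \<psi> z * Kt (z - z')) (K (z - z') *\<^sub>R \<psi>x z + \<psi> z *\<^sub>R Kx (z - z'))
        (\<psi> z * K (z - z')) l m \<partial>N z) \<partial>lebesgue)"
    and ineq_S: "\<And>z l. \<bar>l\<bar> \<le> C \<Longrightarrow> 0 \<le> (\<integral>z'. (\<integral>m. kruzhkov_integrand A (eta (snd z')) (f z')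
        (- (\<psi> z * Kt (z - z'))) (- (\<psi> z *\<^sub>R Kx (z - z'))) (\<psi> z * K (z - z')) m l \<partial>S z') \<partial>lebesgue)"
begin

abbreviation P1 :: "real \<times> 'b \<Rightarrow> real \<times> 'b \<Rightarrow> real \<Rightarrow> real \<Rightarrow> real" where
  "P1 z z' \<equiv> kruzhkov_integrand A (eta (snd z)) (f z)
        (\<psi>t z * K (z - z') + \<psi> z * Kt (z - z')) (K (z - z') *\<^sub>R \<psi>x z + \<psi> z *\<^sub>R Kx (z - z'))
        (\<psi> z * K (z - z'))"

abbreviation P2 :: "real \<times> 'b \<Rightarrow> real \<times> 'b \<Rightarrow> real \<Rightarrow> real \<Rightarrow> real" where
  "P2 z z' l m \<equiv> kruzhkov_integrand A (eta (snd z')) (f z')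
        (- (\<psi> z * Kt (z - z'))) (- (\<psi> z *\<^sub>R Kx (z - z'))) (\<psi> z * K (z - z')) m l"

text \<open>An integrable bound for both doubled integrands: the weights are bounded and supported in
  \<open>W \<times> W\<close>, and the source is dominated at the point at which it is evaluated.\<close>

definition envelope :: "real \<times> 'b \<Rightarrow> real \<times> 'b \<Rightarrow> real" where
  "envelope z z' = (4 * B * (H * H') + 4 * Q * (H * H')) * (indicator W z * indicator W z')
     + H * H' * (F z * indicator W z') + H * H' * (indicator W z * F z')"

lemma envelope_integrable: "integrable (lebesgue \<Otimes>\<^sub>M lebesgue) (\<lambda>(z, z'). envelope z z')"
  using integrable_product_functions[OF W_integrable W_integrable]
    integrable_product_functions[OF F_integrable W_integrable]
    integrable_product_functions[OF W_integrable F_integrable]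
  unfolding envelope_def case_prod_unfold by (intro Bochner_Integration.integrable_add integrable_mult_right)

lemma H'_nonneg: "0 \<le> H'"
  using K_bound(2)[of undefined] by (rule order_trans[OF abs_ge_zero])

lemma weights_bound:
  shows "\<bar>\<psi>t z * K (z - z') + \<psi> z * Kt (z - z')\<bar> \<le> 2 * (H * H') * (indicator W z * indicator W z')" (is ?t)
    and "norm (K (z - z') *\<^sub>R \<psi>x z + \<psi> z *\<^sub>R Kx (z - z')) \<le> 2 * (H * H') * (indicator W z * indicator W z')" (is ?x)
    and "\<bar>\<psi> z * K (z - z')\<bar> \<le> H * H' * (indicator W z * indicator W z')" (is ?o)
    and "\<bar>\<psi> z * Kt (z - z')\<bar> \<le> 2 * (H * H') * (indicator W z * indicator W z')" (is ?t')
    and "norm (\<psi> z *\<^sub>R Kx (z - z')) \<le> 2 * (H * H') * (indicator W z * indicator W z')" (is ?x')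
proof -
  have "?t \<and> ?x \<and> ?o \<and> ?t' \<and> ?x'"
  proof (cases "z \<in> W \<and> z' \<in> W")
    case True
    have ab: "\<bar>a * c\<bar> \<le> H * H'" if "\<bar>a\<bar> \<le> H" "\<bar>c\<bar> \<le> H'" for a c
      unfolding abs_mult using that bounds_nonneg by (intro mult_mono) auto
    have nb: "norm (a *\<^sub>R c) \<le> H * H'" if "\<bar>a\<bar> \<le> H" "norm c \<le> H'" for a and c :: 'b
      using that bounds_nonneg by (auto intro!: mult_mono)
    have nb': "norm (a *\<^sub>R c) \<le> H * H'" if "\<bar>a\<bar> \<le> H'" "norm c \<le> H" for a and c :: 'b
      using that H'_nonneg by (subst mult.commute) (auto intro!: mult_mono)
    have a: "\<bar>\<psi> z\<bar> \<le> H" "\<bar>K (z - z')\<bar> \<le> H'"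
      using psi_nonneg[of z] psi_bound(1)[of z] K_nonneg[of "z - z'"] K_bound(1)[of "z - z'"] by auto
    have 1: "\<bar>\<psi>t z * K (z - z')\<bar> \<le> H * H'" "\<bar>\<psi> z * Kt (z - z')\<bar> \<le> H * H'" "\<bar>\<psi> z * K (z - z')\<bar> \<le> H * H'"
      "norm (K (z - z') *\<^sub>R \<psi>x z) \<le> H * H'" "norm (\<psi> z *\<^sub>R Kx (z - z')) \<le> H * H'"
      by (intro ab nb nb' psi_bound K_bound a)+
    have "0 \<le> H * H'" using bounds_nonneg H'_nonneg by simp
    with 1 norm_triangle_ineq[of "K (z - z') *\<^sub>R \<psi>x z" "\<psi> z *\<^sub>R Kx (z - z')"]
      abs_triangle_ineq[of "\<psi>t z * K (z - z')" "\<psi> z * Kt (z - z')"]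
    show ?thesis using True by (simp del: norm_scaleR)
  next
    case False
    then have "(\<psi> z = 0 \<and> \<psi>t z = 0 \<and> \<psi>x z = 0) \<or> (K (z - z') = 0 \<and> Kt (z - z') = 0 \<and> Kx (z - z') = 0)"
      using psi_W[of z] K_W[of z z'] by auto
    then show ?thesis using bounds_nonneg H'_nonneg by auto
  qed
  then show ?t ?x ?o ?t' ?x' by auto
qed

lemma P1_bound: "\<bar>P1 z z' l m\<bar> \<le> envelope z z'"
proof -
  let ?w = "indicator W z * indicator W z' :: real"
  have "\<bar>P1 z z' l m\<bar> \<le> 2 * B * \<bar>\<psi>t z * K (z - z') + \<psi> z * Kt (z - z')\<bar>
      + 2 * Q * norm (K (z - z') *\<^sub>R \<psi>x z + \<psi> z *\<^sub>R Kx (z - z')) + F z * \<bar>\<psi> z * K (z - z')\<bar>"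
    by (intro kruzhkov_integrand_bound eta_bound A_bound f_bound)
  also have "\<dots> \<le> 2 * B * (2 * (H * H') * ?w) + 2 * Q * (2 * (H * H') * ?w) + F z * (H * H' * ?w)"
    using bounds_nonneg F_nonneg by (intro add_mono mult_left_mono weights_bound) auto
  also have "F z * (H * H' * ?w) \<le> H * H' * (F z * indicator W z') + H * H' * (indicator W z * F z')"
    using bounds_nonneg H'_nonneg F_nonneg[of z] F_nonneg[of z'] by (auto simp: indicator_def)
  finally show ?thesis by (simp add: envelope_def algebra_simps)
qed

lemma P2_bound: "\<bar>P2 z z' l m\<bar> \<le> envelope z z'"
proof -
  let ?w = "indicator W z * indicator W z' :: real"
  have "\<bar>P2 z z' l m\<bar> \<le> 2 * B * \<bar>- (\<psi> z * Kt (z - z'))\<bar>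
      + 2 * Q * norm (- (\<psi> z *\<^sub>R Kx (z - z'))) + F z' * \<bar>\<psi> z * K (z - z')\<bar>"
    by (intro kruzhkov_integrand_bound eta_bound A_bound f_bound)
  also have "\<dots> \<le> 2 * B * (2 * (H * H') * ?w) + 2 * Q * (2 * (H * H') * ?w) + F z' * (H * H' * ?w)"
    unfolding abs_minus_cancel norm_minus_cancel
    using bounds_nonneg F_nonneg by (intro add_mono mult_left_mono weights_bound) auto
  also have "F z' * (H * H' * ?w) \<le> H * H' * (F z * indicator W z') + H * H' * (indicator W z * F z')"
    using bounds_nonneg H'_nonneg F_nonneg[of z] F_nonneg[of z'] by (auto simp: indicator_def)
  finally show ?thesis by (simp add: envelope_def algebra_simps)
qed

lemma K_borel [measurable]: "K \<in> borel_measurable borel" "Kt \<in> borel_measurable borel" "Kx \<in> borel_measurable borel"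
  by (rule borel_measurable_continuous_onI, rule K_cont)+

lemma kernel_pair_measurable [measurable]:
  "(\<lambda>p. K (fst p - snd p)) \<in> borel_measurable (lebesgue \<Otimes>\<^sub>M lebesgue)"
  "(\<lambda>p. Kt (fst p - snd p)) \<in> borel_measurable (lebesgue \<Otimes>\<^sub>M lebesgue)"
  "(\<lambda>p. Kx (fst p - snd p)) \<in> borel_measurable (lebesgue \<Otimes>\<^sub>M lebesgue)"
  by measurable

lemma P1_measurable: "(\<lambda>(p, q). P1 (fst p) (snd p) (fst q) (snd q))
    \<in> borel_measurable ((lebesgue \<Otimes>\<^sub>M lebesgue) \<Otimes>\<^sub>M (borel \<Otimes>\<^sub>M borel))"
  by (rule kruzhkov_integrand_measurable(1)[where e="\<lambda>p. eta (snd (fst p))" and f="\<lambda>p. f (fst p)",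
        OF borel_data(1) eta_pair[OF measurable_fst] f_pair[OF measurable_fst] _ _ _ measurable_fst measurable_snd])
     measurable

lemma P2_measurable: "(\<lambda>(p, q). P2 (fst p) (snd p) (fst q) (snd q))
    \<in> borel_measurable ((lebesgue \<Otimes>\<^sub>M lebesgue) \<Otimes>\<^sub>M (borel \<Otimes>\<^sub>M borel))"
  by (rule kruzhkov_integrand_measurable(1)[where e="\<lambda>p. eta (snd (snd p))" and f="\<lambda>p. f (snd p)",
        OF borel_data(1) eta_pair[OF measurable_snd] f_pair[OF measurable_snd] _ _ _ measurable_snd measurable_fst])
     measurable

lemma doubled_nonneg:
  "0 \<le> (\<integral>p. (\<integral>q. P1 (fst p) (snd p) (fst q) (snd q) \<partial>(N (fst p) \<Otimes>\<^sub>M S (snd p))) \<partial>(lebesgue \<Otimes>\<^sub>M lebesgue))"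
  "0 \<le> (\<integral>p. (\<integral>q. P2 (fst p) (snd p) (fst q) (snd q) \<partial>(N (fst p) \<Otimes>\<^sub>M S (snd p))) \<partial>(lebesgue \<Otimes>\<^sub>M lebesgue))"
proof -
  show "0 \<le> (\<integral>p. (\<integral>q. P1 (fst p) (snd p) (fst q) (snd q) \<partial>(N (fst p) \<Otimes>\<^sub>M S (snd p))) \<partial>(lebesgue \<Otimes>\<^sub>M lebesgue))"
  proof (rule doubled_integral_nonneg[OF N S P1_measurable P1_bound envelope_integrable])
    show "AE m in S z'. 0 \<le> (\<integral>z. (\<integral>l. P1 z z' l m \<partial>N z) \<partial>lebesgue)" for z'
      using S_bound[of z'] by eventually_elim (rule ineq_N)
  qed
  show "0 \<le> (\<integral>p. (\<integral>q. P2 (fst p) (snd p) (fst q) (snd q) \<partial>(N (fst p) \<Otimes>\<^sub>M S (snd p))) \<partial>(lebesgue \<Otimes>\<^sub>M lebesgue))"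
  proof (rule doubled_integral_nonneg'[OF N S P2_measurable P2_bound envelope_integrable])
    show "AE l in N z. 0 \<le> (\<integral>z'. (\<integral>m. P2 z z' l m \<partial>S z') \<partial>lebesgue)" for z
      using N_bound[of z] by eventually_elim (rule ineq_S)
  qed
qed

text \<open>What separates the doubled inequality from the comparison inequality: the cost of moving the base
  point of the comparison integrand, and the oscillations of \<open>\<eta>\<close> and of the source.\<close>

definition defect :: "real \<times> 'b \<Rightarrow> real \<times> 'b \<Rightarrow> real" where
  "defect z z' = sup_diff g z z' * K (z - z') + 2 * sup_diff eta (snd z) (snd z') * \<psi> z * \<bar>Kt (z - z')\<bar>
      + sup_diff f z z' * \<psi> z * K (z - z')"

lemma sup_diff_eta_measurable [measurable]:
  "(\<lambda>p. sup_diff eta (snd (fst p)) (snd (snd p))) \<in>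
    borel_measurable ((lebesgue :: (real \<times> 'b) measure) \<Otimes>\<^sub>M (lebesgue :: (real \<times> 'b) measure))"
proof -
  have "(\<lambda>p. (snd (fst p), snd (snd p))) \<in>
      (lebesgue :: (real \<times> 'b) measure) \<Otimes>\<^sub>M (lebesgue :: (real \<times> 'b) measure) \<rightarrow>\<^sub>M lebesgue \<Otimes>\<^sub>M lebesgue"
    by (intro measurable_Pair measurable_compose[OF measurable_fst measurable_snd_lebesgue_lebesgue]
      measurable_compose[OF measurable_snd measurable_snd_lebesgue_lebesgue])
  from measurable_compose[OF this sup_diff_measurable[OF eta]] show ?thesis by simp
qed

lemma sup_diff_pair_measurable [measurable]:
  "(\<lambda>p. sup_diff g (fst p) (snd p)) \<in> borel_measurable (lebesgue \<Otimes>\<^sub>M lebesgue)"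
  "(\<lambda>p. sup_diff f (fst p) (snd p)) \<in> borel_measurable (lebesgue \<Otimes>\<^sub>M lebesgue)"
  using sup_diff_measurable[OF g_caratheodory] sup_diff_measurable[OF f] by (simp_all add: case_prod_unfold)

lemma pointwise_bound:
  "(\<integral>q. P1 z z' (fst q) (snd q) \<partial>(N z \<Otimes>\<^sub>M S z')) + (\<integral>q. P2 z z' (fst q) (snd q) \<partial>(N z \<Otimes>\<^sub>M S z'))
    \<le> I z' * K (z - z') + defect z z'"
proof -
  interpret Y: prob_space "N z \<Otimes>\<^sub>M S z'" by (rule prob_space_pair) simp_all
  interpret S: prob_space "S z'" by simp
  let ?k = "K (z - z')" and ?kt = "Kt (z - z')"
  have m: "(\<lambda>q. P z z' (fst q) (snd q)) \<in> borel_measurable (N z \<Otimes>\<^sub>M S z')"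
    if "(\<lambda>(p, q). P (fst p) (snd p) (fst q) (snd q)) \<in> borel_measurable ((lebesgue \<Otimes>\<^sub>M lebesgue) \<Otimes>\<^sub>M (borel \<Otimes>\<^sub>M borel))"
    for P :: "real \<times> 'b \<Rightarrow> real \<times> 'b \<Rightarrow> real \<Rightarrow> real \<Rightarrow> real"
    using measurable_Pair2[OF that, of "(z, z')"]
    by (simp add: space_pair_measure cong: measurable_cong_sets sets_pair_measure_cong)
  have i1: "integrable (N z \<Otimes>\<^sub>M S z') (\<lambda>q. P1 z z' (fst q) (snd q))"
    using m[OF P1_measurable] P1_bound by (intro Y.integrable_const_bound[of _ "envelope z z'"]) auto
  have i2: "integrable (N z \<Otimes>\<^sub>M S z') (\<lambda>q. P2 z z' (fst q) (snd q))"
    using m[OF P2_measurable] P2_bound by (intro Y.integrable_const_bound[of _ "envelope z z'"]) auto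
  let ?c = "2 * sup_diff eta (snd z) (snd z') * \<psi> z * \<bar>?kt\<bar> + sup_diff f z z' * \<psi> z * ?k"
  have "(\<integral>q. P1 z z' (fst q) (snd q) \<partial>(N z \<Otimes>\<^sub>M S z')) + (\<integral>q. P2 z z' (fst q) (snd q) \<partial>(N z \<Otimes>\<^sub>M S z'))
      = (\<integral>q. P1 z z' (fst q) (snd q) + P2 z z' (fst q) (snd q) \<partial>(N z \<Otimes>\<^sub>M S z'))"
    using i1 i2 by simp
  also have "\<dots> \<le> (\<integral>q. G z (fst q) (snd q) * ?k + ?c \<partial>(N z \<Otimes>\<^sub>M S z'))"
  proof (intro integral_mono)
    fix q :: "real \<times> real"
    show "P1 z z' (fst q) (snd q) + P2 z z' (fst q) (snd q) \<le> G z (fst q) (snd q) * ?k + ?c"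
    proof -
      have "P1 z z' (fst q) (snd q) + P2 z z' (fst q) (snd q) \<le> G z (fst q) (snd q) * ?k
          + 2 * sup_diff eta (snd z) (snd z') * \<psi> z * \<bar>?kt\<bar> + sup_diff f z z' * \<psi> z * ?k"
      proof (rule kruzhkov_integrand_doubling)
        show "f z m \<le> f z l" if "l \<le> m" for l m using that by (rule f_anti)
        show "\<bar>eta (snd z) l - eta (snd z') l\<bar> \<le> sup_diff eta (snd z) (snd z')" for l
          by (rule sup_diff_upper[OF eta])
        show "\<bar>f z l - f z' l\<bar> \<le> sup_diff f z z'" for l by (rule sup_diff_upper[OF f])
      qed (rule psi_nonneg K_nonneg)+
      then show ?thesis by simp
    qed
  qed (use i1 i2 pair_integrable_G in auto)
  also have "\<dots> = (\<integral>m. g z m \<partial>S z') * ?k + ?c"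
    using pair_integrable_G[of z z'] by (simp add: pair_integral_G Y.prob_space)
  also have "(\<integral>m. g z m \<partial>S z') * ?k \<le> (I z' + sup_diff g z z') * ?k"
  proof (rule mult_right_mono[OF _ K_nonneg])
    have gi: "integrable (S z') (g w)" for w
    proof (rule integrable_prob_bounded)
      show "g w \<in> borel_measurable (S z')"
        using measurable_Pair2[OF caratheodory_measurable[OF g_caratheodory], of w] by (simp cong: measurable_cong_sets)
      show "\<bar>g w l\<bar> \<le> G_bound w" for l using g_caratheodory unfolding caratheodory_def by blast
    qed simp
    have "(\<integral>m. g z m \<partial>S z') \<le> (\<integral>m. g z' m + sup_diff g z z' \<partial>S z')"
    proof (rule integral_mono)
      show "g z m \<le> g z' m + sup_diff g z z'" for m
        using sup_diff_upper[OF g_caratheodory, of z m z'] by linarith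
    qed (use gi in auto)
    also have "\<dots> = I z' + sup_diff g z z'" using gi S.prob_space by (simp add: I_eq)
    finally show "(\<integral>m. g z m \<partial>S z') \<le> I z' + sup_diff g z z'" .
  qed
  finally show ?thesis by (simp add: defect_def algebra_simps)
qed

text \<open>The kernel has mass one, so mollification does not change the integral.\<close>

lemma I_kernel:
  "integrable (lebesgue \<Otimes>\<^sub>M lebesgue) (\<lambda>p. I (snd p) * K (fst p - snd p))"
  "(\<integral>p. I (snd p) * K (fst p - snd p) \<partial>(lebesgue \<Otimes>\<^sub>M lebesgue)) = (\<integral>z. I z \<partial>lebesgue)"
proof -
  have [measurable]: "I \<in> borel_measurable lebesgue" using I_integrable by auto
  have m: "(\<lambda>(z', z). I z' * K (z - z')) \<in> borel_measurable (lebesgue \<Otimes>\<^sub>M lebesgue)"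
    unfolding case_prod_unfold by measurable
  have mass: "(\<integral>\<^sup>+z. ennreal (K (z - z')) \<partial>lebesgue) = 1" for z'
    using nn_integral_reflect(2)[of "\<lambda>h. ennreal (K h)" z'] K_mass by simp
  have Km: "(\<lambda>z. K (z - z')) \<in> borel_measurable lebesgue" for z'
    by (rule borel_imp_lebesgue_measurable) measurable
  have Ki: "integrable lebesgue (\<lambda>z. K (z - z'))" for z'
    using mass[of z'] Km K_nonneg by (auto simp: integrable_iff_bounded)
  have K1: "(\<integral>z. K (z - z') \<partial>lebesgue) = 1" for z'
    using integral_eq_nn_integral[OF Km, of z'] mass[of z'] K_nonneg by simp
  have i: "integrable (lebesgue \<Otimes>\<^sub>M lebesgue) (\<lambda>(z', z). I z' * K (z - z'))"
  proof (rule leb_pair.Fubini_integrable[OF m])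
    show "integrable lebesgue (\<lambda>z'. \<integral>z. norm (case (z', z) of (z', z) \<Rightarrow> I z' * K (z - z')) \<partial>lebesgue)"
      using I_integrable by (simp add: abs_mult K_nonneg K1)
    show "AE z' in lebesgue. integrable lebesgue (\<lambda>z. case (z', z) of (z', z) \<Rightarrow> I z' * K (z - z'))"
      using Ki by simp
  qed
  show i': "integrable (lebesgue \<Otimes>\<^sub>M lebesgue) (\<lambda>p. I (snd p) * K (fst p - snd p))"
    using leb_pair.integrable_product_swap[OF i] by (simp add: case_prod_unfold)
  have "(\<integral>z'. (\<integral>z. I z' * K (z - z') \<partial>lebesgue) \<partial>lebesgue)
      = (\<integral>p. (case p of (z, z') \<Rightarrow> I z' * K (z - z')) \<partial>(lebesgue \<Otimes>\<^sub>M lebesgue))"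
    by (rule leb_pair.integral_snd) (use i' in \<open>simp add: case_prod_unfold\<close>)
  then show "(\<integral>p. I (snd p) * K (fst p - snd p) \<partial>(lebesgue \<Otimes>\<^sub>M lebesgue)) = (\<integral>z. I z \<partial>lebesgue)"
    by (simp add: case_prod_unfold K1)
qed

text \<open>The positive part of minus the comparison integral is controlled by the defect. Stated in
  extended nonnegative reals, the estimate needs no integrability of the defect.\<close>

lemma doubling_estimate:
  "ennreal (- (\<integral>z. I z \<partial>lebesgue)) \<le>
     (\<integral>\<^sup>+z. \<integral>\<^sup>+z'. ennreal (sup_diff g z z') * ennreal (K (z - z')) \<partial>lebesgue \<partial>lebesgue)
   + (\<integral>\<^sup>+z. \<integral>\<^sup>+z'. ennreal (2 * sup_diff eta (snd z) (snd z') * \<psi> z * \<bar>Kt (z - z')\<bar>) \<partial>lebesgue \<partial>lebesgue)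
   + ennreal H * (\<integral>\<^sup>+z. \<integral>\<^sup>+z'. ennreal (sup_diff f z z') * ennreal (K (z - z')) \<partial>lebesgue \<partial>lebesgue)"
proof -
  let ?LL = "lebesgue \<Otimes>\<^sub>M lebesgue :: ((real \<times> 'b) \<times> (real \<times> 'b)) measure"
  note D0 = sup_diff_nonneg[OF g_caratheodory] sup_diff_nonneg[OF f] sup_diff_nonneg[OF eta]
  have d0: "0 \<le> defect z z'" for z z'
    unfolding defect_def using D0 psi_nonneg K_nonneg by simp
  have dm [measurable]: "(\<lambda>p. defect (fst p) (snd p)) \<in> borel_measurable ?LL"
    unfolding defect_def by measurable
  have real: "ennreal (- (\<integral>z. I z \<partial>lebesgue)) \<le> (\<integral>\<^sup>+p. ennreal (defect (fst p) (snd p)) \<partial>?LL)"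
  proof (cases "integrable ?LL (\<lambda>p. defect (fst p) (snd p))")
    case True
    note i1 = product_integral_integrable[OF N S P1_measurable P1_bound envelope_integrable]
    note i2 = product_integral_integrable[OF N S P2_measurable P2_bound envelope_integrable]
    have "0 \<le> (\<integral>p. (\<integral>q. P1 (fst p) (snd p) (fst q) (snd q) \<partial>(N (fst p) \<Otimes>\<^sub>M S (snd p)))
        + (\<integral>q. P2 (fst p) (snd p) (fst q) (snd q) \<partial>(N (fst p) \<Otimes>\<^sub>M S (snd p))) \<partial>?LL)"
      using doubled_nonneg by (subst Bochner_Integration.integral_add[OF i1 i2]) simp
    also have "\<dots> \<le> (\<integral>p. I (snd p) * K (fst p - snd p) + defect (fst p) (snd p) \<partial>?LL)"
      by (intro integral_mono Bochner_Integration.integrable_add i1 i2 I_kernel(1) True pointwise_bound)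
    also have "\<dots> = (\<integral>z. I z \<partial>lebesgue) + (\<integral>p. defect (fst p) (snd p) \<partial>?LL)"
      by (simp add: I_kernel True)
    finally have "- (\<integral>z. I z \<partial>lebesgue) \<le> (\<integral>p. defect (fst p) (snd p) \<partial>?LL)" by simp
    then show ?thesis
      by (subst nn_integral_eq_integral[OF True]) (auto simp: d0 intro: ennreal_leI)
  next
    case False
    then have "(\<integral>\<^sup>+p. ennreal (defect (fst p) (snd p)) \<partial>?LL) = \<infinity>"
      using d0 by (auto simp: integrable_iff_bounded less_top[symmetric])
    then show ?thesis by simp
  qed
  also have "(\<integral>\<^sup>+p. ennreal (defect (fst p) (snd p)) \<partial>?LL)
    = (\<integral>\<^sup>+z. \<integral>\<^sup>+z'. ennreal (defect z z') \<partial>lebesgue \<partial>lebesgue)"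
    by (subst leb.nn_integral_fst[symmetric]) simp_all
  also have "\<dots> \<le> (\<integral>\<^sup>+z. \<integral>\<^sup>+z'. (ennreal (sup_diff g z z') * ennreal (K (z - z'))
       + ennreal (2 * sup_diff eta (snd z) (snd z') * \<psi> z * \<bar>Kt (z - z')\<bar>))
       + ennreal H * (ennreal (sup_diff f z z') * ennreal (K (z - z'))) \<partial>lebesgue \<partial>lebesgue)"
  proof (intro nn_integral_mono)
    fix z z' :: "real \<times> 'b"
    have "sup_diff f z z' * \<psi> z * K (z - z') \<le> H * (sup_diff f z z' * K (z - z'))"
      using psi_bound(1)[of z] mult_right_mono[of "\<psi> z" H "sup_diff f z z' * K (z - z')"] D0 K_nonneg
      by (simp add: mult_ac)
    then have "defect z z' \<le> sup_diff g z z' * K (z - z') + 2 * sup_diff eta (snd z) (snd z') * \<psi> z * \<bar>Kt (z - z')\<bar>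
      + H * (sup_diff f z z' * K (z - z'))"
      unfolding defect_def by simp
    then show "ennreal (defect z z') \<le> (ennreal (sup_diff g z z') * ennreal (K (z - z'))
       + ennreal (2 * sup_diff eta (snd z) (snd z') * \<psi> z * \<bar>Kt (z - z')\<bar>))
       + ennreal H * (ennreal (sup_diff f z z') * ennreal (K (z - z')))"
      using D0 psi_nonneg K_nonneg bounds_nonneg
      by (simp add: ennreal_leI flip: ennreal_mult ennreal_plus)
  qed
  also have "\<dots> = (\<integral>\<^sup>+z. \<integral>\<^sup>+z'. ennreal (sup_diff g z z') * ennreal (K (z - z')) \<partial>lebesgue \<partial>lebesgue)
   + (\<integral>\<^sup>+z. \<integral>\<^sup>+z'. ennreal (2 * sup_diff eta (snd z) (snd z') * \<psi> z * \<bar>Kt (z - z')\<bar>) \<partial>lebesgue \<partial>lebesgue)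
   + (\<integral>\<^sup>+z. \<integral>\<^sup>+z'. ennreal H * (ennreal (sup_diff f z z') * ennreal (K (z - z'))) \<partial>lebesgue \<partial>lebesgue)"
  proof -
    have m1: "(\<lambda>(z, z'). ennreal (sup_diff g z z') * ennreal (K (z - z'))) \<in> borel_measurable ?LL"
      and m2: "(\<lambda>(z, z'). ennreal (2 * sup_diff eta (snd z) (snd z') * \<psi> z * \<bar>Kt (z - z')\<bar>)) \<in> borel_measurable ?LL"
      and m3: "(\<lambda>(z, z'). ennreal H * (ennreal (sup_diff f z z') * ennreal (K (z - z')))) \<in> borel_measurable ?LL"
      unfolding case_prod_unfold by measurable
    have m12: "(\<lambda>(z, z'). ennreal (sup_diff g z z') * ennreal (K (z - z'))
        + ennreal (2 * sup_diff eta (snd z) (snd z') * \<psi> z * \<bar>Kt (z - z')\<bar>)) \<in> borel_measurable ?LL"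
      using borel_measurable_add[OF m1 m2] by (simp add: case_prod_unfold)
    show ?thesis
      unfolding nn_integral_add_iterated[OF m12 m3] nn_integral_add_iterated[OF m1 m2] ..
  qed
  also have "(\<integral>\<^sup>+z. \<integral>\<^sup>+z'. ennreal H * (ennreal (sup_diff f z z') * ennreal (K (z - z'))) \<partial>lebesgue \<partial>lebesgue)
     = ennreal H * (\<integral>\<^sup>+z. \<integral>\<^sup>+z'. ennreal (sup_diff f z z') * ennreal (K (z - z')) \<partial>lebesgue \<partial>lebesgue)"
  proof -
    have m: "(\<lambda>(z, z'). ennreal (sup_diff f z z') * ennreal (K (z - z'))) \<in> borel_measurable ?LL"
      unfolding case_prod_unfold by measurable
    show ?thesis
      using measurable_Pair2[OF m] leb.borel_measurable_nn_integral[OF m] by (simp add: nn_integral_cmult)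
  qed
  finally show ?thesis .
qed

end

end

lemma (in kruzhkov_doubling) comparison_inequality:
  fixes K Kt :: "nat \<Rightarrow> real \<times> 'b \<Rightarrow> real" and Kx :: "nat \<Rightarrow> real \<times> 'b \<Rightarrow> 'b" and H' :: "nat \<Rightarrow> real"
  assumes K_cont: "\<And>n. continuous_on UNIV (K n)" "\<And>n. continuous_on UNIV (Kt n)" "\<And>n. continuous_on UNIV (Kx n)"
    and K_nonneg: "\<And>n h. 0 \<le> K n h"
    and K_bound: "\<And>n h. K n h \<le> H' n" "\<And>n h. \<bar>Kt n h\<bar> \<le> H' n" "\<And>n h. norm (Kx n h) \<le> H' n"
    and K_mass: "\<And>n. (\<integral>\<^sup>+h. ennreal (K n h) \<partial>lborel) = 1"
    and K_approx: "approximate_kernel (\<lambda>n h. ennreal (K n h)) 1"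
    and K_W: "\<And>n z z'. \<psi> z \<noteq> 0 \<or> \<psi>t z \<noteq> 0 \<or> \<psi>x z \<noteq> 0 \<Longrightarrow> z' \<notin> W \<Longrightarrow>
        K n (z - z') = 0 \<and> Kt n (z - z') = 0 \<and> Kx n (z - z') = 0"
    and ineq_N: "\<And>n z' m. \<bar>m\<bar> \<le> C \<Longrightarrow> 0 \<le> (\<integral>z. (\<integral>l. kruzhkov_integrand A (eta (snd z)) (f z)
        (\<psi>t z * K n (z - z') + \<psi> z * Kt n (z - z')) (K n (z - z') *\<^sub>R \<psi>x z + \<psi> z *\<^sub>R Kx n (z - z'))
        (\<psi> z * K n (z - z')) l m \<partial>N z) \<partial>lebesgue)"
    and ineq_S: "\<And>n z l. \<bar>l\<bar> \<le> C \<Longrightarrow> 0 \<le> (\<integral>z'. (\<integral>m. kruzhkov_integrand A (eta (snd z')) (f z')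
        (- (\<psi> z * Kt n (z - z'))) (- (\<psi> z *\<^sub>R Kx n (z - z'))) (\<psi> z * K n (z - z')) m l \<partial>S z') \<partial>lebesgue)"
    and eta_error: "(\<lambda>n. \<integral>\<^sup>+z. \<integral>\<^sup>+z'. ennreal (2 * sup_diff eta (snd z) (snd z') * \<psi> z * \<bar>Kt n (z - z')\<bar>)
        \<partial>lebesgue \<partial>lebesgue) \<longlonglongrightarrow> 0"
  shows "0 \<le> (\<integral>z. I z \<partial>lebesgue)"
proof -
  let ?R = "\<lambda>n. (\<integral>\<^sup>+z. \<integral>\<^sup>+z'. ennreal (sup_diff g z z') * ennreal (K n (z - z')) \<partial>lebesgue \<partial>lebesgue)
   + (\<integral>\<^sup>+z. \<integral>\<^sup>+z'. ennreal (2 * sup_diff eta (snd z) (snd z') * \<psi> z * \<bar>Kt n (z - z')\<bar>) \<partial>lebesgue \<partial>lebesgue)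
   + ennreal H * (\<integral>\<^sup>+z. \<integral>\<^sup>+z'. ennreal (sup_diff f z z') * ennreal (K n (z - z')) \<partial>lebesgue \<partial>lebesgue)"
  have le: "ennreal (- (\<integral>z. I z \<partial>lebesgue)) \<le> ?R n" for n
    by (rule doubling_estimate[OF K_cont K_nonneg K_bound K_mass K_W ineq_N ineq_S])
  have C0: "0 \<le> C" using C by simp
  have "?R \<longlonglongrightarrow> 0 + 0 + ennreal H * 0"
    by (intro tendsto_add tendsto_mult_ennreal tendsto_const eta_error
        sup_diff_mollify[OF g_caratheodory K_approx _ C0] sup_diff_mollify[OF f K_approx _ C0]) auto
  then have "?R \<longlonglongrightarrow> 0" by simp
  then have "ennreal (- (\<integral>z. I z \<partial>lebesgue)) \<le> 0"
    by (rule tendsto_lowerbound) (use le in auto)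
  then show ?thesis by (simp add: ennreal_eq_0_iff)
qed

section \<open>Kernels with separate scales in time and space\<close>

text \<open>Both scales of the mollifier can be chosen independently, which is why scaling is needed
  separately in time and space.\<close>

lemma nn_integral_scale:
  fixes u :: "'b::euclidean_space \<Rightarrow> ennreal"
  assumes [measurable]: "u \<in> borel_measurable borel" and d: "0 < d"
  shows "(\<integral>\<^sup>+x. u ((1 / d) *\<^sub>R x) \<partial>lborel) = ennreal (d ^ DIM('b)) * (\<integral>\<^sup>+x. u x \<partial>lborel)"
proof -
  have "(\<integral>\<^sup>+x. u x \<partial>lborel) = ennreal ((1 / d) ^ DIM('b)) * (\<integral>\<^sup>+x. u ((1 / d) *\<^sub>R x) \<partial>lborel)"
    using d by (subst lborel_affine[of "1 / d" 0])
      (simp_all add: nn_integral_density nn_integral_distr nn_integral_cmult)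
  then have "ennreal (d ^ DIM('b)) * (\<integral>\<^sup>+x. u x \<partial>lborel)
      = (ennreal (d ^ DIM('b)) * ennreal ((1 / d) ^ DIM('b))) * (\<integral>\<^sup>+x. u ((1 / d) *\<^sub>R x) \<partial>lborel)"
    by (simp add: mult.assoc)
  also have "ennreal (d ^ DIM('b)) * ennreal ((1 / d) ^ DIM('b)) = 1"
    using d by (simp add: power_divide flip: ennreal_mult ennreal_1)
  finally show ?thesis by simp
qed

lemma nn_integral_scale_product:
  fixes u :: "real \<times> 'b::euclidean_space \<Rightarrow> ennreal"
  assumes u [measurable]: "u \<in> borel_measurable borel" and "0 < e" "0 < d"
  shows "(\<integral>\<^sup>+z. u (fst z / e, (1 / d) *\<^sub>R snd z) \<partial>lborel) = ennreal (e * d ^ DIM('b)) * (\<integral>\<^sup>+z. u z \<partial>lborel)"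
proof -
  have ux: "(\<lambda>x. u (t, x)) \<in> borel_measurable borel" for t
    by (rule measurable_compose[OF _ u]) (auto intro!: borel_measurable_continuous_onI continuous_intros)
  have "(\<lambda>p. u (fst p / e, (1 / d) *\<^sub>R snd p)) \<in> borel_measurable borel"
    by (rule measurable_compose[OF _ u])
      (intro borel_measurable_continuous_onI continuous_intros, use \<open>0 < e\<close> in auto)
  then have m1: "(\<lambda>p. u (fst p / e, (1 / d) *\<^sub>R snd p)) \<in> borel_measurable (lborel \<Otimes>\<^sub>M lborel)"
    and m0: "u \<in> borel_measurable (lborel \<Otimes>\<^sub>M lborel)"
    using u by (simp_all add: lborel_prod)
  have ut: "(\<lambda>t. \<integral>\<^sup>+x. u (t, x) \<partial>lborel) \<in> borel_measurable borel"
    using lborel.borel_measurable_nn_integral_fst[OF m0] by simp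
  have "(\<integral>\<^sup>+z. u (fst z / e, (1 / d) *\<^sub>R snd z) \<partial>lborel) = (\<integral>\<^sup>+t. \<integral>\<^sup>+x. u (t / e, (1 / d) *\<^sub>R x) \<partial>lborel \<partial>lborel)"
    using lborel.nn_integral_fst[OF m1] by (simp add: lborel_prod)
  also have "\<dots> = (\<integral>\<^sup>+t. ennreal (d ^ DIM('b)) * (\<integral>\<^sup>+x. u (t / e, x) \<partial>lborel) \<partial>lborel)"
    using nn_integral_scale[OF ux \<open>0 < d\<close>] by simp
  also have "\<dots> = ennreal (d ^ DIM('b)) * (\<integral>\<^sup>+t. (\<integral>\<^sup>+x. u ((1 / e) *\<^sub>R t, x) \<partial>lborel) \<partial>lborel)"
    using measurable_compose[OF _ ut, of "\<lambda>t. t / e" lborel] by (subst nn_integral_cmult) auto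
  also have "\<dots> = ennreal (d ^ DIM('b)) * (ennreal e * (\<integral>\<^sup>+t. (\<integral>\<^sup>+x. u (t, x) \<partial>lborel) \<partial>lborel))"
    using nn_integral_scale[OF ut \<open>0 < e\<close>] by simp
  also have "(\<integral>\<^sup>+t. (\<integral>\<^sup>+x. u (t, x) \<partial>lborel) \<partial>lborel) = (\<integral>\<^sup>+z. u z \<partial>lborel)"
    using lborel.nn_integral_fst[OF m0] by (simp add: lborel_prod)
  finally show ?thesis
    using assms by (simp add: ennreal_mult mult_ac)
qed

text \<open>If the oscillation depends on space only, a window in time merely contributes its length.\<close>

lemma space_time_collapse:
  fixes D :: "'b::euclidean_space \<Rightarrow> 'b \<Rightarrow> ennreal"
  assumes D [measurable]: "(\<lambda>(x, y). D x y) \<in> borel_measurable (lebesgue \<Otimes>\<^sub>M lebesgue)" and "0 \<le> T" "0 \<le> r"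
  shows "(\<integral>\<^sup>+z. \<integral>\<^sup>+z'. indicator {- T..T} (fst z) * (indicator {- r..r} (fst z - fst z') * D (snd z) (snd z'))
      \<partial>lebesgue \<partial>(lebesgue :: (real \<times> 'b) measure))
    = ennreal (2 * T) * (ennreal (2 * r) * (\<integral>\<^sup>+x. \<integral>\<^sup>+y. D x y \<partial>lebesgue \<partial>lebesgue))"
proof -
  have Dm: "(\<lambda>y. D x y) \<in> borel_measurable lebesgue" for x
    using measurable_Pair2[OF D, of x] by simp
  have DI: "(\<lambda>x. \<integral>\<^sup>+y. D x y \<partial>lebesgue) \<in> borel_measurable lebesgue"
    using leb.borel_measurable_nn_integral[OF D] by simp
  have prodm: "(\<lambda>z'. indicator {- r..r} (t - fst z') * D x (snd z')) \<in> borel_measurable (lebesgue :: (real \<times> 'b) measure)" for t x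
  proof -
    have "(\<lambda>z'. indicator {- r..r} (t - fst z') :: ennreal) \<in> borel_measurable (lebesgue :: (real \<times> 'b) measure)"
    proof -
      have "continuous_on UNIV (\<lambda>z' :: real \<times> 'b. t - fst z')" by (intro continuous_intros)
      then have "(\<lambda>z' :: real \<times> 'b. t - fst z') \<in> borel_measurable borel"
        by (rule borel_measurable_continuous_onI)
      from measurable_compose[OF this borel_measurable_indicator[of "{- r..r}"]]
      show ?thesis by (intro borel_imp_lebesgue_measurable) simp
    qed
    then show ?thesis using measurable_compose[OF measurable_snd_lebesgue_lebesgue Dm[of x]] by measurable
  qed
  have len: "(\<integral>\<^sup>+s. indicator {- r..r} (t - s) \<partial>lebesgue) = ennreal (2 * r)" for t :: real
  proof -
    have "(\<integral>\<^sup>+s. indicator {- r..r} (t - s) \<partial>lebesgue) = (\<integral>\<^sup>+s. indicator {- r..r} s \<partial>lborel)"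
      by (rule nn_integral_reflect(1)) measurable
    then show ?thesis using \<open>0 \<le> r\<close> by simp
  qed
  have inner: "(\<integral>\<^sup>+z'. indicator {- r..r} (t - fst z') * D x (snd z') \<partial>(lebesgue :: (real \<times> 'b) measure))
      = ennreal (2 * r) * (\<integral>\<^sup>+y. D x y \<partial>lebesgue)" for t x
    using nn_integral_lebesgue_product[of "\<lambda>s. indicator {- r..r} (t - s)" "D x"] Dm[of x] len[of t] by simp
  have "(\<integral>\<^sup>+z. \<integral>\<^sup>+z'. indicator {- T..T} (fst z) * (indicator {- r..r} (fst z - fst z') * D (snd z) (snd z'))
      \<partial>lebesgue \<partial>(lebesgue :: (real \<times> 'b) measure))
    = (\<integral>\<^sup>+z. indicator {- T..T} (fst z) * (ennreal (2 * r) * (\<integral>\<^sup>+y. D (snd z) y \<partial>lebesgue)) \<partial>(lebesgue :: (real \<times> 'b) measure))"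
    by (intro nn_integral_cong) (simp add: nn_integral_cmult prodm inner)
  also have "\<dots> = (\<integral>\<^sup>+t. indicator {- T..T} t \<partial>lebesgue) * (\<integral>\<^sup>+x. ennreal (2 * r) * (\<integral>\<^sup>+y. D x y \<partial>lebesgue) \<partial>lebesgue)"
    by (rule nn_integral_lebesgue_product) (use DI in measurable)
  also have "(\<integral>\<^sup>+t. indicator {- T..T} t \<partial>lebesgue) = ennreal (2 * T)"
    using \<open>0 \<le> T\<close> by simp
  also have "(\<integral>\<^sup>+x. ennreal (2 * r) * (\<integral>\<^sup>+y. D x y \<partial>lebesgue) \<partial>lebesgue)
      = ennreal (2 * r) * (\<integral>\<^sup>+x. \<integral>\<^sup>+y. D x y \<partial>lebesgue \<partial>lebesgue)"
    using DI by (rule nn_integral_cmult)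
  finally show ?thesis .
qed

lemma scaled_ball_kernel:
  fixes r :: real
  shows "approximate_kernel (\<lambda>n k. ennreal (real (Suc n) ^ DIM('b::euclidean_space)) * indicator (cball (0::'b) (r / real (Suc n))) k)
     (measure lborel (cball (0::'b) r) + 1)"
  unfolding approximate_kernel_def
proof (intro conjI allI impI)
  fix n
  define c where "c = real (Suc n)"
  have c: "0 < c" by (simp add: c_def)
  have ball: "cball (0::'b) s \<in> sets borel" for s by (rule borel_closed[OF closed_cball])
  show "(\<lambda>k. ennreal (real (Suc n) ^ DIM('b)) * indicator (cball (0::'b) (r / real (Suc n))) k) \<in> borel_measurable borel"
    using borel_measurable_indicator[OF borel_closed[OF closed_cball[of "0::'b" "r / real (Suc n)"]]]
    by (intro borel_measurable_times_ennreal borel_measurable_const)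
  have eq: "indicator (cball (0::'b) (r / c)) k = (indicator (cball 0 r) ((1 / (1 / c)) *\<^sub>R k) :: ennreal)" for k
    using pos_le_divide_eq[OF c, of "norm k" r] c by (simp add: indicator_def mult.commute)
  have "(\<integral>\<^sup>+k. indicator (cball (0::'b) (r / c)) k \<partial>lborel)
      = ennreal ((1 / c) ^ DIM('b)) * (\<integral>\<^sup>+k. indicator (cball (0::'b) r) k \<partial>lborel)"
    unfolding eq
    by (rule nn_integral_scale[OF borel_measurable_indicator[OF borel_closed[OF closed_cball]]]) (use c in simp)
  then have "(\<integral>\<^sup>+k. ennreal (c ^ DIM('b)) * indicator (cball (0::'b) (r / c)) k \<partial>lborel)
      = (ennreal (c ^ DIM('b)) * ennreal ((1 / c) ^ DIM('b))) * emeasure lborel (cball (0::'b) r)"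
    unfolding nn_integral_cmult[OF borel_measurable_indicator[OF ball[THEN sets_lborel[THEN equalityD2, THEN subsetD]]]]
    by (simp add: ball mult.assoc)
  also have "ennreal (c ^ DIM('b)) * ennreal ((1 / c) ^ DIM('b)) = ennreal ((c * (1 / c)) ^ DIM('b))"
    using c by (simp only: power_mult_distrib ennreal_mult' zero_le_power order_less_imp_le)
  also have "\<dots> = 1" using c by simp
  also have "1 * emeasure lborel (cball (0::'b) r) \<le> ennreal (measure lborel (cball (0::'b) r) + 1)"
    using emeasure_bounded_finite[of "cball (0::'b) r"] by (simp add: emeasure_eq_ennreal_measure ennreal_leI)
  finally show "(\<integral>\<^sup>+k. ennreal (real (Suc n) ^ DIM('b)) * indicator (cball (0::'b) (r / real (Suc n))) k \<partial>lborel)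
      \<le> ennreal (measure lborel (cball (0::'b) r) + 1)" unfolding c_def .
next
  fix s :: real assume "0 < s"
  have "(\<lambda>n. r / real (Suc n)) \<longlonglongrightarrow> 0"
    using LIMSEQ_Suc[OF lim_const_over_n[of r]] by simp
  then have "\<forall>\<^sub>F n in sequentially. r / real (Suc n) < s" using \<open>0 < s\<close> by (rule order_tendstoD(2))
  then show "\<forall>\<^sub>F n in sequentially. \<forall>z. ennreal (real (Suc n) ^ DIM('b)) * indicator (cball (0::'b) (r / real (Suc n))) z \<noteq> 0 \<longrightarrow> norm z < s"
    by eventually_elim (auto simp: indicator_def split: if_splits)
qed

lemma nn_integral_bump:
  fixes \<rho> :: "'a::euclidean_space \<Rightarrow> real"
  assumes cont: "continuous_on UNIV \<rho>" and nonneg: "\<And>z. 0 \<le> \<rho> z" and "compact S"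
    and S: "\<And>z. z \<notin> S \<Longrightarrow> \<rho> z = 0" and nz: "\<rho> z0 \<noteq> 0"
  obtains m where "0 < m" "(\<integral>\<^sup>+z. ennreal (\<rho> z) \<partial>lborel) = ennreal m"
proof -
  have [measurable]: "\<rho> \<in> borel_measurable borel" using cont by (rule borel_measurable_continuous_onI)
  obtain M where M: "0 < M" "\<And>z. norm (\<rho> z) \<le> M" using compact_support_bounded[OF cont \<open>compact S\<close> S] by blast
  have [measurable]: "S \<in> sets borel" using \<open>compact S\<close> by (simp add: compact_imp_closed)
  have "(\<integral>\<^sup>+z. ennreal (\<rho> z) \<partial>lborel) \<le> (\<integral>\<^sup>+z. ennreal M * indicator S z \<partial>lborel)"
  proof (rule nn_integral_mono)
    show "ennreal (\<rho> z) \<le> ennreal M * indicator S z" for z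
      using M(2)[of z] S[of z] by (cases "z \<in> S") (auto intro: ennreal_leI)
  qed
  also have "\<dots> = ennreal M * emeasure lborel S" by (rule nn_integral_cmult_indicator) simp
  also have "\<dots> < \<infinity>"
    using emeasure_bounded_finite[OF compact_imp_bounded[OF \<open>compact S\<close>]] by (simp add: ennreal_mult_less_top)
  finally have fin: "(\<integral>\<^sup>+z. ennreal (\<rho> z) \<partial>lborel) < \<infinity>" .
  have "(\<integral>\<^sup>+z. ennreal (\<rho> z) \<partial>lborel) \<noteq> 0"
  proof
    assume "(\<integral>\<^sup>+z. ennreal (\<rho> z) \<partial>lborel) = 0"
    then have "AE z in lborel. ennreal (\<rho> z) = 0" by (subst (asm) nn_integral_0_iff_AE) auto
    then have "AE z in lebesgue. z \<notin> {z. \<rho> z \<noteq> 0}"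
      using nonneg by (intro AE_completion) (auto elim!: eventually_mono simp: ennreal_eq_0_iff order_antisym)
    then have "negligible {z. \<rho> z \<noteq> 0}"
      by (simp add: negligible_iff_null_sets AE_iff_null_sets completion.complete2 eventually_ae_filter)
    moreover have "open {z. \<rho> z \<noteq> 0}"
      using open_Collect_neq[OF cont continuous_on_const[of _ 0]] by simp
    ultimately show False using nz open_not_negligible by blast
  qed
  with fin that show thesis
    by (cases "\<integral>\<^sup>+z. ennreal (\<rho> z) \<partial>lborel") (auto simp: less_top)
qed

text \<open>The kernels are rescaled copies of a bump function, with time scale tending to zero and the spatial
  scale chosen after it. The time derivative grows like the inverse of the time scale, but it only
  meets the spatial oscillation of \<open>\<eta>\<close>, which a much smaller spatial scale makes negligible.\<close>

lemma mollifier_sequence: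
  fixes \<rho> \<psi> :: "real \<times> 'b::euclidean_space \<Rightarrow> real"
  assumes smooth: "smooth \<rho>" and nonneg: "\<And>z. 0 \<le> \<rho> z" and nz: "\<rho> z0 \<noteq> 0"
    and cS: "compact S" and S: "closure {z. \<rho> z \<noteq> 0} \<subseteq> S" and S_pos: "\<And>z. z \<in> S \<Longrightarrow> 0 \<le> fst z"
    and eta: "caratheodory C Feta eta" and C: "0 \<le> C"
    and psi: "\<And>z. 0 \<le> \<psi> z" "\<And>z. \<psi> z \<le> H" "\<And>z. T < \<bar>fst z\<bar> \<Longrightarrow> \<psi> z = 0"
    and pos: "0 < \<tau>"
  obtains K :: "nat \<Rightarrow> real \<times> 'b \<Rightarrow> real" where
    "\<And>n. smooth (K n)" "\<And>n h. 0 \<le> K n h" "\<And>n. (\<integral>\<^sup>+h. ennreal (K n h) \<partial>lborel) = 1"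
    "approximate_kernel (\<lambda>n h. ennreal (K n h)) 1"
    "\<And>n. closure {h. K n h \<noteq> 0} \<subseteq> {0..\<tau>} \<times> cball 0 1"
    "(\<lambda>n. \<integral>\<^sup>+z. \<integral>\<^sup>+z'. ennreal (2 * sup_diff eta (snd z) (snd z') * \<psi> z * \<bar>Dt (K n) (z - z')\<bar>)
        \<partial>lebesgue \<partial>lebesgue) \<longlonglongrightarrow> 0"
proof -
  have S0: "\<rho> z = 0" "Dt \<rho> z = 0" if "z \<notin> S" for z
    using that S Dt_Dx_eq_0_outside_support[of z \<rho>] closure_subset[of "{z. \<rho> z \<noteq> 0}"] by auto
  obtain m where m: "0 < m" "(\<integral>\<^sup>+z. ennreal (\<rho> z) \<partial>lborel) = ennreal m"
    using nn_integral_bump[OF smooth_imp(2)[OF smooth] nonneg cS S0(1) nz] by blast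
  obtain M where M: "0 < M" "\<And>z. norm (Dt \<rho> z) \<le> M"
    using compact_support_bounded[OF continuous_Dt[OF smooth] cS S0(2)] by blast
  obtain r where r: "0 < r" "\<And>z. z \<in> S \<Longrightarrow> norm z \<le> r"
    using compact_imp_bounded[OF cS] unfolding bounded_pos by blast
  have rS: "\<bar>fst z\<bar> \<le> r" "norm (snd z) \<le> r" if "z \<in> S" for z
    using r(2)[OF that] norm_fst_le[of "fst z" "snd z"] norm_snd_le[of "snd z" "fst z"] by auto
  define c where "c e d = 1 / (e * d ^ DIM('b) * m)" for e d :: real
  define L where "L e d h = (0 + ((1 / e) * fst h, (1 / d) *\<^sub>R snd h))" for e d :: real and h :: "real \<times> 'b"
  define k where "k e d h = c e d * \<rho> (L e d h)" for e d :: real and h :: "real \<times> 'b"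
  have k_smooth: "smooth (k e d)" for e d
    unfolding k_def[abs_def] L_def by (intro smooth_cmult smooth_scale smooth)
  have k_Dt: "Dt (k e d) h = c e d * ((1 / e) * Dt \<rho> (L e d h))" for e d h
    unfolding k_def[abs_def] L_def by (simp only: Dt_cmult[OF smooth_scale[OF smooth]] Dt_scale[OF smooth])
  have k_nonneg: "0 \<le> k e d h" if "0 < e" "0 < d" for e d h
    using that m nonneg by (simp add: k_def c_def)
  have \<rho>m [measurable]: "\<rho> \<in> borel_measurable borel"
    by (rule borel_measurable_continuous_onI[OF smooth_imp(2)[OF smooth]])
  have k_mass: "(\<integral>\<^sup>+h. ennreal (k e d h) \<partial>lborel) = 1" if "0 < e" "0 < d" for e d
  proof -
    have c0: "0 \<le> c e d" using that m by (simp add: c_def)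
    have "(\<lambda>h. ennreal (\<rho> (L e d h))) \<in> borel_measurable borel"
      using smooth_imp(2)[OF smooth_scale[OF smooth, of 0 "1 / e" "1 / d"]]
      by (intro measurable_compose[OF _ measurable_ennreal] borel_measurable_continuous_onI) (simp add: L_def)
    then have "(\<integral>\<^sup>+h. ennreal (k e d h) \<partial>lborel) = ennreal (c e d) * (\<integral>\<^sup>+h. ennreal (\<rho> (L e d h)) \<partial>lborel)"
      unfolding k_def using c0 nonneg by (simp add: ennreal_mult nn_integral_cmult)
    also have "(\<integral>\<^sup>+h. ennreal (\<rho> (L e d h)) \<partial>lborel) = ennreal (e * d ^ DIM('b)) * ennreal m"
      using nn_integral_scale_product[of "\<lambda>z. ennreal (\<rho> z)" e d] that m by (simp add: L_def)
    also have "ennreal (c e d) * (ennreal (e * d ^ DIM('b)) * ennreal m) = ennreal (c e d * (e * d ^ DIM('b) * m))"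
      using that m c0 by (simp flip: ennreal_mult)
    also have "c e d * (e * d ^ DIM('b) * m) = 1" using that m by (simp add: c_def)
    finally show ?thesis by simp
  qed
  have L_S: "0 \<le> fst h \<and> fst h \<le> e * r \<and> norm (snd h) \<le> d * r" if "0 < e" "0 < d" "L e d h \<in> S" for e d h
  proof -
    have "0 \<le> fst h / e" "\<bar>fst h / e\<bar> \<le> r" "norm (snd h) / d \<le> r"
      using S_pos[OF that(3)] rS[OF that(3)] that(1,2) by (simp_all add: L_def)
    then show ?thesis
      using that(1,2) by (simp add: zero_le_divide_iff pos_divide_le_eq mult.commute[of r])
  qed
  have k_supp: "0 \<le> fst h \<and> fst h \<le> e * r \<and> norm (snd h) \<le> d * r" if "0 < e" "0 < d" "k e d h \<noteq> 0" for e d h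
  proof (rule L_S[OF that(1,2)])
    show "L e d h \<in> S" using S0(1)[of "L e d h"] that(3) unfolding k_def by force
  qed
  have k_closure: "closure {h. k e d h \<noteq> 0} \<subseteq> {0..e * r} \<times> cball 0 (d * r)" if "0 < e" "0 < d" for e d
    by (rule closure_minimal) (use k_supp[OF that] in \<open>auto intro!: closed_Times\<close>)
  let ?E = "\<lambda>e d. \<integral>\<^sup>+z. \<integral>\<^sup>+z'. ennreal (2 * sup_diff eta (snd z) (snd z') * \<psi> z * \<bar>Dt (k e d) (z - z')\<bar>)
        \<partial>lebesgue \<partial>lebesgue"
  let ?\<kappa> = "\<lambda>j h. ennreal (real (Suc j) ^ DIM('b)) * indicator (cball (0::'b) (r / real (Suc j))) h"
  have H: "0 \<le> H" using psi(1,2)[of undefined] by linarith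
  \<comment> \<open>At a fixed time scale the time derivative of the kernel is a bounded multiple of a spatial
    averaging kernel, so the oscillation of \<open>\<eta>\<close> is averaged out as the spatial scale shrinks.\<close>
  have E_lim: "(\<lambda>j. ?E e (1 / real (Suc j))) \<longlonglongrightarrow> 0" if e: "0 < e" for e
  proof -
    define T' where "T' = max T 0"
    have T': "0 \<le> T'" "\<And>z. T' < \<bar>fst z\<bar> \<Longrightarrow> \<psi> z = 0" using psi(3) by (auto simp: T'_def)
    define c2 where "c2 = 2 * H * (M / (e * e * m))"
    have c2: "0 \<le> c2" using H M m e by (simp add: c2_def)
    let ?D = "\<lambda>j x y. ennreal (sup_diff eta x y) * ?\<kappa> j (x - y)"
    have Dm: "(\<lambda>(x, y). ?D j x y) \<in> borel_measurable (lebesgue \<Otimes>\<^sub>M lebesgue)" for j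
    proof -
      have 1: "(\<lambda>p. ?\<kappa> j (fst p - snd p)) \<in> borel_measurable (lebesgue \<Otimes>\<^sub>M lebesgue)"
        by (rule borel_measurable_kernel_pair) (use scaled_ball_kernel[of r, where ?'b='b] in \<open>unfold approximate_kernel_def, blast\<close>)
      have 2: "(\<lambda>p. ennreal (sup_diff eta (fst p) (snd p))) \<in> borel_measurable (lebesgue \<Otimes>\<^sub>M lebesgue)"
        using measurable_compose[OF sup_diff_measurable[OF eta] measurable_ennreal] by (simp add: case_prod_unfold)
      from borel_measurable_times_ennreal[OF 2 1] show ?thesis by (simp only: case_prod_unfold)
    qed
    have bound: "?E e (1 / real (Suc j)) \<le> ennreal c2 * (ennreal (2 * T') * (ennreal (2 * (e * r)) *
        (\<integral>\<^sup>+x. \<integral>\<^sup>+y. ?D j x y \<partial>lebesgue \<partial>lebesgue)))" for j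
    proof -
      define d where "d = 1 / real (Suc j)"
      have d: "0 < d" "d * r = r / real (Suc j)" by (auto simp: d_def)
      have cd: "c e d * (1 / e) = real (Suc j) ^ DIM('b) * (1 / (e * e * m))"
        by (simp add: c_def d_def power_divide del: of_nat_Suc)
      have Dt_bound: "\<bar>Dt (k e d) h\<bar> \<le> (M / (e * e * m)) * (indicator {- (e * r)..e * r} (fst h) *
          (real (Suc j) ^ DIM('b) * indicator (cball 0 (r / real (Suc j))) (snd h)))" for h
      proof (cases "L e d h \<in> S")
        case True
        from L_S[OF e d(1) True] have in_supp: "fst h \<in> {- (e * r)..e * r}" "snd h \<in> cball 0 (r / real (Suc j))"
          unfolding d(2) using e r(1) mult_pos_pos[OF e r(1)] by (auto simp del: of_nat_Suc)
        have "\<bar>Dt (k e d) h\<bar> = c e d * (1 / e) * \<bar>Dt \<rho> (L e d h)\<bar>"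
          using e d(1) m by (simp add: k_Dt abs_mult c_def)
        also have "\<dots> \<le> c e d * (1 / e) * M"
          using M(2)[of "L e d h"] e d(1) m by (intro mult_left_mono) (auto simp: c_def)
        also have "\<dots> = (M / (e * e * m)) * real (Suc j) ^ DIM('b)" unfolding cd by simp
        finally show ?thesis using in_supp by (simp del: of_nat_Suc)
      next
        case False
        then show ?thesis using S0(2)[of "L e d h"] M m e by (simp add: k_Dt)
      qed
      have "?E e d \<le> (\<integral>\<^sup>+z. \<integral>\<^sup>+z'. ennreal c2 * (indicator {- T'..T'} (fst z) *
          (indicator {- (e * r)..e * r} (fst z - fst z') * ?D j (snd z) (snd z'))) \<partial>lebesgue \<partial>lebesgue)"
      proof (intro nn_integral_mono)
        fix z z' :: "real \<times> 'b"
        let ?s = "sup_diff eta (snd z) (snd z')"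
        let ?i = "indicator {- (e * r)..e * r} (fst z - fst z') :: real"
        let ?j = "indicator (cball 0 (r / real (Suc j))) (snd z - snd z') :: real"
        let ?t = "indicator {- T'..T'} (fst z) :: real"
        have s0: "0 \<le> ?s" by (rule sup_diff_nonneg[OF eta])
        have "\<psi> z \<le> H * ?t" using psi(2)[of z] T'(2)[of z] H by (auto simp: indicator_def abs_le_iff not_le)
        then have "2 * ?s * \<psi> z * \<bar>Dt (k e d) (z - z')\<bar>
            \<le> 2 * ?s * (H * ?t) * ((M / (e * e * m)) * (?i * (real (Suc j) ^ DIM('b) * ?j)))"
          using Dt_bound[of "z - z'"] s0 psi(1)[of z] H M m e
          by (intro mult_mono mult_left_mono) (auto simp del: of_nat_Suc)
        also have "\<dots> = c2 * (?t * (?i * (?s * (real (Suc j) ^ DIM('b) * ?j))))"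
          by (simp add: c2_def del: of_nat_Suc)
        finally have "ennreal (2 * ?s * \<psi> z * \<bar>Dt (k e d) (z - z')\<bar>) \<le> ennreal (c2 * (?t * (?i * (?s * (real (Suc j) ^ DIM('b) * ?j)))))"
          by (rule ennreal_leI)
        also have "\<dots> = ennreal c2 * (indicator {- T'..T'} (fst z) * (indicator {- (e * r)..e * r} (fst z - fst z') * ?D j (snd z) (snd z')))"
          using c2 s0 by (simp add: ennreal_mult ennreal_indicator del: of_nat_Suc ennreal_power)
        finally show "ennreal (2 * ?s * \<psi> z * \<bar>Dt (k e d) (z - z')\<bar>) \<le>
            ennreal c2 * (indicator {- T'..T'} (fst z) * (indicator {- (e * r)..e * r} (fst z - fst z') * ?D j (snd z) (snd z')))" .
      qed
      also have "\<dots> = ennreal c2 * (\<integral>\<^sup>+z. \<integral>\<^sup>+z'. indicator {- T'..T'} (fst z) *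
          (indicator {- (e * r)..e * r} (fst z - fst z') * ?D j (snd z) (snd z')) \<partial>lebesgue \<partial>lebesgue)"
      proof -
        have 1: "(\<lambda>(z, z'). indicator {- T'..T'} (fst z) * (indicator {- (e * r)..e * r} (fst z - fst z') * ?D j (snd z) (snd z')))
           \<in> borel_measurable ((lebesgue :: (real \<times> 'b) measure) \<Otimes>\<^sub>M (lebesgue :: (real \<times> 'b) measure))"
        proof -
          have f1: "(\<lambda>z. indicator {- T'..T'} (fst z) :: ennreal) \<in> borel_measurable (lebesgue :: (real \<times> 'b) measure)"
            by (intro borel_imp_lebesgue_measurable measurable_compose[OF borel_measurable_continuous_onI[OF continuous_on_fst[OF continuous_on_id]]]) simp
          have f2: "(\<lambda>p. indicator {- (e * r)..e * r} (fst (fst p) - fst (snd p)) :: ennreal) \<in>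
             borel_measurable ((lebesgue :: (real \<times> 'b) measure) \<Otimes>\<^sub>M (lebesgue :: (real \<times> 'b) measure))"
          proof -
            have k1: "(\<lambda>z. indicator {- (e * r)..e * r} (fst z) :: ennreal) \<in> borel_measurable (borel :: (real \<times> 'b) measure)"
              by (intro measurable_compose[OF borel_measurable_continuous_onI[OF continuous_on_fst[OF continuous_on_id]]]) simp
            show ?thesis using borel_measurable_kernel_pair[OF k1] by simp
          qed
          have "(\<lambda>p. (snd (fst p), snd (snd p))) \<in>
              (lebesgue :: (real \<times> 'b) measure) \<Otimes>\<^sub>M (lebesgue :: (real \<times> 'b) measure) \<rightarrow>\<^sub>M lebesgue \<Otimes>\<^sub>M lebesgue"
            by (intro measurable_Pair measurable_compose[OF measurable_fst measurable_snd_lebesgue_lebesgue]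
              measurable_compose[OF measurable_snd measurable_snd_lebesgue_lebesgue])
          from measurable_compose[OF this Dm[of j]]
          have f3: "(\<lambda>p. ?D j (snd (fst p)) (snd (snd p))) \<in>
              borel_measurable ((lebesgue :: (real \<times> 'b) measure) \<Otimes>\<^sub>M (lebesgue :: (real \<times> 'b) measure))"
            by (simp only: case_prod_conv)
          show ?thesis unfolding case_prod_unfold
            by (intro borel_measurable_times_ennreal f2 f3 measurable_compose[OF measurable_fst f1])
        qed
        have "(\<integral>\<^sup>+z'. ennreal c2 * u z z' \<partial>lebesgue) = ennreal c2 * (\<integral>\<^sup>+z'. u z z' \<partial>lebesgue)"
          if "(\<lambda>(z, z'). u z z') \<in> borel_measurable ((lebesgue :: (real \<times> 'b) measure) \<Otimes>\<^sub>M (lebesgue :: (real \<times> 'b) measure))" for u z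
          using measurable_Pair2[OF that, of z] by (intro nn_integral_cmult) simp
        from this[OF 1] leb.borel_measurable_nn_integral[OF 1]
        show ?thesis by (simp only: nn_integral_cmult)
      qed
      also have "\<dots> = ennreal c2 * (ennreal (2 * T') * (ennreal (2 * (e * r)) * (\<integral>\<^sup>+x. \<integral>\<^sup>+y. ?D j x y \<partial>lebesgue \<partial>lebesgue)))"
        by (subst space_time_collapse[OF Dm T'(1)]) (use e r(1) in auto)
      finally show ?thesis unfolding d_def .
    qed
    have "(\<lambda>j. \<integral>\<^sup>+x. \<integral>\<^sup>+y. ?D j x y \<partial>lebesgue \<partial>lebesgue) \<longlonglongrightarrow> 0"
      by (rule sup_diff_mollify[OF eta scaled_ball_kernel _ C]) (simp add: add_nonneg_pos)
    then have "(\<lambda>j. ennreal c2 * (ennreal (2 * T') * (ennreal (2 * (e * r)) *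
        (\<integral>\<^sup>+x. \<integral>\<^sup>+y. ?D j x y \<partial>lebesgue \<partial>lebesgue)))) \<longlonglongrightarrow> ennreal c2 * (ennreal (2 * T') * (ennreal (2 * (e * r)) * 0))"
      by (intro tendsto_mult_ennreal tendsto_const) auto
    then have lim: "(\<lambda>j. ennreal c2 * (ennreal (2 * T') * (ennreal (2 * (e * r)) *
        (\<integral>\<^sup>+x. \<integral>\<^sup>+y. ?D j x y \<partial>lebesgue \<partial>lebesgue)))) \<longlonglongrightarrow> 0" by simp
    show ?thesis
      by (rule tendsto_sandwich[OF _ _ tendsto_const lim]) (simp_all only: bound zero_le eventually_sequentially, auto)
  qed
  define e where "e n = \<tau> / r / real (Suc n)" for n
  have e: "0 < e n" "e n * r = \<tau> / real (Suc n)" for n using pos r(1) by (auto simp: e_def)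
  \<comment> \<open>The index is at least \<open>n\<close> so that the supports shrink, and at least \<open>r - 1\<close> so that they stay
    within unit distance.\<close>
  have "\<exists>j. n \<le> j \<and> r \<le> real (Suc j) \<and> ?E (e n) (1 / real (Suc j)) < ennreal (1 / real (Suc n))" for n
  proof -
    have "\<forall>\<^sub>F j in sequentially. ?E (e n) (1 / real (Suc j)) < ennreal (1 / real (Suc n))"
      by (rule order_tendstoD(2)[OF E_lim[OF e(1)]]) simp
    moreover have "\<forall>\<^sub>F j in sequentially. n \<le> j" by (rule eventually_ge_at_top)
    moreover have "\<forall>\<^sub>F j in sequentially. nat \<lceil>r\<rceil> \<le> j" by (rule eventually_ge_at_top)
    ultimately have "\<forall>\<^sub>F j in sequentially. n \<le> j \<and> r \<le> real (Suc j) \<and> ?E (e n) (1 / real (Suc j)) < ennreal (1 / real (Suc n))"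
    proof eventually_elim
      case (elim j)
      from elim(3) have "r \<le> real (Suc j)" by linarith
      with elim show ?case by blast
    qed
    then show ?thesis by (rule eventually_happens'[OF sequentially_bot])
  qed
  from choice[OF allI[OF this]] obtain j where
    "\<forall>n. n \<le> j n \<and> r \<le> real (Suc (j n)) \<and> ?E (e n) (1 / real (Suc (j n))) < ennreal (1 / real (Suc n))" ..
  then have j: "n \<le> j n" "r \<le> real (Suc (j n))"
    "?E (e n) (1 / real (Suc (j n))) < ennreal (1 / real (Suc n))" for n by blast+
  define K where "K n = k (e n) (1 / real (Suc (j n)))" for n
  have d: "0 < 1 / real (Suc (j n))" for n by simp
  have inv_lim: "(\<lambda>n. a / real (Suc n)) \<longlonglongrightarrow> 0" for a :: real
    using LIMSEQ_Suc[OF lim_const_over_n[of a]] by simp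
  show thesis
  proof (rule that[of K])
    show "smooth (K n)" for n unfolding K_def by (rule k_smooth)
    show "0 \<le> K n h" for n h unfolding K_def by (rule k_nonneg[OF e(1) d])
    show mass: "(\<integral>\<^sup>+h. ennreal (K n h) \<partial>lborel) = 1" for n unfolding K_def by (rule k_mass[OF e(1) d])
    have small: "norm h \<le> (\<tau> + r) / real (Suc n)" if "K n h \<noteq> 0" for n h
    proof -
      from k_supp[OF e(1) d that[unfolded K_def]]
      have 1: "0 \<le> fst h" "fst h \<le> \<tau> / real (Suc n)" "norm (snd h) \<le> r / real (Suc (j n))" by (simp_all add: e(2))
      have "r / real (Suc (j n)) \<le> r / real (Suc n)" using r(1) j(1)[of n] by (intro divide_left_mono) auto
      then have "\<bar>fst h\<bar> + norm (snd h) \<le> (\<tau> + r) / real (Suc n)" using 1 by (simp add: add_divide_distrib)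
      then show ?thesis using norm_Pair_le[of "fst h" "snd h"] by simp
    qed
    show "approximate_kernel (\<lambda>n h. ennreal (K n h)) 1"
      unfolding approximate_kernel_def
    proof (intro conjI allI impI)
      show "(\<lambda>h. ennreal (K n h)) \<in> borel_measurable borel" for n
        unfolding K_def by (intro measurable_compose[OF _ measurable_ennreal] borel_measurable_continuous_onI smooth_imp(2) k_smooth)
      show "(\<integral>\<^sup>+h. ennreal (K n h) \<partial>lborel) \<le> ennreal 1" for n by (simp add: mass)
      fix s :: real assume "0 < s"
      then have "\<forall>\<^sub>F n in sequentially. (\<tau> + r) / real (Suc n) < s" by (rule order_tendstoD(2)[OF inv_lim])
      then show "\<forall>\<^sub>F n in sequentially. \<forall>z. ennreal (K n z) \<noteq> 0 \<longrightarrow> norm z < s"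
      proof eventually_elim
        case (elim n)
        show ?case
        proof (intro allI impI)
          fix z assume "ennreal (K n z) \<noteq> 0"
          then have "K n z \<noteq> 0" by auto
          from small[OF this] elim show "norm z < s" by linarith
        qed
      qed
    qed
    show "closure {h. K n h \<noteq> 0} \<subseteq> {0..\<tau>} \<times> cball 0 1" for n
    proof -
      have c: "closure {h. K n h \<noteq> 0} \<subseteq> {0..\<tau> / real (Suc n)} \<times> cball 0 (r / real (Suc (j n)))"
        using k_closure[OF e(1) d] by (simp add: K_def e(2))
      have "\<tau> / real (Suc n) \<le> \<tau>" using pos by (simp add: pos_divide_le_eq mult_le_cancel_left1)
      moreover have "r / real (Suc (j n)) \<le> 1" using j(2)[of n] by (simp add: pos_divide_le_eq)
      ultimately have "{0..\<tau> / real (Suc n)} \<times> cball 0 (r / real (Suc (j n))) \<subseteq> {0..\<tau>} \<times> cball (0::'b) 1"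
        by (intro Sigma_mono subset_cball) (simp_all del: of_nat_Suc)
      with c show ?thesis by (rule order_trans)
    qed
    have "(\<lambda>n. ennreal (1 / real (Suc n))) \<longlonglongrightarrow> ennreal 0" by (intro tendsto_ennrealI inv_lim)
    then have lim: "(\<lambda>n. ennreal (1 / real (Suc n))) \<longlonglongrightarrow> 0" by simp
    show "(\<lambda>n. \<integral>\<^sup>+z. \<integral>\<^sup>+z'. ennreal (2 * sup_diff eta (snd z) (snd z') * \<psi> z * \<bar>Dt (K n) (z - z')\<bar>)
        \<partial>lebesgue \<partial>lebesgue) \<longlonglongrightarrow> 0"
      unfolding K_def
      by (rule tendsto_sandwich[OF _ _ tendsto_const lim]) (use j(3) in \<open>auto intro!: less_imp_le always_eventually\<close>)
  qed
qed

section \<open>Young measures as probability kernels\<close>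

lemma half_space_lebesgue [measurable]: "half_space \<in> sets lebesgue"
  unfolding half_space_def by (auto intro!: sets_completionI_sets borel_open open_Times)

text \<open>The complement of the support is a union of open null sets, and countably many of them suffice.\<close>

lemma measure_support_null:
  assumes sets: "sets M = sets (borel :: real measure)" and sub: "measure_support M \<subseteq> {- C..C}"
  shows "AE l in M. \<bar>l\<bar> \<le> C"
proof -
  let ?F = "{U. open U \<and> emeasure M U = 0}"
  obtain F' where F': "F' \<subseteq> ?F" "countable F'" "\<Union>F' = \<Union>?F"
    using Lindelof[of ?F] by auto
  have "(\<Union>U\<in>F'. U) \<in> null_sets M"
    using F' sets by (intro null_sets_UN') (auto simp: null_sets_def)
  moreover have "{l \<in> space M. \<not> \<bar>l\<bar> \<le> C} \<subseteq> (\<Union>U\<in>F'. U)"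
  proof
    fix l assume "l \<in> {l \<in> space M. \<not> \<bar>l\<bar> \<le> C}"
    then have "l \<notin> measure_support M" using sub by (auto simp: abs_le_iff)
    then have "l \<in> \<Union>?F" by (auto simp: measure_support_def)
    then show "l \<in> (\<Union>U\<in>F'. U)" using F'(3) by auto
  qed
  ultimately show ?thesis by (rule AE_I')
qed

text \<open>Off the good set the Young measure is replaced by a Dirac mass, which makes it a probability
  kernel at every point; the test functions vanish there up to a null set.\<close>

definition restricted_kernel :: "'a set \<Rightarrow> ('a \<Rightarrow> real measure) \<Rightarrow> 'a \<Rightarrow> real measure" where
  "restricted_kernel G \<nu> z = (if z \<in> G then \<nu> z else return borel 0)"

text \<open>The indicator of a half-line is the pointwise limit of functions with compact support, so
  testing against functions that vanish at infinity determines the distribution functions.\<close>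

definition ramp :: "nat \<Rightarrow> real \<Rightarrow> real \<Rightarrow> real" where
  "ramp n a l = max 0 (min 1 (1 - real n * (l - a))) * max 0 (min 1 (l + real n))"

lemma ramp_bounds: "0 \<le> ramp n a l" "ramp n a l \<le> 1"
  unfolding ramp_def by (auto intro!: mult_le_one)

lemma ramp_continuous: "continuous_on UNIV (ramp n a)"
  unfolding ramp_def[abs_def] by (intro continuous_intros)

lemma ramp_C0: "ramp (Suc n) a \<in> C0_functions"
  unfolding C0_functions_def
proof (intro CollectI conjI ramp_continuous tendsto_eventually)
  show "\<forall>\<^sub>F l in at_infinity. ramp (Suc n) a l = 0"
    unfolding eventually_at_infinity
  proof (intro exI allI impI)
    fix l assume l: "\<bar>a\<bar> + real (Suc n) + 1 \<le> norm (l :: real)"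
    show "ramp (Suc n) a l = 0"
    proof (cases "0 \<le> l")
      case True
      then have "1 \<le> l - a" using l by auto
      then have "1 * 1 \<le> real (Suc n) * (l - a)" by (intro mult_mono) auto
      then show ?thesis by (simp add: ramp_def)
    qed (use l in \<open>simp add: ramp_def\<close>)
  qed
qed

lemma ramp_tendsto: "(\<lambda>n. ramp (Suc n) a l) \<longlonglongrightarrow> indicator {..a} l"
proof (rule tendsto_eventually)
  have "\<forall>\<^sub>F n in sequentially. nat \<lceil>\<bar>l\<bar> + 1\<rceil> \<le> n" by (rule eventually_ge_at_top)
  moreover have "\<forall>\<^sub>F n in sequentially. l > a \<longrightarrow> nat \<lceil>1 / (l - a)\<rceil> \<le> n"
    using eventually_ge_at_top[of "nat \<lceil>1 / (l - a)\<rceil>"] by eventually_elim simp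
  ultimately show "\<forall>\<^sub>F n in sequentially. ramp (Suc n) a l = indicator {..a} l"
  proof eventually_elim
    case (elim n)
    have 1: "max 0 (min 1 (l + real (Suc n))) = 1" using elim(1) by linarith
    show ?case
    proof (cases "l \<le> a")
      case True
      then have "real (Suc n) * (l - a) \<le> 0" by (intro mult_nonneg_nonpos) auto
      then show ?thesis using True 1 by (simp add: ramp_def del: of_nat_Suc)
    next
      case False
      then have "1 / (l - a) \<le> real (Suc n)" using elim(2) by linarith
      then have "1 \<le> real (Suc n) * (l - a)" using False by (simp add: pos_divide_le_eq)
      then show ?thesis using False by (simp add: ramp_def del: of_nat_Suc)
    qed
  qed
qed

lemma restricted_kernel_measurable:
  fixes \<nu> :: "real \<times> (real^'n) \<Rightarrow> real measure"
  assumes G: "G \<in> sets lebesgue" "G \<subseteq> half_space"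
    and wm: "weak_star_measurable \<nu>" and prob: "\<And>z. z \<in> G \<Longrightarrow> \<nu> z \<in> space (prob_algebra borel)"
  shows "restricted_kernel G \<nu> \<in> lebesgue \<rightarrow>\<^sub>M prob_algebra borel"
proof -
  have [measurable]: "G \<in> sets lebesgue" by (rule G(1))
  let ?N = "restricted_kernel G \<nu>"
  have pr: "prob_space (?N z)" "sets (?N z) = sets borel" for z
  proof -
    have "?N z \<in> space (prob_algebra borel)"
    proof (cases "z \<in> G")
      case True
      then show ?thesis using prob[OF True] unfolding restricted_kernel_def by simp
    next
      case False
      have "return borel (0::real) \<in> space (prob_algebra borel)"
        by (rule measurable_space[OF measurable_return_prob_space]) (simp only: space_borel UNIV_I)
      with False show ?thesis unfolding restricted_kernel_def by (simp only: if_False)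
    qed
    then show "prob_space (?N z)" "sets (?N z) = sets borel"
      unfolding space_prob_algebra by blast+
  qed
  show ?thesis
  proof (rule measurable_prob_algebra_generated[of borel UNIV "range (\<lambda>a::real. {..a})"])
    show "sets (borel :: real measure) = sigma_sets UNIV (range (\<lambda>a. {..a}))"
      by (simp add: borel_eq_atMost)
    show "Int_stable (range (\<lambda>a::real. {..a}))" by (auto simp: Int_stable_def)
    fix A :: "real set" assume "A \<in> range (\<lambda>a. {..a})"
    then obtain a where A: "A = {..a}" by auto
    have m: "(\<lambda>z. \<integral>l. ramp (Suc n) a l \<partial>?N z) \<in> borel_measurable lebesgue" for n
    proof -
      have "(\<lambda>z. \<integral>l. ramp (Suc n) a l \<partial>\<nu> z) \<in> borel_measurable (lebesgue_on half_space)"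
        using wm ramp_C0 by (auto simp: weak_star_measurable_def)
      then have "(\<lambda>z. indicator half_space z *\<^sub>R (\<integral>l. ramp (Suc n) a l \<partial>\<nu> z)) \<in> borel_measurable lebesgue"
        by (subst (asm) borel_measurable_restrict_space_iff) auto
      then have "(\<lambda>z. if z \<in> G then indicator half_space z *\<^sub>R (\<integral>l. ramp (Suc n) a l \<partial>\<nu> z) else ramp (Suc n) a 0) \<in> borel_measurable lebesgue"
        by measurable
      also have "(\<lambda>z. if z \<in> G then indicator half_space z *\<^sub>R (\<integral>l. ramp (Suc n) a l \<partial>\<nu> z) else ramp (Suc n) a 0)
          = (\<lambda>z. \<integral>l. ramp (Suc n) a l \<partial>?N z)"
        using G(2) borel_measurable_continuous_onI[OF ramp_continuous]
        by (auto simp: restricted_kernel_def fun_eq_iff integral_return)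
      finally show ?thesis .
    qed
    have lim: "(\<lambda>n. \<integral>l. ramp (Suc n) a l \<partial>?N z) \<longlonglongrightarrow> measure (?N z) {..a}" for z
    proof -
      interpret prob_space "?N z" by (rule pr)
      have rm: "ramp n a \<in> borel_measurable (?N z)" for n
        unfolding measurable_cong_sets[OF pr(2) refl] by (rule borel_measurable_continuous_onI[OF ramp_continuous])
      have "(\<lambda>n. \<integral>l. ramp (Suc n) a l \<partial>?N z) \<longlonglongrightarrow> (\<integral>l. indicator {..a} l \<partial>?N z)"
      proof (rule integral_dominated_convergence[where w="\<lambda>_. 1"])
        show "AE l in ?N z. (\<lambda>n. ramp (Suc n) a l) \<longlonglongrightarrow> indicator {..a} l" using ramp_tendsto by auto
        show "AE l in ?N z. norm (ramp (Suc n) a l) \<le> 1" for n using ramp_bounds[of "Suc n" a] by auto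
        show "(\<lambda>l. indicat_real {..a} l) \<in> borel_measurable (?N z)"
          unfolding measurable_cong_sets[OF pr(2) refl] by simp
      qed (rule rm integrable_const)+
      then show ?thesis
        by (simp only: Bochner_Integration.integral_indicator sets_eq_imp_space_eq[OF pr(2)] space_borel Int_UNIV_right)
    qed
    have "(\<lambda>z. measure (?N z) {..a}) \<in> borel_measurable lebesgue"
      by (rule borel_measurable_LIMSEQ_real[OF lim m])
    then have "(\<lambda>z. ennreal (measure (?N z) {..a})) \<in> borel_measurable lebesgue"
      by (rule measurable_compose[OF _ measurable_ennreal])
    moreover have "ennreal (measure (?N z) {..a}) = emeasure (?N z) {..a}" for z
    proof -
      interpret prob_space "?N z" by (rule pr)
      show ?thesis by (rule emeasure_eq_measure[symmetric])
    qed
    ultimately show "(\<lambda>z. emeasure (?N z) A) \<in> borel_measurable lebesgue" unfolding A by (simp only:)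
  qed (rule subset_UNIV pr | simp)+
qed

lemma restricted_kernel_bound:
  assumes "\<And>z. z \<in> G \<Longrightarrow> \<nu> z \<in> space (prob_algebra borel)"
    and "\<And>z. z \<in> G \<Longrightarrow> measure_support (\<nu> z) \<subseteq> {- C..C}" and "0 \<le> C"
  shows "AE l in restricted_kernel G \<nu> z. \<bar>l\<bar> \<le> C"
proof (cases "z \<in> G")
  case True
  then have "sets (\<nu> z) = sets borel" "measure_support (\<nu> z) \<subseteq> {- C..C}"
    using assms(1)[OF True] assms(2)[OF True] by (simp_all add: space_prob_algebra)
  from measure_support_null[OF this] show ?thesis by (simp only: restricted_kernel_def True if_True)
next
  case False
  have "AE l in return borel (0::real). \<bar>l\<bar> \<le> C" using assms(3) by (subst AE_return) auto
  then show ?thesis by (simp only: restricted_kernel_def False if_False)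
qed

section \<open>The inverse of a maximal monotone operator\<close>

lemma inverse_monotone:
  fixes S :: "real \<Rightarrow> real set"
  assumes "monotone_operator S" and inv: "\<forall>u s. u = e s \<longleftrightarrow> s \<in> S u"
  shows "mono e"
proof (rule monoI)
  fix s t :: real assume "s \<le> t"
  have "0 \<le> (t - s) * (e t - e s)"
    using assms unfolding monotone_operator_def by blast
  with \<open>s \<le> t\<close> show "e s \<le> e t"
    by (cases "s = t") (auto simp: zero_le_mult_iff)
qed

lemma least_abs_selection_is_least:
  assumes "continuous_on UNIV e" and inv: "\<forall>u s. u = e s \<longleftrightarrow> s \<in> \<theta> x u" and "\<theta> x l \<noteq> {}"
  shows "least_abs_selection \<theta> x l \<in> \<theta> x l"
    and "s \<in> \<theta> x l \<Longrightarrow> \<bar>least_abs_selection \<theta> x l\<bar> \<le> \<bar>s\<bar>"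
proof -
  have "s \<in> \<theta> x l \<longleftrightarrow> e s = l" for s using inv[rule_format, of l s] by auto
  then have "\<theta> x l = e -` {l}" by auto
  then have "closed (\<theta> x l)"
    using continuous_closed_vimage[of "{l}" e] assms(1) by (simp add: continuous_on_eq_continuous_at)
  then obtain s0 where s0: "s0 \<in> \<theta> x l" "\<And>y. y \<in> \<theta> x l \<Longrightarrow> dist 0 s0 \<le> dist 0 y"
    using distance_attains_inf[OF _ assms(3), of 0] by blast
  have "arg_min abs (\<lambda>s. s \<in> \<theta> x l) \<in> \<theta> x l \<and> (\<forall>s\<in>\<theta> x l. \<bar>arg_min abs (\<lambda>s. s \<in> \<theta> x l)\<bar> \<le> \<bar>s\<bar>)"
    by (rule arg_minI[of _ s0]) (use s0 in \<open>auto simp: not_less\<close>)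
  then show "least_abs_selection \<theta> x l \<in> \<theta> x l"
    and "s \<in> \<theta> x l \<Longrightarrow> \<bar>least_abs_selection \<theta> x l\<bar> \<le> \<bar>s\<bar>"
    by (auto simp: least_abs_selection_def arg_min_on_def)
qed

text \<open>Since \<open>0 \<in> \<theta>(x,0)\<close>, the fibre \<open>\<theta>(x,l)\<close> lies on one side of the origin for \<open>l \<noteq> 0\<close>, so that its
  element of least absolute value is the end point at which \<open>\<eta>(x,\<cdot>)\<close> reaches the level \<open>l\<close>. This
  turns the measurability of \<open>\<theta>\<^sup>*\<close> into that of \<open>\<eta>\<close>.\<close>

lemma level_of_inverse:
  assumes "continuous_on UNIV e" and inv: "\<forall>u s. u = e s \<longleftrightarrow> s \<in> \<theta> x u" and ne: "\<theta> x l \<noteq> {}"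
    and "mono e" and e0: "e 0 = 0"
  shows "0 < l \<Longrightarrow> l \<le> e s \<longleftrightarrow> least_abs_selection \<theta> x l \<le> s"
    and "l < 0 \<Longrightarrow> e s \<le> l \<longleftrightarrow> s \<le> least_abs_selection \<theta> x l"
proof -
  let ?m = "least_abs_selection \<theta> x l"
  note least = least_abs_selection_is_least[of e \<theta> x l, OF assms(1-3)]
  have em: "e ?m = l" using least(1) inv[rule_format, of l ?m] by simp
  have mono: "s \<le> t \<Longrightarrow> e s \<le> e t" for s t using \<open>mono e\<close> by (rule monoD)
  show "l \<le> e s \<longleftrightarrow> ?m \<le> s" if "0 < l"
  proof
    assume l: "l \<le> e s"
    show "?m \<le> s"
    proof (rule ccontr)
      assume "\<not> ?m \<le> s"
      then have "e s \<le> l" using mono[of s ?m] em by auto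
      then have "s \<in> \<theta> x l" using l inv[rule_format, of l s] by simp
      moreover have "0 < s" using mono[of s 0] e0 l that by (cases "0 < s") auto
      ultimately show False using least(2)[of s] \<open>\<not> ?m \<le> s\<close> by auto
    qed
  next
    assume "?m \<le> s"
    then show "l \<le> e s" using mono[of ?m s] em by simp
  qed
  show "e s \<le> l \<longleftrightarrow> s \<le> ?m" if "l < 0"
  proof
    assume l: "e s \<le> l"
    show "s \<le> ?m"
    proof (rule ccontr)
      assume "\<not> s \<le> ?m"
      then have "l \<le> e s" using mono[of ?m s] em by auto
      then have "s \<in> \<theta> x l" using l inv[rule_format, of l s] by simp
      moreover have "s < 0" using mono[of 0 s] e0 l that by (cases "s < 0") auto
      ultimately show False using least(2)[of s] \<open>\<not> s \<le> ?m\<close> by auto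
    qed
  next
    assume "s \<le> ?m"
    then show "e s \<le> l" using mono[of s ?m] em by simp
  qed
qed

text \<open>Positive levels are reached according to the previous lemma; a nonpositive level is compared through
  the complement and countably many negative levels.\<close>

lemma inverse_measurable:
  fixes \<theta> :: "real^'n \<Rightarrow> real \<Rightarrow> real set" and \<eta> :: "real^'n \<Rightarrow> real \<Rightarrow> real"
  assumes X: "X \<in> sets lebesgue" "X \<subseteq> cball 0 r"
    and sel: "\<And>l. L1_loc_space (\<lambda>x. least_abs_selection \<theta> x l)"
    and ne: "\<And>x u. \<theta> x u \<noteq> {}"
    and cont: "\<And>x. x \<in> X \<Longrightarrow> continuous_on UNIV (\<eta> x)"
    and inv: "\<And>x. x \<in> X \<Longrightarrow> \<forall>u s. u = \<eta> x s \<longleftrightarrow> s \<in> \<theta> x u"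
    and mono: "\<And>x. x \<in> X \<Longrightarrow> mono (\<eta> x)" and zero: "\<And>x. x \<in> X \<Longrightarrow> \<eta> x 0 = 0"
  shows "(\<lambda>x. if x \<in> X then \<eta> x s else 0) \<in> borel_measurable lebesgue"
proof (rule borel_measurableI_ge)
  fix y :: real
  have least_meas: "(\<lambda>x. indicator (cball 0 r) x *\<^sub>R least_abs_selection \<theta> x l) \<in> borel_measurable lebesgue" for l
  proof -
    have "(\<lambda>x. least_abs_selection \<theta> x l) absolutely_integrable_on cball 0 r"
      using sel[of l] by (auto simp: L1_loc_space_def)
    then show ?thesis by (auto simp: set_integrable_def)
  qed
  have pos: "{x \<in> X. l \<le> \<eta> x s} \<in> sets lebesgue" if "0 < l" for l
  proof -
    have "{x \<in> space lebesgue. indicator (cball 0 r) x *\<^sub>R least_abs_selection \<theta> x l \<le> s} \<in> sets lebesgue"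
      using borel_measurable_le[OF least_meas[of l] borel_measurable_const[of s]] by simp
    from sets.Int[OF X(1) this]
    have "X \<inter> {x. indicator (cball 0 r) x *\<^sub>R least_abs_selection \<theta> x l \<le> s} \<in> sets lebesgue" by simp
    also have "X \<inter> {x. indicator (cball 0 r) x *\<^sub>R least_abs_selection \<theta> x l \<le> s} = {x \<in> X. l \<le> \<eta> x s}"
    proof -
      have "l \<le> \<eta> x s \<longleftrightarrow> least_abs_selection \<theta> x l \<le> s" if "x \<in> X" for x
        by (rule level_of_inverse(1)[OF cont inv ne mono zero]) fact+
      then show ?thesis using X(2) by (auto simp: indicator_def)
    qed
    finally show ?thesis .
  qed
  have neg: "{x \<in> X. \<eta> x s \<le> l} \<in> sets lebesgue" if "l < 0" for l
  proof -
    have "{x \<in> space lebesgue. s \<le> indicator (cball 0 r) x *\<^sub>R least_abs_selection \<theta> x l} \<in> sets lebesgue"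
      using borel_measurable_le[OF borel_measurable_const[of s] least_meas[of l]] by simp
    from sets.Int[OF X(1) this]
    have "X \<inter> {x. s \<le> indicator (cball 0 r) x *\<^sub>R least_abs_selection \<theta> x l} \<in> sets lebesgue" by simp
    also have "X \<inter> {x. s \<le> indicator (cball 0 r) x *\<^sub>R least_abs_selection \<theta> x l} = {x \<in> X. \<eta> x s \<le> l}"
    proof -
      have "\<eta> x s \<le> l \<longleftrightarrow> s \<le> least_abs_selection \<theta> x l" if "x \<in> X" for x
        by (rule level_of_inverse(2)[OF cont inv ne mono zero]) fact+
      then show ?thesis using X(2) by (auto simp: indicator_def)
    qed
    finally show ?thesis .
  qed
  have "{x \<in> X. y \<le> \<eta> x s} \<in> sets lebesgue"
  proof (cases "0 < y")
    case False
    have "{x \<in> X. y \<le> \<eta> x s} = X - (\<Union>q\<in>{q \<in> \<rat>. q < y}. {x \<in> X. \<eta> x s \<le> q})"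
    proof -
      have "\<exists>q\<in>\<rat>. q < y \<and> \<eta> x s \<le> q" if "\<eta> x s < y" for x
        using Rats_dense_in_real[OF that] by (auto intro: less_imp_le)
      then show ?thesis by (fastforce simp: not_le)
    qed
    moreover have "(\<Union>q\<in>{q \<in> \<rat>. q < y}. {x \<in> X. \<eta> x s \<le> q}) \<in> sets lebesgue"
      using False countable_rat by (intro sets.countable_UN'' neg) (auto intro: countable_subset)
    ultimately show ?thesis using X(1) by auto
  qed (rule pos)
  moreover have "{x \<in> space lebesgue. y \<le> (if x \<in> X then \<eta> x s else 0)}
      = {x \<in> X. y \<le> \<eta> x s} \<union> (if y \<le> 0 then - X else {})" by auto
  ultimately show "{x \<in> space lebesgue. y \<le> (if x \<in> X then \<eta> x s else 0)} \<in> sets lebesgue"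
    using X(1) by (auto simp: Compl_in_sets_lebesgue)
qed

text \<open>The growth condition bounds \<open>\<eta>\<close> on bounded sets of states uniformly in \<open>x\<close>.\<close>

lemma inverse_bounded:
  assumes "filterlim h at_top (at_infinity :: real filter)"
  obtains B :: real where "0 \<le> B"
    "\<And>e s. \<bar>s\<bar> \<le> C \<Longrightarrow> h (e s) \<le> \<bar>s\<bar> \<Longrightarrow> \<bar>(e :: real \<Rightarrow> real) s\<bar> \<le> B"
proof -
  have "\<forall>\<^sub>F u in at_infinity. C < h u" using assms by (simp add: filterlim_at_top_dense)
  then obtain B where B: "\<And>u. B \<le> norm u \<Longrightarrow> C < h u" unfolding eventually_at_infinity by auto
  show thesis
  proof (rule that[of "max B 0"])
    fix e :: "real \<Rightarrow> real" and s assume "\<bar>s\<bar> \<le> C" "h (e s) \<le> \<bar>s\<bar>"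
    then show "\<bar>e s\<bar> \<le> max B 0" using B[of "e s"] by (cases "B \<le> norm (e s)") auto
  qed simp
qed

lemma inverse_caratheodory:
  fixes \<theta> :: "real^'n \<Rightarrow> real \<Rightarrow> real set" and \<eta> :: "real^'n \<Rightarrow> real \<Rightarrow> real"
  assumes X: "X \<in> sets lebesgue" "X \<subseteq> cball 0 r"
    and sel: "\<And>l. L1_loc_space (\<lambda>x. least_abs_selection \<theta> x l)"
    and ne: "\<And>x u. \<theta> x u \<noteq> {}"
    and cont: "\<And>x. x \<in> X \<Longrightarrow> continuous_on UNIV (\<eta> x)"
    and inv: "\<And>x. x \<in> X \<Longrightarrow> \<forall>u s. u = \<eta> x s \<longleftrightarrow> s \<in> \<theta> x u"
    and mono: "\<And>x. x \<in> X \<Longrightarrow> mono (\<eta> x)" and zero: "\<And>x. x \<in> X \<Longrightarrow> \<eta> x 0 = 0"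
    and bound: "\<And>x s. x \<in> X \<Longrightarrow> \<bar>s\<bar> \<le> C \<Longrightarrow> \<bar>\<eta> x s\<bar> \<le> B" and "0 \<le> B" "0 \<le> C"
  shows "caratheodory C (\<lambda>x. B * indicator (cball 0 r) x) (\<lambda>x s. if x \<in> X then \<eta> x (clip C s) else 0)"
  unfolding caratheodory_def
proof (intro conjI allI)
  show "integrable lebesgue (\<lambda>x. B * indicator (cball (0::real^'n) r) x)"
    by (intro integrable_mult_right integrable_real_indicator)
       (use emeasure_bounded_finite[of "cball (0::real^'n) r"] in auto)
  show "continuous_on UNIV (\<lambda>s. if x \<in> X then \<eta> x (clip C s) else 0)" for x
    by (cases "x \<in> X") (auto intro!: continuous_on_compose2[OF cont continuous_on_clip])
  show "(\<lambda>x. if x \<in> X then \<eta> x (clip C s) else 0) \<in> borel_measurable lebesgue" for s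
    by (rule inverse_measurable[OF X sel ne cont inv mono zero])
  show "\<bar>if x \<in> X then \<eta> x (clip C s) else 0\<bar> \<le> B * indicator (cball 0 r) x" for x s
    using bound[of x "clip C s"] clip_bound[of C s] X(2) \<open>0 \<le> C\<close> \<open>0 \<le> B\<close> by (auto simp: indicator_def)
qed (simp add: clip_idem)

section \<open>The source\<close>

text \<open>A nonincreasing source is dominated on \<open>[-C, C]\<close> by its values at the two end points, so that
  integrability of \<open>f(\<cdot>,u)\<close> for each single \<open>u\<close> yields a common integrable bound.\<close>

lemma source_caratheodory:
  fixes f :: "'a::euclidean_space \<Rightarrow> real \<Rightarrow> real"
  assumes G: "G \<in> sets lebesgue" "G \<subseteq> W"
    and int: "\<And>u. (\<lambda>z. f z u) absolutely_integrable_on W"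
    and cont: "\<And>z. z \<in> G \<Longrightarrow> continuous_on UNIV (f z)"
    and anti: "\<And>z u v. z \<in> G \<Longrightarrow> (f z u - f z v) * (u - v) \<le> 0" and "0 \<le> C"
  defines "f' \<equiv> \<lambda>z l. if z \<in> G then f z (clip C l) else 0"
  shows "caratheodory C (\<lambda>z. \<bar>f' z C\<bar> + \<bar>f' z (- C)\<bar>) f'"
    and "l \<le> m \<Longrightarrow> f' z m \<le> f' z l"
proof -
  have anti': "f' z m \<le> f' z l" if "l \<le> m" for z l m
  proof (cases "z \<in> G \<and> clip C l \<noteq> clip C m")
    case True
    then have "clip C l < clip C m" using clip_mono[OF that, of C] by auto
    then show ?thesis
      using True anti[of z "clip C m" "clip C l"] by (auto simp: f'_def mult_le_0_iff)
  qed (auto simp: f'_def)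
  then show "l \<le> m \<Longrightarrow> f' z m \<le> f' z l" .
  have int': "integrable lebesgue (\<lambda>z. f' z l)" for l
  proof -
    have "integrable lebesgue (\<lambda>z. indicator W z *\<^sub>R f z (clip C l))"
      using int[of "clip C l"] by (simp add: set_integrable_def)
    from integrable_mult_indicator[OF G(1) this]
    show ?thesis
      by (rule Bochner_Integration.integrable_cong[THEN iffD1, rotated -1])
         (use G(2) in \<open>auto simp: f'_def indicator_def\<close>)
  qed
  have clip_C: "clip C C = C" "clip C (- C) = - C" using \<open>0 \<le> C\<close> by (auto intro: clip_eq)
  have f'_clip: "f' z (clip C l) = f' z l" for z l by (simp add: f'_def clip_idem)
  show "caratheodory C (\<lambda>z. \<bar>f' z C\<bar> + \<bar>f' z (- C)\<bar>) f'"
    unfolding caratheodory_def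
  proof (intro conjI allI)
    show "integrable lebesgue (\<lambda>z. \<bar>f' z C\<bar> + \<bar>f' z (- C)\<bar>)"
      using int' by auto
    show "continuous_on UNIV (f' z)" for z
      unfolding f'_def by (cases "z \<in> G") (auto intro!: continuous_on_compose2[OF cont continuous_on_clip])
    show "(\<lambda>z. f' z l) \<in> borel_measurable lebesgue" for l using int' by auto
    show "\<bar>f' z l\<bar> \<le> \<bar>f' z C\<bar> + \<bar>f' z (- C)\<bar>" for z l
    proof -
      have "- C \<le> clip C l" "clip C l \<le> C" using clip_bound[OF \<open>0 \<le> C\<close>, of l] by auto
      from anti'[OF this(1), of z] anti'[OF this(2), of z] show ?thesis unfolding f'_clip by linarith
    qed
    show "f' z (clip C l) = f' z l" for z l by (rule f'_clip)
  qed
qed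

section \<open>From the entropy inequalities to Kruzhkov's inequality\<close>

text \<open>Completeness of Lebesgue measure makes \<open>h\<close> measurable as soon as it agrees with a measurable
  function almost everywhere.\<close>

lemma integral_transfer:
  fixes h h' :: "'a::euclidean_space \<Rightarrow> real"
  assumes \<Omega>: "\<Omega> \<in> sets lebesgue" and h': "h' \<in> borel_measurable lebesgue"
    and eq: "AE z in lebesgue. z \<in> \<Omega> \<longrightarrow> h z = h' z" and out: "\<And>z. z \<notin> \<Omega> \<Longrightarrow> h' z = 0"
  shows "(\<integral>z. h z \<partial>lebesgue_on \<Omega>) = (\<integral>z. h' z \<partial>lebesgue)"
proof -
  have ae: "AE z in lebesgue. h' z = indicator \<Omega> z *\<^sub>R h z"
    using eq by eventually_elim (use out in \<open>auto simp: indicator_def\<close>)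
  have "(\<integral>z. h z \<partial>lebesgue_on \<Omega>) = (\<integral>z. indicator \<Omega> z *\<^sub>R h z \<partial>lebesgue)"
    by (rule integral_restrict_space) (use \<Omega> in simp)
  also have "\<dots> = (\<integral>z. h' z \<partial>lebesgue)"
    by (rule integral_cong_AE[OF borel_measurable_AE[OF h' ae] h']) (use ae in \<open>auto elim: eventually_mono\<close>)
  finally show ?thesis .
qed

lemma integrable_continuous_compact_support:
  fixes u :: "'a::euclidean_space \<Rightarrow> real"
  assumes "continuous_on UNIV u" "compact S" "\<And>z. z \<notin> S \<Longrightarrow> u z = 0"
  shows "integrable lebesgue u"
proof -
  have "integrable lborel (\<lambda>z. indicator S z *\<^sub>R u z)"
    by (rule borel_integrable_compact[OF assms(2)]) (rule continuous_on_subset[OF assms(1) subset_UNIV])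
  moreover have "(\<lambda>z. indicator S z *\<^sub>R u z) = u" using assms(3) by (auto simp: indicator_def fun_eq_iff)
  ultimately have "integrable lborel u" by simp
  then show ?thesis by (subst integrable_completion) auto
qed

lemma kernel_integral_integrable:
  fixes P :: "'a::euclidean_space \<Rightarrow> 'c \<Rightarrow> real"
  assumes N: "N \<in> lebesgue \<rightarrow>\<^sub>M prob_algebra R"
    and P: "(\<lambda>(z, l). P z l) \<in> borel_measurable (lebesgue \<Otimes>\<^sub>M R)"
    and bd: "\<And>z l. \<bar>P z l\<bar> \<le> bd z" "integrable lebesgue bd"
  shows "integrable (N z) (P z)" and "integrable lebesgue (\<lambda>z. \<integral>l. P z l \<partial>N z)"
proof -
  have pr: "prob_space (N z)" "sets (N z) = sets R" for z
    by (rule prob_kernelD[OF N], simp)+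
  have "P z \<in> borel_measurable R" for z
    using measurable_Pair2[OF P, of z] by simp
  then have "P z \<in> borel_measurable (N z)" for z
    unfolding measurable_cong_sets[OF pr(2) refl] .
  then show "integrable (N z) (P z)"
    by (rule integrable_prob_bounded[OF pr(1) _ bd(1)])
  show "integrable lebesgue (\<lambda>z. \<integral>l. P z l \<partial>N z)"
  proof (rule Bochner_Integration.integrable_bound[OF bd(2) borel_measurable_kernel_integral[OF N P]])
    have "\<bar>\<integral>l. P z l \<partial>N z\<bar> \<le> bd z" for z by (rule integral_prob_bound[OF pr(1) bd(1)])
    then have "norm (\<integral>l. P z l \<partial>N z) \<le> norm (bd z)" for z by (metis abs_ge_self order_trans real_norm_def)
    then show "AE z in lebesgue. norm (\<integral>l. P z l \<partial>N z) \<le> norm (bd z)" by simp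
  qed
qed

text \<open>The given data next to their clipped versions, on a box \<open>W\<close> from which the null set \<open>W - G\<close> of
  bad points has been removed.\<close>

locale clipped_data =
  fixes A :: "real \<Rightarrow> real^'n" and \<eta> :: "real^'n \<Rightarrow> real \<Rightarrow> real" and f :: "real \<Rightarrow> real^'n \<Rightarrow> real \<Rightarrow> real"
    and C B :: real and X :: "(real^'n) set" and G W :: "(real \<times> (real^'n)) set"
    and Feta :: "real^'n \<Rightarrow> real" and F :: "real \<times> (real^'n) \<Rightarrow> real"
  fixes A' :: "real \<Rightarrow> real^'n" and eta' :: "real^'n \<Rightarrow> real \<Rightarrow> real" and f' :: "real \<times> (real^'n) \<Rightarrow> real \<Rightarrow> real"
  assumes A'_def: "A' = (\<lambda>l. A (clip C l))"
    and eta'_def: "eta' = (\<lambda>x l. if x \<in> X then \<eta> x (clip C l) else 0)"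
    and f'_def: "f' = (\<lambda>z l. if z \<in> G then f (fst z) (snd z) (clip C l) else 0)"
    and C: "0 < C" and A: "continuous_on UNIV A"
    and G: "G \<in> sets lebesgue" "G \<subseteq> W" "AE z in lebesgue. z \<in> W \<longrightarrow> z \<in> G"
    and W: "W \<subseteq> half_space" "W \<in> sets borel" "bounded W"
    and GX: "\<And>z. z \<in> G \<Longrightarrow> snd z \<in> X"
    and eta_cont: "\<And>x. x \<in> X \<Longrightarrow> continuous_on UNIV (\<eta> x)"
    and f_cont: "\<And>z. z \<in> G \<Longrightarrow> continuous_on UNIV (f (fst z) (snd z))"
    and eta': "caratheodory C Feta eta'" "\<And>x l. \<bar>eta' x l\<bar> \<le> B"
    and f': "caratheodory C F f'" "\<And>z l m. l \<le> m \<Longrightarrow> f' z m \<le> f' z l"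
begin

lemma A'_cont: "continuous_on UNIV A'"
  unfolding A'_def by (auto intro!: continuous_on_compose2[OF A continuous_on_clip])

lemma A'_bounded: obtains Q where "\<And>l. norm (A' l) \<le> Q"
proof -
  have "compact (A ` {- C..C})" by (intro compact_continuous_image continuous_on_subset[OF A]) auto
  from compact_imp_bounded[OF this] obtain Q where Q: "\<forall>y\<in>A ` {- C..C}. norm y \<le> Q"
    unfolding bounded_iff ..
  have "clip C l \<in> {- C..C}" for l using clip_bound[of C l] C by (auto simp: abs_le_iff)
  then have "norm (A' l) \<le> Q" for l unfolding A'_def by (intro Q[rule_format] imageI)
  then show thesis by (rule that)
qed

lemma A'_measurable: "A' \<in> borel_measurable borel"
  using A'_cont by (rule borel_measurable_continuous_onI)

lemma clipped_eq:
  assumes "\<bar>l\<bar> \<le> C"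
  shows "A' l = A l" "snd z \<in> X \<Longrightarrow> eta' (snd z) l = \<eta> (snd z) l" "z \<in> G \<Longrightarrow> f' z l = f (fst z) (snd z) l"
  using clip_eq[OF assms] by (simp_all add: A'_def eta'_def f'_def)

lemma eta'_pair: "(\<lambda>(z, l). eta' (snd z) l) \<in> borel_measurable ((lebesgue :: (real \<times> (real^'n)) measure) \<Otimes>\<^sub>M borel)"
  using eta'(1) unfolding caratheodory_def
  by (intro borel_measurable_continuous_in_second measurable_compose[OF measurable_snd_lebesgue_lebesgue]) auto

lemma f'_pair: "(\<lambda>(z, l). f' z l) \<in> borel_measurable (lebesgue \<Otimes>\<^sub>M borel)"
  by (rule caratheodory_measurable[OF f'(1)])

text \<open>One term of the entropy inequality: integration over the half space against the given Young
  measure agrees with integration over the whole space of the clipped integrand against the kernel.\<close>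

lemma entropy_term:
  fixes P :: "real \<times> (real^'n) \<Rightarrow> 'c \<Rightarrow> real" and h :: "real \<times> (real^'n) \<Rightarrow> real"
  assumes \<kappa>: "\<kappa> \<in> lebesgue \<rightarrow>\<^sub>M prob_algebra R"
    and P: "(\<lambda>(z, l). P z l) \<in> borel_measurable (lebesgue \<Otimes>\<^sub>M R)"
    "\<And>z l. \<bar>P z l\<bar> \<le> bd z" "integrable lebesgue bd"
    and h: "\<And>z. z \<in> G \<Longrightarrow> h z = (\<integral>l. P z l \<partial>\<kappa> z)"
    and out: "\<And>z. z \<notin> W \<Longrightarrow> h z = 0" "\<And>z l. z \<notin> W \<Longrightarrow> P z l = 0"
  shows "(\<integral>z. h z \<partial>lebesgue_on half_space) = (\<integral>z. (\<integral>l. P z l \<partial>\<kappa> z) \<partial>lebesgue)"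
proof (rule integral_transfer[OF half_space_lebesgue])
  show "(\<lambda>z. \<integral>l. P z l \<partial>\<kappa> z) \<in> borel_measurable lebesgue"
    by (rule borel_measurable_kernel_integral[OF \<kappa> P(1)])
  show "AE z in lebesgue. z \<in> half_space \<longrightarrow> h z = (\<integral>l. P z l \<partial>\<kappa> z)"
    using G(3)
  proof eventually_elim
    case (elim z)
    show ?case
    proof (cases "z \<in> W")
      case True
      then show ?thesis using h[OF elim[rule_format]] by blast
    next
      case False
      have "P z = (\<lambda>_. 0)" using out(2)[OF False] by (simp add: fun_eq_iff)
      then show ?thesis by (simp only: out(1)[OF False] Bochner_Integration.integral_zero simp_thms)
    qed
  qed
  show "(\<integral>l. P z l \<partial>\<kappa> z) = 0" if "z \<notin> half_space" for z
  proof -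
    have "z \<notin> W" using that W(1) by auto
    then have "P z = (\<lambda>_. 0)" using out(2) by (simp add: fun_eq_iff)
    then show ?thesis by (simp only: Bochner_Integration.integral_zero)
  qed
qed

context
  fixes \<phi> :: "real \<times> (real^'n) \<Rightarrow> real"
  assumes phi: "\<phi> \<in> test_functions half_space" "closure {z. \<phi> z \<noteq> 0} \<subseteq> W"
begin

lemma phi_facts: "smooth \<phi>" "compact (closure {z. \<phi> z \<noteq> 0})"
  using phi(1) by (auto simp: test_functions_def)

lemma phi_outside: "z \<notin> W \<Longrightarrow> \<phi> z = 0" "z \<notin> W \<Longrightarrow> dt \<phi> z = 0" "z \<notin> W \<Longrightarrow> grad_x \<phi> z = 0"
  using phi(2) closure_subset[of "{z. \<phi> z \<noteq> 0}"] Dt_Dx_eq_0_outside_support[of z \<phi>]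
  by (auto simp: dt_eq_Dt[OF phi_facts(1)] grad_x_eq_Dx[OF phi_facts(1)])

lemma weights_measurable:
  "\<phi> \<in> borel_measurable lebesgue" "Dt \<phi> \<in> borel_measurable lebesgue" "Dx \<phi> \<in> borel_measurable lebesgue"
  by (rule borel_imp_lebesgue_measurable, rule borel_measurable_continuous_onI,
      rule smooth_imp(2) continuous_Dt continuous_Dx, rule phi_facts)+

lemma weights_integrable: "integrable lebesgue (\<lambda>z. \<bar>Dt \<phi> z\<bar>)" "integrable lebesgue (\<lambda>z. norm (Dx \<phi> z))"
  "integrable lebesgue (\<lambda>z. F z * \<bar>\<phi> z\<bar>)"
proof -
  show "integrable lebesgue (\<lambda>z. \<bar>Dt \<phi> z\<bar>)" "integrable lebesgue (\<lambda>z. norm (Dx \<phi> z))"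
    by (rule integrable_continuous_compact_support[OF _ phi_facts(2)];
        use continuous_Dt[OF phi_facts(1)] continuous_Dx[OF phi_facts(1)] Dt_Dx_eq_0_outside_support in
        \<open>auto intro: continuous_intros\<close>)+
  obtain M where M: "\<And>z. norm (\<phi> z) \<le> M"
    using compact_support_bounded[OF smooth_imp(2)[OF phi_facts(1)] phi_facts(2)]
      closure_subset[of "{z. \<phi> z \<noteq> 0}"] by blast
  have Fi: "integrable lebesgue F" using f'(1) by (simp add: caratheodory_def)
  have F0: "0 \<le> F z" for z using f'(1) unfolding caratheodory_def by (meson abs_ge_zero order_trans)
  show "integrable lebesgue (\<lambda>z. F z * \<bar>\<phi> z\<bar>)"
  proof (rule Bochner_Integration.integrable_bound[of _ "\<lambda>z. F z * M"])
    show "AE z in lebesgue. norm (F z * \<bar>\<phi> z\<bar>) \<le> norm (F z * M)"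
      using M F0 by (intro AE_I2) (auto simp: abs_mult intro!: mult_left_mono order_trans[OF _ abs_ge_self])
    show "(\<lambda>z. F z * \<bar>\<phi> z\<bar>) \<in> borel_measurable lebesgue"
      using Fi weights_measurable(1) by (intro borel_measurable_times borel_measurable_abs) auto
  qed (use Fi in auto)
qed

context
  fixes \<nu> :: "real \<times> (real^'n) \<Rightarrow> real measure" and m :: real
  assumes kernel: "restricted_kernel G \<nu> \<in> lebesgue \<rightarrow>\<^sub>M prob_algebra borel"
      "\<And>z. AE l in restricted_kernel G \<nu> z. \<bar>l\<bar> \<le> C"
    and m: "\<bar>m\<bar> \<le> C"
begin

lemma kernel_cong:
  fixes h h' :: "real \<Rightarrow> 'c::{banach, second_countable_topology}"
  assumes z: "z \<in> G" and "h \<in> borel_measurable borel" "h' \<in> borel_measurable borel"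
    and eq: "\<And>l. \<bar>l\<bar> \<le> C \<Longrightarrow> h l = h' l"
  shows "(\<integral>l. h l \<partial>\<nu> z) = (\<integral>l. h' l \<partial>restricted_kernel G \<nu> z)"
proof -
  have N: "restricted_kernel G \<nu> z = \<nu> z" using z by (simp only: restricted_kernel_def if_True)
  have s: "sets (restricted_kernel G \<nu> z) = sets borel"
    by (rule prob_kernelD(2)[OF kernel(1)]) (simp only: space_completion space_lborel space_borel UNIV_I)
  have "(\<integral>l. h l \<partial>restricted_kernel G \<nu> z) = (\<integral>l. h' l \<partial>restricted_kernel G \<nu> z)"
  proof (rule integral_cong_AE)
    show "AE l in restricted_kernel G \<nu> z. h l = h' l"
      using kernel(2)[of z] by eventually_elim (rule eq)
    show "h \<in> borel_measurable (restricted_kernel G \<nu> z)" "h' \<in> borel_measurable (restricted_kernel G \<nu> z)"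
      unfolding measurable_cong_sets[OF s refl] by (rule assms)+
  qed
  then show ?thesis by (simp only: N)
qed

text \<open>Subtracting the two one-sided entropy inequalities gives Kruzhkov's: the positive and negative
  parts add up to the absolute value, and the difference of the two half-line indicators is the
  sign function, which vanishes at \<open>l = m\<close>.\<close>

lemma kruzhkov_inequality:
  assumes upper: "(\<integral>(t, x). (\<integral>l. max (\<eta> x l - \<eta> x m) 0 \<partial>\<nu> (t, x)) * dt \<phi> (t, x) \<partial>lebesgue_on half_space)
      + (\<integral>(t, x). (\<integral>l. indicator {m<..} l *\<^sub>R (A l - A m) \<partial>\<nu> (t, x)) \<bullet> grad_x \<phi> (t, x) \<partial>lebesgue_on half_space)
      + (\<integral>(t, x). (\<integral>l. indicator {m<..} l * f t x l \<partial>\<nu> (t, x)) * \<phi> (t, x) \<partial>lebesgue_on half_space) \<ge> 0"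
    and lower: "- (\<integral>(t, x). (\<integral>l. max (- (\<eta> x l - \<eta> x m)) 0 \<partial>\<nu> (t, x)) * dt \<phi> (t, x) \<partial>lebesgue_on half_space)
      + (\<integral>(t, x). (\<integral>l. indicator {..<m} l *\<^sub>R (A l - A m) \<partial>\<nu> (t, x)) \<bullet> grad_x \<phi> (t, x) \<partial>lebesgue_on half_space)
      + (\<integral>(t, x). (\<integral>l. indicator {..<m} l * f t x l \<partial>\<nu> (t, x)) * \<phi> (t, x) \<partial>lebesgue_on half_space) \<le> 0"
  shows "0 \<le> (\<integral>z. (\<integral>l. kruzhkov_integrand A' (eta' (snd z)) (f' z) (Dt \<phi> z) (Dx \<phi> z) (\<phi> z) l m
      \<partial>restricted_kernel G \<nu> z) \<partial>lebesgue)"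
proof -
  let ?N = "restricted_kernel G \<nu>"
  obtain Q where Q: "\<And>l. norm (A' l) \<le> Q" using A'_bounded by blast
  have F: "\<bar>f' z l\<bar> \<le> F z" for z l using f'(1) unfolding caratheodory_def by blast
  have B: "0 \<le> B" using eta'(2)[of undefined undefined] by linarith
  note wm = weights_measurable
  have wmp: "(\<lambda>p. \<phi> (fst p)) \<in> borel_measurable (lebesgue \<Otimes>\<^sub>M (borel :: real measure))"
    "(\<lambda>p. Dt \<phi> (fst p)) \<in> borel_measurable (lebesgue \<Otimes>\<^sub>M (borel :: real measure))"
    "(\<lambda>p. Dx \<phi> (fst p)) \<in> borel_measurable (lebesgue \<Otimes>\<^sub>M (borel :: real measure))"
    by (rule measurable_compose[OF measurable_fst], rule wm)+
  have em: "(\<lambda>p. eta' (snd (fst p)) (snd p)) \<in> borel_measurable ((lebesgue :: (real \<times> (real^'n)) measure) \<Otimes>\<^sub>M borel)"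
    and fm: "(\<lambda>p. f' (fst p) (snd p)) \<in> borel_measurable (lebesgue \<Otimes>\<^sub>M borel)"
    using eta'_pair f'_pair by (simp_all add: case_prod_unfold)
  have em0: "(\<lambda>p. eta' (snd (fst p)) m) \<in> borel_measurable ((lebesgue :: (real \<times> (real^'n)) measure) \<Otimes>\<^sub>M (borel :: real measure))"
    using eta'(1) unfolding caratheodory_def
    by (intro measurable_compose[OF measurable_fst] measurable_compose[OF measurable_snd_lebesgue_lebesgue]) auto
  have am: "(\<lambda>p. A' (snd p)) \<in> borel_measurable (lebesgue \<Otimes>\<^sub>M borel)"
    by (rule measurable_compose[OF measurable_snd A'_measurable])
  have im: "(\<lambda>p. indicator S (snd p)) \<in> borel_measurable (lebesgue \<Otimes>\<^sub>M borel)" if "S \<in> sets borel" for S :: "real set"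
    by (rule measurable_compose[OF measurable_snd borel_measurable_indicator[OF that]])
  \<comment> \<open>The entropy, flux and source terms: \<open>s = 1\<close> and \<open>S = {m<..}\<close> in the first inequality, \<open>s = - 1\<close> and
    \<open>S = {..<m}\<close> in the second.\<close>
  define P where "P s z l = max (s * (eta' (snd z) l - eta' (snd z) m)) 0 * Dt \<phi> z" for s z l
  define R where "R S z l = (indicat_real S l *\<^sub>R (A' l - A' m)) \<bullet> Dx \<phi> z" for S z l
  define T where "T S z l = indicat_real S l * f' z l * \<phi> z" for S z l
  have Pm: "(\<lambda>(z, l). P s z l) \<in> borel_measurable (lebesgue \<Otimes>\<^sub>M borel)" for s
    unfolding P_def case_prod_unfold
    by (intro borel_measurable_times borel_measurable_max borel_measurable_diff borel_measurable_const em em0 wmp)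
  have Rm: "(\<lambda>(z, l). R S z l) \<in> borel_measurable (lebesgue \<Otimes>\<^sub>M borel)" if "S \<in> sets borel" for S
    unfolding R_def case_prod_unfold
    by (intro borel_measurable_inner borel_measurable_scaleR borel_measurable_diff borel_measurable_const am im that wmp)
  have Tm: "(\<lambda>(z, l). T S z l) \<in> borel_measurable (lebesgue \<Otimes>\<^sub>M borel)" if "S \<in> sets borel" for S
    unfolding T_def case_prod_unfold by (intro borel_measurable_times im that fm wmp)
  have Pb: "\<bar>P s z l\<bar> \<le> 2 * B * \<bar>Dt \<phi> z\<bar>" if "\<bar>s\<bar> = 1" for s z l
  proof -
    have "\<bar>max (s * (eta' (snd z) l - eta' (snd z) m)) 0\<bar> \<le> \<bar>s\<bar> * \<bar>eta' (snd z) l - eta' (snd z) m\<bar>"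
      unfolding abs_mult[symmetric] by linarith
    also have "\<dots> \<le> 2 * B" using eta'(2)[of "snd z" l] eta'(2)[of "snd z" m] that by simp
    finally show ?thesis unfolding P_def abs_mult by (intro mult_right_mono) auto
  qed
  have Rb: "\<bar>R S z l\<bar> \<le> 2 * Q * norm (Dx \<phi> z)" for S z l
  proof -
    have "norm (indicat_real S l *\<^sub>R (A' l - A' m)) \<le> 2 * Q"
      using norm_triangle_ineq4[of "A' l" "A' m"] Q[of l] Q[of m] order_trans[OF norm_ge_zero Q[of l]]
      by (auto simp: indicator_def)
    then have "norm (indicat_real S l *\<^sub>R (A' l - A' m)) * norm (Dx \<phi> z) \<le> 2 * Q * norm (Dx \<phi> z)"
      by (intro mult_right_mono) auto
    then show ?thesis
      unfolding R_def using Cauchy_Schwarz_ineq2[of "indicat_real S l *\<^sub>R (A' l - A' m)" "Dx \<phi> z"] by linarith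
  qed
  have Tb: "\<bar>T S z l\<bar> \<le> F z * \<bar>\<phi> z\<bar>" for S z l
    unfolding T_def abs_mult[of _ "\<phi> z"] using F[of z l] by (intro mult_right_mono) (auto simp: indicator_def)
  have Pi: "integrable lebesgue (\<lambda>z. 2 * B * \<bar>Dt \<phi> z\<bar>)" and Ri: "integrable lebesgue (\<lambda>z. 2 * Q * norm (Dx \<phi> z))"
    by (intro integrable_mult_right weights_integrable)+
  note Ti = weights_integrable(3)
  have dt: "dt \<phi> = Dt \<phi>" and gr: "grad_x \<phi> = Dx \<phi>"
    using dt_eq_Dt[OF phi_facts(1)] grad_x_eq_Dx[OF phi_facts(1)] by auto
  note out = phi_outside[unfolded dt gr]
  have etab: "\<eta> (snd z) \<in> borel_measurable borel" if "z \<in> G" for z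
    by (rule borel_measurable_continuous_onI[OF eta_cont[OF GX[OF that]]])
  have eta'b: "eta' x \<in> borel_measurable borel" for x
    using eta'(1) by (intro borel_measurable_continuous_onI) (simp add: caratheodory_def)
  have fb: "f (fst z) (snd z) \<in> borel_measurable borel" if "z \<in> G" for z
    by (rule borel_measurable_continuous_onI[OF f_cont[OF that]])
  have f'b: "f' z \<in> borel_measurable borel" for z
    using f'(1) unfolding caratheodory_def by (intro borel_measurable_continuous_onI) blast
  have Ab: "A \<in> borel_measurable borel" by (rule borel_measurable_continuous_onI[OF A])
  have eqP: "(\<integral>(t, x). (\<integral>l. max (s * (\<eta> x l - \<eta> x m)) 0 \<partial>\<nu> (t, x)) * dt \<phi> (t, x) \<partial>lebesgue_on half_space)
      = (\<integral>z. (\<integral>l. P s z l \<partial>?N z) \<partial>lebesgue)" if s: "\<bar>s\<bar> = 1" for s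
  proof (rule entropy_term[OF kernel(1) Pm Pb[OF s] Pi])
    fix z assume z: "z \<in> G"
    have "(\<integral>l. max (s * (\<eta> (snd z) l - \<eta> (snd z) m)) 0 \<partial>\<nu> z)
        = (\<integral>l. max (s * (eta' (snd z) l - eta' (snd z) m)) 0 \<partial>?N z)"
    proof (rule kernel_cong[OF z])
      show "(\<lambda>l. max (s * (\<eta> (snd z) l - \<eta> (snd z) m)) 0) \<in> borel_measurable borel"
        "(\<lambda>l. max (s * (eta' (snd z) l - eta' (snd z) m)) 0) \<in> borel_measurable borel"
        by (intro borel_measurable_max borel_measurable_times borel_measurable_diff borel_measurable_const
            etab[OF z] eta'b)+
    qed (use clipped_eq(2)[of _ z] GX[OF z] m in simp)
    then show "(case z of (t, x) \<Rightarrow> (\<integral>l. max (s * (\<eta> x l - \<eta> x m)) 0 \<partial>\<nu> (t, x)) * dt \<phi> (t, x)) = (\<integral>l. P s z l \<partial>?N z)"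
      unfolding P_def by (cases z) (simp add: dt)
  qed (auto simp: P_def dt out)
  have eqR: "(\<integral>(t, x). (\<integral>l. indicator S l *\<^sub>R (A l - A m) \<partial>\<nu> (t, x)) \<bullet> grad_x \<phi> (t, x) \<partial>lebesgue_on half_space)
      = (\<integral>z. (\<integral>l. R S z l \<partial>?N z) \<partial>lebesgue)" if S: "S \<in> sets borel" for S
  proof (rule entropy_term[OF kernel(1) Rm[OF S] Rb Ri])
    fix z assume z: "z \<in> G"
    have 1: "(\<lambda>l. indicat_real S l *\<^sub>R (A' l - A' m)) \<in> borel_measurable borel"
      using S A'_measurable by (intro borel_measurable_scaleR borel_measurable_diff borel_measurable_const borel_measurable_indicator)
    have "(\<integral>l. indicat_real S l *\<^sub>R (A l - A m) \<partial>\<nu> z) = (\<integral>l. indicat_real S l *\<^sub>R (A' l - A' m) \<partial>?N z)"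
    proof (rule kernel_cong[OF z _ 1])
      show "(\<lambda>l. indicat_real S l *\<^sub>R (A l - A m)) \<in> borel_measurable borel"
        using S Ab by (intro borel_measurable_scaleR borel_measurable_diff borel_measurable_const borel_measurable_indicator)
    qed (use clipped_eq(1) m in simp)
    moreover have "integrable (?N z) (\<lambda>l. indicat_real S l *\<^sub>R (A' l - A' m))"
    proof -
      interpret prob_space "?N z" by (rule prob_kernelD(1)[OF kernel(1)]) (simp only: space_completion space_lborel space_borel UNIV_I)
      have s: "sets (?N z) = sets borel" by (rule prob_kernelD(2)[OF kernel(1)]) (simp only: space_completion space_lborel space_borel UNIV_I)
      show ?thesis
      proof (rule integrable_const_bound[of _ "2 * Q"])
        show "AE l in ?N z. norm (indicat_real S l *\<^sub>R (A' l - A' m)) \<le> 2 * Q"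
        proof (rule AE_I2)
          show "norm (indicat_real S l *\<^sub>R (A' l - A' m)) \<le> 2 * Q" for l
            using norm_triangle_ineq4[of "A' l" "A' m"] Q[of l] Q[of m] order_trans[OF norm_ge_zero Q[of l]]
            by (auto simp: indicator_def)
        qed
        show "(\<lambda>l. indicat_real S l *\<^sub>R (A' l - A' m)) \<in> borel_measurable (?N z)"
          unfolding measurable_cong_sets[OF s refl] by (rule 1)
      qed
    qed
    ultimately show "(case z of (t, x) \<Rightarrow> (\<integral>l. indicator S l *\<^sub>R (A l - A m) \<partial>\<nu> (t, x)) \<bullet> grad_x \<phi> (t, x)) = (\<integral>l. R S z l \<partial>?N z)"
      unfolding R_def by (cases z) (simp only: prod.case gr integral_inner_left)
  qed (auto simp: R_def gr out)
  have eqT: "(\<integral>(t, x). (\<integral>l. indicator S l * f t x l \<partial>\<nu> (t, x)) * \<phi> (t, x) \<partial>lebesgue_on half_space)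
      = (\<integral>z. (\<integral>l. T S z l \<partial>?N z) \<partial>lebesgue)" if S: "S \<in> sets borel" for S
  proof (rule entropy_term[OF kernel(1) Tm[OF S] Tb Ti])
    fix z assume z: "z \<in> G"
    have "(\<integral>l. indicat_real S l * f (fst z) (snd z) l \<partial>\<nu> z) = (\<integral>l. indicat_real S l * f' z l \<partial>?N z)"
    proof (rule kernel_cong[OF z])
      show "(\<lambda>l. indicat_real S l * f (fst z) (snd z) l) \<in> borel_measurable borel"
        "(\<lambda>l. indicat_real S l * f' z l) \<in> borel_measurable borel"
        by (intro borel_measurable_times borel_measurable_indicator S fb[OF z] f'b)+
    qed (use clipped_eq(3)[OF _ z] in simp)
    then show "(case z of (t, x) \<Rightarrow> (\<integral>l. indicator S l * f t x l \<partial>\<nu> (t, x)) * \<phi> (t, x)) = (\<integral>l. T S z l \<partial>?N z)"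
      unfolding T_def by (cases z) simp
  qed (auto simp: T_def out)
  have S: "{m<..} \<in> sets borel" "{..<m} \<in> sets borel" by auto
  note iP = kernel_integral_integrable[OF kernel(1) Pm Pb Pi]
  note iR = kernel_integral_integrable[OF kernel(1) Rm Rb Ri]
  note iT = kernel_integral_integrable[OF kernel(1) Tm Tb Ti]
  let ?J = "\<lambda>P. \<integral>z. (\<integral>l. P z l \<partial>?N z) \<partial>lebesgue"
  have up: "0 \<le> ?J (P 1) + ?J (R {m<..}) + ?J (T {m<..})"
    using upper eqP[of 1] eqR[OF S(1)] eqT[OF S(1)] by simp
  have low: "- ?J (P (- 1)) + ?J (R {..<m}) + ?J (T {..<m}) \<le> 0"
    using lower eqP[of "-1"] eqR[OF S(2)] eqT[OF S(2)] by simp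
  have KI: "kruzhkov_integrand A' (eta' (snd z)) (f' z) (Dt \<phi> z) (Dx \<phi> z) (\<phi> z) l m
      = (P 1 z l + R {m<..} z l + T {m<..} z l) + (P (- 1) z l - R {..<m} z l - T {..<m} z l)" for z l
    by (cases l m rule: linorder_cases)
       (auto simp: kruzhkov_integrand_def P_def R_def T_def max_def algebra_simps inner_diff_left)
  have in1: "integrable (?N z) (P 1 z)" "integrable (?N z) (P (- 1) z)" "integrable (?N z) (R {m<..} z)"
    "integrable (?N z) (R {..<m} z)" "integrable (?N z) (T {m<..} z)" "integrable (?N z) (T {..<m} z)" for z
    by (intro iP(1) iR(1) iT(1) S; simp)+
  have in2: "integrable lebesgue (\<lambda>z. \<integral>l. P 1 z l \<partial>?N z)" "integrable lebesgue (\<lambda>z. \<integral>l. P (- 1) z l \<partial>?N z)"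
    "integrable lebesgue (\<lambda>z. \<integral>l. R {m<..} z l \<partial>?N z)" "integrable lebesgue (\<lambda>z. \<integral>l. R {..<m} z l \<partial>?N z)"
    "integrable lebesgue (\<lambda>z. \<integral>l. T {m<..} z l \<partial>?N z)" "integrable lebesgue (\<lambda>z. \<integral>l. T {..<m} z l \<partial>?N z)"
    by (intro iP(2) iR(2) iT(2) S; simp)+
  have "(\<integral>z. (\<integral>l. kruzhkov_integrand A' (eta' (snd z)) (f' z) (Dt \<phi> z) (Dx \<phi> z) (\<phi> z) l m \<partial>?N z) \<partial>lebesgue)
    = (?J (P 1) + ?J (R {m<..}) + ?J (T {m<..})) + (?J (P (- 1)) - ?J (R {..<m}) - ?J (T {..<m}))"
    unfolding KI by (simp add: in1 in2)
  with up low show ?thesis by linarith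
qed

end

text \<open>The three integrals of the comparison inequality, gathered into one.\<close>

lemma comparison_integral:
  assumes N: "restricted_kernel G \<nu> \<in> lebesgue \<rightarrow>\<^sub>M prob_algebra borel"
      "\<And>z. AE l in restricted_kernel G \<nu> z. \<bar>l\<bar> \<le> C"
    and S: "restricted_kernel G \<sigma> \<in> lebesgue \<rightarrow>\<^sub>M prob_algebra borel"
      "\<And>z. AE l in restricted_kernel G \<sigma> z. \<bar>l\<bar> \<le> C"
  shows "(\<integral>(t, x). (\<integral>(l, \<mu>). kruzhkov_entropy (\<eta> x l - \<eta> x \<mu>) \<partial>(\<nu> (t, x) \<Otimes>\<^sub>M \<sigma> (t, x)))
             * dt \<phi> (t, x) \<partial>lebesgue_on half_space)
       + (\<integral>(t, x). (\<integral>(l, \<mu>). kruzhkov_flux A l \<mu> \<partial>(\<nu> (t, x) \<Otimes>\<^sub>M \<sigma> (t, x)))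
             \<bullet> grad_x \<phi> (t, x) \<partial>lebesgue_on half_space)
       + (\<integral>(t, x). (\<integral>(l, \<mu>). kruzhkov_entropy_deriv (l - \<mu>) * (f t x l - f t x \<mu>)
                          \<partial>(\<nu> (t, x) \<Otimes>\<^sub>M \<sigma> (t, x)))
             * \<phi> (t, x) \<partial>lebesgue_on half_space)
     = (\<integral>z. (\<integral>q. comparison_integrand A' (eta' (snd z)) (f' z) (Dt \<phi> z) (Dx \<phi> z) (\<phi> z) (fst q) (snd q)
         \<partial>(restricted_kernel G \<nu> z \<Otimes>\<^sub>M restricted_kernel G \<sigma> z)) \<partial>lebesgue)"
proof -
  let ?K = "\<lambda>z. restricted_kernel G \<nu> z \<Otimes>\<^sub>M restricted_kernel G \<sigma> z"
  let ?BB = "borel \<Otimes>\<^sub>M borel :: (real \<times> real) measure"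
  obtain Q where Q: "\<And>l. norm (A' l) \<le> Q" using A'_bounded by blast
  have F: "\<bar>f' z l\<bar> \<le> F z" for z l using f'(1) unfolding caratheodory_def by blast
  have K: "?K \<in> lebesgue \<rightarrow>\<^sub>M prob_algebra ?BB" by (rule measurable_pair_prob[OF N(1) S(1)])
  have Ks: "sets (?K z) = sets ?BB" and Kp: "prob_space (?K z)" for z
    by (rule prob_kernelD[OF K], simp only: space_completion space_lborel space_borel UNIV_I)+
  \<comment> \<open>The coefficients switch the entropy, flux and source terms on and off.\<close>
  define R where "R a b c z q = comparison_integrand A' (eta' (snd z)) (f' z) (a * Dt \<phi> z) (b *\<^sub>R Dx \<phi> z) (c * \<phi> z) (fst q) (snd q)"
    for a b c :: real and z q
  note wm = weights_measurable
  have Rm: "(\<lambda>(z, q). R a b c z q) \<in> borel_measurable (lebesgue \<Otimes>\<^sub>M ?BB)" for a b c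
    unfolding R_def
    by (rule kruzhkov_integrand_measurable(2)[where e="\<lambda>z. eta' (snd z)" and f=f' and M=lebesgue and R="?BB"
          and l=fst and m=snd, OF A'_measurable])
      (use eta'_pair f'_pair wm in \<open>auto simp: case_prod_unfold intro: borel_measurable_times borel_measurable_scaleR\<close>)
  have Rb: "\<bar>R a b c z q\<bar> \<le> 2 * B * \<bar>a * Dt \<phi> z\<bar> + 2 * Q * norm (b *\<^sub>R Dx \<phi> z) + 2 * F z * \<bar>c * \<phi> z\<bar>" for a b c z q
    unfolding R_def by (intro comparison_integrand_bound eta'(2) Q F)
  have Ri: "integrable lebesgue (\<lambda>z. 2 * B * \<bar>a * Dt \<phi> z\<bar> + 2 * Q * norm (b *\<^sub>R Dx \<phi> z) + 2 * F z * \<bar>c * \<phi> z\<bar>)" for a b c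
  proof -
    have "integrable lebesgue (\<lambda>z. 2 * B * \<bar>a\<bar> * \<bar>Dt \<phi> z\<bar> + 2 * Q * \<bar>b\<bar> * norm (Dx \<phi> z) + 2 * \<bar>c\<bar> * (F z * \<bar>\<phi> z\<bar>))"
      by (intro Bochner_Integration.integrable_add integrable_mult_right weights_integrable)
    then show ?thesis by (simp add: abs_mult mult_ac)
  qed
  note RI = kernel_integral_integrable[OF K Rm Rb Ri]
  have dt: "dt \<phi> = Dt \<phi>" and gr: "grad_x \<phi> = Dx \<phi>"
    using dt_eq_Dt[OF phi_facts(1)] grad_x_eq_Dx[OF phi_facts(1)] by auto
  note out = phi_outside[unfolded dt gr]
  have Rout: "R a b c z q = 0" if "z \<notin> W" for a b c z q
    using out[OF that] by (simp add: R_def comparison_integrand_def)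
  have cong: "(\<integral>q. h q \<partial>(\<nu> z \<Otimes>\<^sub>M \<sigma> z)) = (\<integral>q. h' q \<partial>?K z)"
    if z: "z \<in> G" and h: "h \<in> borel_measurable ?BB" and h': "h' \<in> borel_measurable ?BB"
      and eq: "\<And>l m. \<bar>l\<bar> \<le> C \<Longrightarrow> \<bar>m\<bar> \<le> C \<Longrightarrow> h (l, m) = h' (l, m)"
    for z and h h' :: "real \<times> real \<Rightarrow> 'c::{banach, second_countable_topology}"
  proof -
    have Kz: "?K z = \<nu> z \<Otimes>\<^sub>M \<sigma> z" using z by (simp only: restricted_kernel_def if_True)
    have "(\<integral>q. h q \<partial>?K z) = (\<integral>q. h' q \<partial>?K z)"
    proof (rule integral_cong_AE)
      show "h \<in> borel_measurable (?K z)" "h' \<in> borel_measurable (?K z)"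
        unfolding measurable_cong_sets[OF Ks refl] by (rule h h')+
      interpret N: prob_space "restricted_kernel G \<nu> z" by (rule prob_kernelD(1)[OF N(1)]) simp
      interpret S: prob_space "restricted_kernel G \<sigma> z" by (rule prob_kernelD(1)[OF S(1)]) simp
      interpret Y: pair_sigma_finite "restricted_kernel G \<nu> z" "restricted_kernel G \<sigma> z"
        by (simp add: pair_sigma_finite_def N.sigma_finite_measure_axioms S.sigma_finite_measure_axioms)
      have "AE q in ?K z. \<bar>fst q\<bar> \<le> C \<and> \<bar>snd q\<bar> \<le> C"
      proof (rule Y.AE_pair_measure)
        have "{q \<in> space ?BB. \<bar>fst q\<bar> \<le> C \<and> \<bar>snd q\<bar> \<le> C} \<in> sets ?BB" by measurable
        then show "{q \<in> space (?K z). \<bar>fst q\<bar> \<le> C \<and> \<bar>snd q\<bar> \<le> C} \<in> sets (?K z)"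
          by (simp only: Ks sets_eq_imp_space_eq[OF Ks])
        show "AE l in restricted_kernel G \<nu> z. AE m in restricted_kernel G \<sigma> z. \<bar>fst (l, m)\<bar> \<le> C \<and> \<bar>snd (l, m)\<bar> \<le> C"
          using N(2)[of z] by eventually_elim (use S(2)[of z] in \<open>simp\<close>)
      qed
      then show "AE q in ?K z. h q = h' q"
      proof eventually_elim
        case (elim q)
        then show ?case using eq[of "fst q" "snd q"] by simp
      qed
    qed
    then show ?thesis by (simp only: Kz)
  qed
  have etab: "\<eta> (snd z) \<in> borel_measurable borel" if "z \<in> G" for z
    by (rule borel_measurable_continuous_onI[OF eta_cont[OF GX[OF that]]])
  have eta'b: "eta' x \<in> borel_measurable borel" for x
    using eta'(1) by (intro borel_measurable_continuous_onI) (simp add: caratheodory_def)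
  have fb: "f (fst z) (snd z) \<in> borel_measurable borel" if "z \<in> G" for z
    by (rule borel_measurable_continuous_onI[OF f_cont[OF that]])
  have f'b: "f' z \<in> borel_measurable borel" for z
    using f'(1) unfolding caratheodory_def by (intro borel_measurable_continuous_onI) blast
  have Ab: "A \<in> borel_measurable borel" by (rule borel_measurable_continuous_onI[OF A])
  have pair: "(\<lambda>q. u (fst q)) \<in> borel_measurable ?BB" "(\<lambda>q. u (snd q)) \<in> borel_measurable ?BB"
    if "u \<in> borel_measurable borel" for u :: "real \<Rightarrow> 'c::topological_space"
    by (rule measurable_compose[OF measurable_fst that] measurable_compose[OF measurable_snd that])+
  have sgn: "(\<lambda>q. sgn (fst q - snd q)) \<in> borel_measurable ?BB"
    unfolding sgn_real_def by measurable
  have deriv_sgn: "kruzhkov_entropy_deriv = sgn"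
    by (auto simp: kruzhkov_entropy_deriv_def sgn_real_def fun_eq_iff)
  have e1: "(\<integral>(t, x). (\<integral>(l, \<mu>). kruzhkov_entropy (\<eta> x l - \<eta> x \<mu>) \<partial>(\<nu> (t, x) \<Otimes>\<^sub>M \<sigma> (t, x)))
             * dt \<phi> (t, x) \<partial>lebesgue_on half_space) = (\<integral>z. (\<integral>q. R 1 0 0 z q \<partial>?K z) \<partial>lebesgue)"
  proof (rule entropy_term[OF K Rm Rb Ri])
    fix z assume z: "z \<in> G"
    have "(\<integral>q. \<bar>\<eta> (snd z) (fst q) - \<eta> (snd z) (snd q)\<bar> \<partial>(\<nu> z \<Otimes>\<^sub>M \<sigma> z))
        = (\<integral>q. \<bar>eta' (snd z) (fst q) - eta' (snd z) (snd q)\<bar> \<partial>?K z)"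
      by (rule cong[OF z]; (intro borel_measurable_abs borel_measurable_diff pair etab[OF z] eta'b)?)
        (use clipped_eq(2)[of _ z] GX[OF z] in simp)
    then show "(case z of (t, x) \<Rightarrow> (\<integral>(l, \<mu>). kruzhkov_entropy (\<eta> x l - \<eta> x \<mu>) \<partial>(\<nu> (t, x) \<Otimes>\<^sub>M \<sigma> (t, x)))
             * dt \<phi> (t, x)) = (\<integral>q. R 1 0 0 z q \<partial>?K z)"
      by (cases z) (simp add: R_def comparison_integrand_def kruzhkov_entropy_def dt case_prod_unfold)
  qed (auto simp: Rout dt out)
  have e2: "(\<integral>(t, x). (\<integral>(l, \<mu>). kruzhkov_flux A l \<mu> \<partial>(\<nu> (t, x) \<Otimes>\<^sub>M \<sigma> (t, x)))
             \<bullet> grad_x \<phi> (t, x) \<partial>lebesgue_on half_space) = (\<integral>z. (\<integral>q. R 0 1 0 z q \<partial>?K z) \<partial>lebesgue)"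
  proof (rule entropy_term[OF K Rm Rb Ri])
    fix z assume z: "z \<in> G"
    let ?h = "\<lambda>A q. sgn (fst q - snd q) *\<^sub>R (A (fst q) - A (snd q))"
    have hm: "?h u \<in> borel_measurable ?BB" if "u \<in> borel_measurable borel" for u :: "real \<Rightarrow> real^'n"
      by (intro borel_measurable_scaleR borel_measurable_diff sgn pair that)
    have eq: "(\<integral>q. ?h A q \<partial>(\<nu> z \<Otimes>\<^sub>M \<sigma> z)) = (\<integral>q. ?h A' q \<partial>?K z)"
      by (rule cong[OF z hm[OF Ab] hm[OF A'_measurable]]) (use clipped_eq(1) in simp)
    have "integrable (?K z) (?h A')"
    proof -
      interpret prob_space "?K z" by (rule Kp)
      show ?thesis
      proof (rule integrable_const_bound[of _ "2 * Q"])
        show "AE q in ?K z. norm (?h A' q) \<le> 2 * Q"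
        proof (rule AE_I2)
          fix q :: "real \<times> real"
          show "norm (?h A' q) \<le> 2 * Q"
            unfolding kruzhkov_flux_max_min
            using norm_triangle_ineq4[of "A' (max (fst q) (snd q))" "A' (min (fst q) (snd q))"]
              Q[of "max (fst q) (snd q)"] Q[of "min (fst q) (snd q)"] by linarith
        qed
        show "?h A' \<in> borel_measurable (?K z)"
          unfolding measurable_cong_sets[OF Ks refl] by (rule hm[OF A'_measurable])
      qed
    qed
    then have "(\<integral>q. ?h A q \<partial>(\<nu> z \<Otimes>\<^sub>M \<sigma> z)) \<bullet> Dx \<phi> z = (\<integral>q. ?h A' q \<bullet> Dx \<phi> z \<partial>?K z)"
      unfolding eq by (intro integral_inner_left[symmetric])
    then show "(case z of (t, x) \<Rightarrow> (\<integral>(l, \<mu>). kruzhkov_flux A l \<mu> \<partial>(\<nu> (t, x) \<Otimes>\<^sub>M \<sigma> (t, x))) \<bullet> grad_x \<phi> (t, x))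
        = (\<integral>q. R 0 1 0 z q \<partial>?K z)"
      by (cases z) (simp add: R_def comparison_integrand_def kruzhkov_flux_def gr case_prod_unfold)
  qed (auto simp: Rout gr out)
  have e3: "(\<integral>(t, x). (\<integral>(l, \<mu>). kruzhkov_entropy_deriv (l - \<mu>) * (f t x l - f t x \<mu>)
                          \<partial>(\<nu> (t, x) \<Otimes>\<^sub>M \<sigma> (t, x)))
             * \<phi> (t, x) \<partial>lebesgue_on half_space) = (\<integral>z. (\<integral>q. R 0 0 1 z q \<partial>?K z) \<partial>lebesgue)"
  proof (rule entropy_term[OF K Rm Rb Ri])
    fix z assume z: "z \<in> G"
    let ?h = "\<lambda>f q. sgn (fst q - snd q) * (f (fst q) - f (snd q))"
    have hm: "?h u \<in> borel_measurable ?BB" if "u \<in> borel_measurable borel" for u :: "real \<Rightarrow> real"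
      by (intro borel_measurable_times borel_measurable_diff sgn pair that)
    have "(\<integral>q. ?h (f (fst z) (snd z)) q \<partial>(\<nu> z \<Otimes>\<^sub>M \<sigma> z)) = (\<integral>q. ?h (f' z) q \<partial>?K z)"
      by (rule cong[OF z hm[OF fb[OF z]] hm[OF f'b]]) (use clipped_eq(3)[OF _ z] in simp)
    moreover have "?h (f' z) q = - \<bar>f' z (fst q) - f' z (snd q)\<bar>" for q
      using f'(2)[of "fst q" "snd q" z] f'(2)[of "snd q" "fst q" z] by (auto simp: sgn_real_def)
    ultimately show "(case z of (t, x) \<Rightarrow> (\<integral>(l, \<mu>). kruzhkov_entropy_deriv (l - \<mu>) * (f t x l - f t x \<mu>)
                          \<partial>(\<nu> (t, x) \<Otimes>\<^sub>M \<sigma> (t, x))) * \<phi> (t, x)) = (\<integral>q. R 0 0 1 z q \<partial>?K z)"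
      by (cases z) (simp add: R_def comparison_integrand_def deriv_sgn case_prod_unfold)
  qed (auto simp: Rout out)
  have sum: "comparison_integrand A' (eta' (snd z)) (f' z) (Dt \<phi> z) (Dx \<phi> z) (\<phi> z) (fst q) (snd q)
      = R 1 0 0 z q + R 0 1 0 z q + R 0 0 1 z q" for z q
    by (simp add: R_def comparison_integrand_def)
  show ?thesis unfolding e1 e2 e3 sum using RI by simp
qed

end

end

section \<open>The comparison inequality\<close>

lemma full_measure_sets:
  assumes "AE z in lebesgue. z \<in> W \<longrightarrow> P z" "W \<in> sets lebesgue"
  shows "{z \<in> W. P (z :: 'a::euclidean_space)} \<in> sets lebesgue"
proof -
  have "{z \<in> W. \<not> P z} \<in> null_sets lebesgue"
    using assms(1) by (simp add: completion.AE_iff_null_sets)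
  then have "W - {z \<in> W. \<not> P z} \<in> sets lebesgue" using assms(2) by auto
  moreover have "W - {z \<in> W. \<not> P z} = {z \<in> W. P z}" by auto
  ultimately show ?thesis by simp
qed

lemma AE_lebesgue_onD:
  assumes "AE z in lebesgue_on \<Omega>. P z" "\<Omega> \<in> sets lebesgue"
  shows "AE z in lebesgue. z \<in> \<Omega> \<longrightarrow> P (z :: 'a::euclidean_space)"
  using assms by (subst (asm) AE_restrict_space_iff) auto

text \<open>The product \<open>\<psi>(z) K(z - z')\<close> is an admissible test function in either variable. With respect to
  \<open>z'\<close> the derivatives fall on the kernel only and change sign, whence the cancellation of the
  kernel's gradient in the doubled inequality.\<close>

lemma (in clipped_data) test_function_product:
  fixes K \<psi> :: "real \<times> (real^'n) \<Rightarrow> real"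
  assumes psi: "\<psi> \<in> test_functions half_space" "closure {z. \<psi> z \<noteq> 0} \<subseteq> W"
    and K: "smooth K" and L: "compact L" "closure {h. K h \<noteq> 0} \<subseteq> L"
    and shift: "\<forall>z\<in>closure {z. \<psi> z \<noteq> 0}. \<forall>h\<in>L. z - h \<in> W"
  shows "(\<lambda>z. \<psi> z * K (z - z')) \<in> test_functions half_space" "closure {z. \<psi> z * K (z - z') \<noteq> 0} \<subseteq> W"
    and "(\<lambda>z'. \<psi> z * K (z - z')) \<in> test_functions half_space" "closure {z'. \<psi> z * K (z - z') \<noteq> 0} \<subseteq> W"
    and "Dt (\<lambda>z. \<psi> z * K (z - z')) w = Dt \<psi> w * K (w - z') + \<psi> w * Dt K (w - z')"
    and "Dx (\<lambda>z. \<psi> z * K (z - z')) w = K (w - z') *\<^sub>R Dx \<psi> w + \<psi> w *\<^sub>R Dx K (w - z')"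
    and "Dt (\<lambda>z'. \<psi> z * K (z - z')) w = - (\<psi> z * Dt K (z - w))"
    and "Dx (\<lambda>z'. \<psi> z * K (z - z')) w = - (\<psi> z *\<^sub>R Dx K (z - w))"
proof -
  have sp: "smooth \<psi>" and cp: "compact (closure {z. \<psi> z \<noteq> 0})" using psi(1) by (auto simp: test_functions_def)
  have eqp: "- z' + (1 * fst w, 1 *\<^sub>R snd w) = w - z'" and eqm: "z + ((- 1) * fst w, (- 1) *\<^sub>R snd w) = z - w"
    for w z z' :: "real \<times> (real^'n)" by (simp_all add: prod_eq_iff)
  have s1: "smooth (\<lambda>z. K (z - z'))" for z'
    using smooth_scale[OF K, of "- z'" 1 1] unfolding eqp .
  have s2: "smooth (\<lambda>z'. K (z - z'))" for z
    using smooth_scale[OF K, of z "- 1" "- 1"] unfolding eqm .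
  have d1: "Dt (\<lambda>z. K (z - z')) w = Dt K (w - z')" "Dx (\<lambda>z. K (z - z')) w = Dx K (w - z')" for z' w
    using Dt_scale[OF K, of "- z'" 1 1 w] Dx_scale[OF K, of "- z'" 1 1 w] unfolding eqp by simp_all
  have d2: "Dt (\<lambda>z'. K (z - z')) w = - Dt K (z - w)" "Dx (\<lambda>z'. K (z - z')) w = - Dx K (z - w)" for z w
    using Dt_scale[OF K, of z "- 1" "- 1" w] Dx_scale[OF K, of z "- 1" "- 1" w] unfolding eqm by simp_all
  show "Dt (\<lambda>z. \<psi> z * K (z - z')) w = Dt \<psi> w * K (w - z') + \<psi> w * Dt K (w - z')"
    "Dx (\<lambda>z. \<psi> z * K (z - z')) w = K (w - z') *\<^sub>R Dx \<psi> w + \<psi> w *\<^sub>R Dx K (w - z')"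
    by (simp_all add: Dt_mult[OF sp s1] Dx_mult[OF sp s1] d1)
  show "Dt (\<lambda>z'. \<psi> z * K (z - z')) w = - (\<psi> z * Dt K (z - w))"
    "Dx (\<lambda>z'. \<psi> z * K (z - z')) w = - (\<psi> z *\<^sub>R Dx K (z - w))"
    by (simp_all add: Dt_cmult[OF s2] Dx_cmult[OF s2] d2)
  have c1: "closure {z. \<psi> z * K (z - z') \<noteq> 0} \<subseteq> closure {z. \<psi> z \<noteq> 0}"
    by (intro closure_mono) auto
  then show W1: "closure {z. \<psi> z * K (z - z') \<noteq> 0} \<subseteq> W" using psi(2) by blast
  have "compact (closure {z. \<psi> z * K (z - z') \<noteq> 0})"
    using compact_Int_closed[OF cp closed_closure, of "{z. \<psi> z * K (z - z') \<noteq> 0}"] c1 by (simp add: Int_absorb1)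
  then show "(\<lambda>z. \<psi> z * K (z - z')) \<in> test_functions half_space"
    using W1 W(1) by (auto simp: test_functions_def smooth_mult[OF sp s1])
  have "compact (closure {z'. \<psi> z * K (z - z') \<noteq> 0}) \<and> closure {z'. \<psi> z * K (z - z') \<noteq> 0} \<subseteq> W"
  proof (cases "\<psi> z = 0")
    case False
    then have z: "z \<in> closure {z. \<psi> z \<noteq> 0}" using closure_subset by fastforce
    have cL: "compact ((\<lambda>h. z - h) ` L)" by (intro compact_continuous_image continuous_intros L(1))
    have "{z'. \<psi> z * K (z - z') \<noteq> 0} \<subseteq> (\<lambda>h. z - h) ` L"
    proof
      fix z' assume "z' \<in> {z'. \<psi> z * K (z - z') \<noteq> 0}"
      then have "z - z' \<in> L" using L(2) closure_subset[of "{h. K h \<noteq> 0}"] by auto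
      then show "z' \<in> (\<lambda>h. z - h) ` L" by (intro image_eqI[of _ _ "z - z'"]) simp_all
    qed
    then have c: "closure {z'. \<psi> z * K (z - z') \<noteq> 0} \<subseteq> (\<lambda>h. z - h) ` L"
      by (rule closure_minimal[OF _ compact_imp_closed[OF cL]])
    then have "compact (closure {z'. \<psi> z * K (z - z') \<noteq> 0})"
      using compact_Int_closed[OF cL closed_closure, of "{z'. \<psi> z * K (z - z') \<noteq> 0}"] by (simp add: Int_absorb1)
    with c bspec[OF shift z] show ?thesis by blast
  qed simp
  then show W2: "closure {z'. \<psi> z * K (z - z') \<noteq> 0} \<subseteq> W"
    and "(\<lambda>z'. \<psi> z * K (z - z')) \<in> test_functions half_space"
    using W(1) by (auto simp: test_functions_def smooth_cmult[OF s2])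
qed

theorem lemma2p1:
  fixes A :: "real \<Rightarrow> real^'n"
    and \<theta> :: "real^'n \<Rightarrow> real \<Rightarrow> real set"
    and \<eta> :: "real^'n \<Rightarrow> real \<Rightarrow> real"
    and f :: "real \<Rightarrow> real^'n \<Rightarrow> real \<Rightarrow> real"
    and u\<^sub>0 :: "real^'n \<Rightarrow> real"
    and \<nu> \<sigma> :: "real \<times> (real^'n) \<Rightarrow> real measure"
    and \<psi> :: "real \<times> (real^'n) \<Rightarrow> real"
  assumes "flux_structure A \<theta> \<eta>"
    and "two_sided_growth \<theta>"
    and "flux_dominated A \<eta>"
    and "dissipative_source f"
    and "L1_loc_space u\<^sub>0"
    and "entropy_mv_solution A \<eta> f u\<^sub>0 \<nu>"
    and "entropy_mv_solution A \<eta> f u\<^sub>0 \<sigma>"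
    and "\<psi> \<in> test_functions half_space"
    and "\<And>z. 0 \<le> \<psi> z"
  shows "(\<integral>(t, x). (\<integral>(l, \<mu>). kruzhkov_entropy (\<eta> x l - \<eta> x \<mu>) \<partial>(\<nu> (t, x) \<Otimes>\<^sub>M \<sigma> (t, x)))
             * dt \<psi> (t, x) \<partial>lebesgue_on half_space)
       + (\<integral>(t, x). (\<integral>(l, \<mu>). kruzhkov_flux A l \<mu> \<partial>(\<nu> (t, x) \<Otimes>\<^sub>M \<sigma> (t, x)))
             \<bullet> grad_x \<psi> (t, x) \<partial>lebesgue_on half_space)
       + (\<integral>(t, x). (\<integral>(l, \<mu>). kruzhkov_entropy_deriv (l - \<mu>) * (f t x l - f t x \<mu>)
                          \<partial>(\<nu> (t, x) \<Otimes>\<^sub>M \<sigma> (t, x)))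
             * \<psi> (t, x) \<partial>lebesgue_on half_space)
       \<ge> 0"
proof (cases "\<forall>z. \<psi> z = 0")
  \<comment> \<open>Otherwise \<open>\<psi>\<close> itself, rescaled, serves as the mollifier.\<close>
  case True
  have sm: "smooth \<psi>" using assms(8) by (simp add: test_functions_def)
  have "dt \<psi> z = 0" "grad_x \<psi> z = 0" for z
    using Dt_Dx_eq_0_outside_support[of z \<psi>] True by (simp_all add: dt_eq_Dt[OF sm] grad_x_eq_Dx[OF sm])
  then show ?thesis using True by (simp add: case_prod_unfold)
next
  case False
  then obtain z0 where z0: "\<psi> z0 \<noteq> 0" by blast
  define S where "S = closure {z. \<psi> z \<noteq> 0}"
  have sm: "smooth \<psi>" and cS: "compact S" and S_half: "S \<subseteq> half_space"
    using assms(8) by (auto simp: test_functions_def S_def)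
  have z0S: "z0 \<in> S" using z0 closure_subset[of "{z. \<psi> z \<noteq> 0}"] by (auto simp: S_def)
  have S0: "\<psi> z = 0" "Dt \<psi> z = 0" "Dx \<psi> z = 0" if "z \<notin> S" for z
    using that Dt_Dx_eq_0_outside_support[of z \<psi>] closure_subset[of "{z. \<psi> z \<noteq> 0}"] by (auto simp: S_def)
  have "continuous_on S fst" by (intro continuous_intros)
  then obtain zt where zt: "zt \<in> S" "\<forall>z\<in>S. fst zt \<le> fst z"
    using continuous_attains_inf[OF cS] z0S by blast
  define \<tau> where "\<tau> = fst zt / 2"
  have tau: "0 < \<tau>" using zt(1) S_half by (auto simp: \<tau>_def half_space_def)
  obtain r where r: "0 < r" "\<And>z. z \<in> S \<Longrightarrow> norm z \<le> r"
    using compact_imp_bounded[OF cS] unfolding bounded_pos by blast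
  have rS: "\<bar>fst z\<bar> \<le> r" "norm (snd z) \<le> r" if "z \<in> S" for z
    using r(2)[OF that] norm_fst_le[of "fst z" "snd z"] norm_snd_le[of "snd z" "fst z"] by auto
  \<comment> \<open>All kernels below move points by at most half the distance of the support to \<open>t = 0\<close> in time
    and by at most one in space, so everything takes place inside the box \<open>W\<close>.\<close>
  define W :: "(real \<times> (real^'n)) set" where "W = {0<..<r + 1} \<times> cball 0 (r + 1)"
  define L :: "(real \<times> (real^'n)) set" where "L = {0..\<tau>} \<times> cball 0 1"
  have cL: "compact L" unfolding L_def by (intro compact_Times) auto
  have shift: "z - h \<in> W" if "z \<in> S" "h \<in> L" for z h
  proof -
    have h: "0 \<le> fst h" "fst h \<le> \<tau>" "norm (snd h) \<le> 1" using that(2) by (auto simp: L_def)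
    have "0 < fst z - fst h" using zt(2) that(1) h(2) tau by (force simp: \<tau>_def)
    moreover have "fst z - fst h < r + 1" using rS(1)[OF that(1)] h(1) by linarith
    moreover have "norm (snd z - snd h) \<le> r + 1"
      using norm_triangle_ineq4[of "snd z" "snd h"] rS(2)[OF that(1)] h(3) by linarith
    ultimately show ?thesis by (cases z; cases h) (simp add: W_def dist_norm norm_minus_commute)
  qed
  have S_W: "S \<subseteq> W"
  proof
    fix z assume "z \<in> S"
    moreover have "0 \<in> L" using tau by (simp add: L_def zero_prod_def)
    ultimately show "z \<in> W" using shift[of z 0] by simp
  qed
  have W: "W \<subseteq> half_space" "W \<in> sets borel" "bounded W"
    by (auto simp: W_def half_space_def intro!: borel_Times bounded_Times)
  have Wleb: "W \<in> sets lebesgue" using W(2) by auto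
  \<comment> \<open>Each of the exceptional null sets is removed from the box.\<close>
  have solD: "young_measure \<kappa>" "AE z in lebesgue_on half_space. \<kappa> z \<in> space (prob_algebra borel)"
      "\<exists>R. Linf_loc R \<and> (AE z in lebesgue_on half_space. measure_support (\<kappa> z) \<subseteq> {- R z..R z})"
    if "entropy_mv_solution A \<eta> f u\<^sub>0 \<kappa>" for \<kappa>
    using that unfolding entropy_mv_solution_def by blast+
  have radius: "\<exists>C. AE z in lebesgue. z \<in> W \<longrightarrow> measure_support (\<kappa> z) \<subseteq> {- C..C}"
    if sol: "entropy_mv_solution A \<eta> f u\<^sub>0 \<kappa>" for \<kappa>
  proof -
    from solD(3)[OF sol] obtain R where R: "Linf_loc R"
      and supp: "AE z in lebesgue_on half_space. measure_support (\<kappa> z) \<subseteq> {- R z..R z}" by blast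
    have "0 < r + 1" "compact (cball (0::real^'n) (r + 1))" using r(1) by auto
    then obtain C where C: "AE z in lebesgue_on W. \<bar>R z\<bar> \<le> C"
      using R unfolding Linf_loc_def W_def by blast
    have "AE z in lebesgue. z \<in> W \<longrightarrow> measure_support (\<kappa> z) \<subseteq> {- C..C}"
      using AE_lebesgue_onD[OF C Wleb] AE_lebesgue_onD[OF supp half_space_lebesgue]
    proof eventually_elim
      case (elim z)
      show ?case
      proof
        assume z: "z \<in> W"
        have "measure_support (\<kappa> z) \<subseteq> {- R z..R z}" "\<bar>R z\<bar> \<le> C" using elim z W(1) by auto
        then show "measure_support (\<kappa> z) \<subseteq> {- C..C}" by (force simp: abs_le_iff)
      qed
    qed
    then show ?thesis by blast
  qed
  obtain C\<nu> where C\<nu>: "AE z in lebesgue. z \<in> W \<longrightarrow> measure_support (\<nu> z) \<subseteq> {- C\<nu>..C\<nu>}"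
    using radius[OF assms(6)] by blast
  obtain C\<sigma> where C\<sigma>: "AE z in lebesgue. z \<in> W \<longrightarrow> measure_support (\<sigma> z) \<subseteq> {- C\<sigma>..C\<sigma>}"
    using radius[OF assms(7)] by blast
  define C where "C = max 1 (max C\<nu> C\<sigma>)"
  have C: "0 < C" "C\<nu> \<le> C" "C\<sigma> \<le> C" by (auto simp: C_def)
  obtain h1 :: "real \<Rightarrow> real" where h1: "filterlim h1 at_top at_infinity"
    and growth: "AE x in lebesgue. \<forall>u. \<forall>s\<in>\<theta> x u. h1 u \<le> \<bar>s\<bar>"
  proof -
    from assms(2) obtain h1 h2 :: "real \<Rightarrow> real" where "filterlim h1 at_top at_infinity"
      and "AE x in lebesgue. \<forall>u. \<forall>s\<in>\<theta> x u. h1 u \<le> \<bar>s\<bar> \<and> \<bar>s\<bar> \<le> h2 u"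
      unfolding two_sided_growth_def by blast
    moreover from this(2) have "AE x in lebesgue. \<forall>u. \<forall>s\<in>\<theta> x u. h1 u \<le> \<bar>s\<bar>" by eventually_elim blast
    ultimately show thesis using that by blast
  qed
  obtain B where B: "0 \<le> B" "\<And>e s. \<bar>s\<bar> \<le> C \<Longrightarrow> h1 (e s) \<le> \<bar>s\<bar> \<Longrightarrow> \<bar>(e :: real \<Rightarrow> real) s\<bar> \<le> B"
    using inverse_bounded[OF h1] by blast
  have fl: "continuous_on UNIV A" "\<And>x u. \<theta> x u \<noteq> {}"
    "AE x in lebesgue. maximal_monotone (\<theta> x) \<and> 0 \<in> \<theta> x 0"
    "AE x in lebesgue. (\<forall>u s. u = \<eta> x s \<longleftrightarrow> s \<in> \<theta> x u) \<and> continuous_on UNIV (\<eta> x)"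
    "\<And>l. L1_loc_space (\<lambda>x. least_abs_selection \<theta> x l)"
    using assms(1) unfolding flux_structure_def by blast+
  define good where "good x \<longleftrightarrow> monotone_operator (\<theta> x) \<and> 0 \<in> \<theta> x 0 \<and> (\<forall>u s. u = \<eta> x s \<longleftrightarrow> s \<in> \<theta> x u)
      \<and> continuous_on UNIV (\<eta> x) \<and> (\<forall>u. \<forall>s\<in>\<theta> x u. h1 u \<le> \<bar>s\<bar>)" for x
  have good_AE: "AE x in lebesgue. good x"
    using fl(3,4) growth by eventually_elim (simp add: good_def maximal_monotone_def)
  define X where "X = {x \<in> cball 0 (r + 1). good x}"
  have X: "X \<in> sets lebesgue" "X \<subseteq> cball 0 (r + 1)"
    unfolding X_def by (rule full_measure_sets) (use good_AE in \<open>auto elim: eventually_mono\<close>)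
  have XD: "monotone_operator (\<theta> x)" "0 \<in> \<theta> x 0" "\<forall>u s. u = \<eta> x s \<longleftrightarrow> s \<in> \<theta> x u"
    "continuous_on UNIV (\<eta> x)" "\<And>u s. s \<in> \<theta> x u \<Longrightarrow> h1 u \<le> \<bar>s\<bar>" if "x \<in> X" for x
    using that by (auto simp: X_def good_def)
  have X_mono: "mono (\<eta> x)" and X_zero: "\<eta> x 0 = 0" if "x \<in> X" for x
    using inverse_monotone[OF XD(1,3)[OF that]] XD(2)[OF that] XD(3)[OF that, rule_format, of 0 0] by simp_all
  have X_bound: "\<bar>\<eta> x s\<bar> \<le> B" if "x \<in> X" "\<bar>s\<bar> \<le> C" for x s
    using XD(3)[OF that(1), rule_format, of "\<eta> x s" s] by (intro B(2) that(2) XD(5)[OF that(1)]) simp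
  define ok where "ok z \<longleftrightarrow> \<nu> z \<in> space (prob_algebra borel) \<and> \<sigma> z \<in> space (prob_algebra borel)
      \<and> measure_support (\<nu> z) \<subseteq> {- C..C} \<and> measure_support (\<sigma> z) \<subseteq> {- C..C}
      \<and> continuous_on UNIV (f (fst z) (snd z)) \<and> (\<forall>u v. (f (fst z) (snd z) u - f (fst z) (snd z) v) * (u - v) \<le> 0)
      \<and> good (snd z)" for z
  have src: "\<And>u. L1_loc (\<lambda>(t, x). f t x u)"
    "AE z in lebesgue_on half_space. continuous_on UNIV (f (fst z) (snd z)) \<and> f (fst z) (snd z) 0 = 0"
    "AE z in lebesgue_on half_space. \<forall>u v. (f (fst z) (snd z) u - f (fst z) (snd z) v) * (u - v) \<le> 0"
    using assms(4) unfolding dissipative_source_def case_prod_unfold by blast+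
  have ok_AE: "AE z in lebesgue. z \<in> W \<longrightarrow> ok z"
    using AE_lebesgue_onD[OF solD(2)[OF assms(6)] half_space_lebesgue]
      AE_lebesgue_onD[OF solD(2)[OF assms(7)] half_space_lebesgue] C\<nu> C\<sigma>
      AE_lebesgue_onD[OF src(2) half_space_lebesgue] AE_lebesgue_onD[OF src(3) half_space_lebesgue]
      AE_lebesgue_snd[OF good_AE]
  proof eventually_elim
    case (elim z)
    show ?case
    proof
      assume z: "z \<in> W"
      then have zh: "z \<in> half_space" using W(1) by blast
      have "{- C\<nu>..C\<nu>} \<subseteq> {- C..C}" "{- C\<sigma>..C\<sigma>} \<subseteq> {- C..C}" using C by auto
      with elim z zh show "ok z" unfolding ok_def by blast
    qed
  qed
  define G where "G = {z \<in> W. ok z}"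
  have G: "G \<in> sets lebesgue" "G \<subseteq> W" "AE z in lebesgue. z \<in> W \<longrightarrow> z \<in> G"
    unfolding G_def using full_measure_sets[OF ok_AE Wleb] ok_AE by (auto elim: eventually_mono)
  have GD: "\<nu> z \<in> space (prob_algebra borel)" "\<sigma> z \<in> space (prob_algebra borel)"
    "measure_support (\<nu> z) \<subseteq> {- C..C}" "measure_support (\<sigma> z) \<subseteq> {- C..C}"
    "continuous_on UNIV (f (fst z) (snd z))"
    "\<And>u v. (f (fst z) (snd z) u - f (fst z) (snd z) v) * (u - v) \<le> 0" "snd z \<in> X" if "z \<in> G" for z
    using that by (auto simp: G_def ok_def X_def W_def)
  define A' where "A' = (\<lambda>l. A (clip C l))"
  define eta' where "eta' = (\<lambda>x l. if x \<in> X then \<eta> x (clip C l) else 0)"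
  define f' where "f' = (\<lambda>z l. if z \<in> G then f (fst z) (snd z) (clip C l) else 0)"
  define Feta where "Feta = (\<lambda>x::real^'n. B * indicator (cball 0 (r + 1)) x)"
  define F where "F = (\<lambda>z. \<bar>f' z C\<bar> + \<bar>f' z (- C)\<bar>)"
  have C0: "0 \<le> C" using C(1) by simp
  have eta_cara: "caratheodory C Feta eta'"
    unfolding Feta_def eta'_def
    by (rule inverse_caratheodory[OF X fl(5) fl(2) XD(4) XD(3) X_mono X_zero X_bound B(1) C0])
  have eta_bound: "\<bar>eta' x l\<bar> \<le> B" for x l
    unfolding eta'_def using X_bound[of x "clip C l"] clip_bound[OF C0] B(1) by auto
  have f_int: "(\<lambda>z. f (fst z) (snd z) u) absolutely_integrable_on W" for u
  proof -
    have "0 < r + 1" "compact (cball (0::real^'n) (r + 1))" using r(1) by auto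
    then show ?thesis using src(1)[of u] unfolding L1_loc_def W_def case_prod_unfold by blast
  qed
  have source: "caratheodory C F f'" "l \<le> m \<Longrightarrow> f' z m \<le> f' z l" for z l m
    unfolding F_def f'_def
    by (rule source_caratheodory[where f="\<lambda>z. f (fst z) (snd z)", OF G(1,2) f_int GD(5) GD(6) C0]; assumption)+
  interpret cd: clipped_data A \<eta> f C B X G W Feta F A' eta' f'
    by unfold_locales (fact A'_def eta'_def f'_def C(1) fl(1) G W GD(7) XD(4) GD(5) eta_cara eta_bound source)+
  let ?N = "restricted_kernel G \<nu>" and ?S = "restricted_kernel G \<sigma>"
  have G_half: "G \<subseteq> half_space" using G(2) W(1) by blast
  have Nk: "?N \<in> lebesgue \<rightarrow>\<^sub>M prob_algebra borel" and Sk: "?S \<in> lebesgue \<rightarrow>\<^sub>M prob_algebra borel"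
    using restricted_kernel_measurable[OF G(1) G_half _ GD(1)] restricted_kernel_measurable[OF G(1) G_half _ GD(2)]
      solD(1)[OF assms(6)] solD(1)[OF assms(7)] by (simp_all add: young_measure_def)
  have Nb: "AE l in ?N z. \<bar>l\<bar> \<le> C" for z by (rule restricted_kernel_bound[OF GD(1) GD(3) C0])
  have Sb: "AE l in ?S z. \<bar>l\<bar> \<le> C" for z by (rule restricted_kernel_bound[OF GD(2) GD(4) C0])
  obtain Q where Q: "\<And>l. norm (A' l) \<le> Q" using cd.A'_bounded by blast
  obtain H1 H2 H3 where H: "\<And>z. norm (\<psi> z) \<le> H1" "\<And>z. norm (Dt \<psi> z) \<le> H2" "\<And>z. norm (Dx \<psi> z) \<le> H3"
    using compact_support_bounded[OF smooth_imp(2)[OF sm] cS S0(1)]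
      compact_support_bounded[OF continuous_Dt[OF sm] cS S0(2)]
      compact_support_bounded[OF continuous_Dx[OF sm] cS S0(3)] by metis
  define H where "H = max H1 (max H2 H3)"
  have HH: "\<psi> z \<le> H" "\<bar>Dt \<psi> z\<bar> \<le> H" "norm (Dx \<psi> z) \<le> H" for z
    using H(1)[of z] H(2)[of z] H(3)[of z] by (auto simp: H_def)
  interpret kd: kruzhkov_doubling A' eta' f' ?N ?S \<psi> "Dt \<psi>" "Dx \<psi>" C B Q H Feta F W
  proof
    show "A' (clip C l) = A' l" for l by (simp add: A'_def clip_idem)
    show "z \<notin> W \<Longrightarrow> \<psi> z = 0 \<and> Dt \<psi> z = 0 \<and> Dx \<psi> z = 0" for z using S0[of z] S_W by blast
  qed (fact C(1) cd.A'_cont Q eta_cara eta_bound source Nk Sk Nb Sb smooth_imp(2)[OF sm] continuous_Dt[OF sm]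
      continuous_Dx[OF sm] assms(9) HH W)+
  have S_pos: "0 \<le> fst z" if "z \<in> S" for z using that S_half by (auto simp: half_space_def)
  have T: "\<psi> z = 0" if "r < \<bar>fst z\<bar>" for z using that rS(1)[of z] S0(1)[of z] by force
  have cl: "closure {z. \<psi> z \<noteq> 0} \<subseteq> S" by (simp add: S_def)
  obtain K :: "nat \<Rightarrow> real \<times> (real^'n) \<Rightarrow> real" where
    K: "\<And>n. smooth (K n)" "\<And>n h. 0 \<le> K n h" "\<And>n. (\<integral>\<^sup>+h. ennreal (K n h) \<partial>lborel) = 1"
      "approximate_kernel (\<lambda>n h. ennreal (K n h)) 1" "\<And>n. closure {h. K n h \<noteq> 0} \<subseteq> {0..\<tau>} \<times> cball 0 1"
      "(\<lambda>n. \<integral>\<^sup>+z. \<integral>\<^sup>+z'. ennreal (2 * sup_diff eta' (snd z) (snd z') * \<psi> z * \<bar>Dt (K n) (z - z')\<bar>)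
        \<partial>lebesgue \<partial>lebesgue) \<longlonglongrightarrow> 0"
    by (rule mollifier_sequence[where \<psi>=\<psi> and T=r, OF sm assms(9) z0 cS cl S_pos eta_cara C0 assms(9) HH(1) T tau])
      (assumption, assumption, rule that)
  note KL = K(5)[folded L_def]
  have K0: "K n h = 0" "Dt (K n) h = 0" "Dx (K n) h = 0" if "h \<notin> L" for n h
    using that KL[of n] Dt_Dx_eq_0_outside_support[of h "K n"] closure_subset[of "{h. K n h \<noteq> 0}"] by auto
  have "\<exists>M. \<forall>h. K n h \<le> M \<and> \<bar>Dt (K n) h\<bar> \<le> M \<and> norm (Dx (K n) h) \<le> M" for n
  proof -
    obtain M1 M2 M3 where M: "\<And>z. norm (K n z) \<le> M1" "\<And>z. norm (Dt (K n) z) \<le> M2" "\<And>z. norm (Dx (K n) z) \<le> M3"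
      using compact_support_bounded[OF smooth_imp(2)[OF K(1)] cL K0(1)]
        compact_support_bounded[OF continuous_Dt[OF K(1)] cL K0(2)]
        compact_support_bounded[OF continuous_Dx[OF K(1)] cL K0(3)] by metis
    have "K n h \<le> max M1 (max M2 M3) \<and> \<bar>Dt (K n) h\<bar> \<le> max M1 (max M2 M3) \<and> norm (Dx (K n) h) \<le> max M1 (max M2 M3)" for h
      using M(1)[of h] M(2)[of h] M(3)[of h] by auto
    then show ?thesis by blast
  qed
  from choice[OF allI[OF this]] obtain H' where
    "\<forall>n. \<forall>h. K n h \<le> H' n \<and> \<bar>Dt (K n) h\<bar> \<le> H' n \<and> norm (Dx (K n) h) \<le> H' n" ..
  then have H': "K n h \<le> H' n" "\<bar>Dt (K n) h\<bar> \<le> H' n" "norm (Dx (K n) h) \<le> H' n" for n h by blast+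
  have entropy: "0 \<le> (\<integral>z. (\<integral>l. kruzhkov_integrand A' (eta' (snd z)) (f' z) (Dt \<phi> z) (Dx \<phi> z) (\<phi> z) l m
      \<partial>restricted_kernel G \<kappa> z) \<partial>lebesgue)"
    if sol: "entropy_mv_solution A \<eta> f u\<^sub>0 \<kappa>" and ker: "restricted_kernel G \<kappa> \<in> lebesgue \<rightarrow>\<^sub>M prob_algebra borel"
        "\<And>z. AE l in restricted_kernel G \<kappa> z. \<bar>l\<bar> \<le> C"
      and phi: "\<phi> \<in> test_functions half_space" "closure {z. \<phi> z \<noteq> 0} \<subseteq> W" "\<And>z. 0 \<le> \<phi> z" and m: "\<bar>m\<bar> \<le> C" for \<kappa> \<phi> m
    by (rule cd.kruzhkov_inequality[OF phi(1,2) ker m]; use sol phi(1,3) in \<open>unfold entropy_mv_solution_def, blast\<close>)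
  have psi_W: "closure {z. \<psi> z \<noteq> 0} \<subseteq> W" using S_W by (simp add: S_def)
  have shift_all: "\<forall>z\<in>closure {z. \<psi> z \<noteq> 0}. \<forall>h\<in>L. z - h \<in> W" using shift by (simp add: S_def)
  note prod = cd.test_function_product[OF assms(8) psi_W K(1) cL KL shift_all]
  have nonneg: "0 \<le> \<psi> z * K n h" for z n h using assms(9) K(2) by simp
  have "0 \<le> (\<integral>z. kd.I z \<partial>lebesgue)"
  proof (rule kd.comparison_inequality[of K "\<lambda>n. Dt (K n)" "\<lambda>n. Dx (K n)" H'])
    show "continuous_on UNIV (K n)" "continuous_on UNIV (Dt (K n))" "continuous_on UNIV (Dx (K n))" for n
      by (rule smooth_imp(2) continuous_Dt continuous_Dx, rule K(1))+
    show "K n (z - z') = 0 \<and> Dt (K n) (z - z') = 0 \<and> Dx (K n) (z - z') = 0"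
      if "\<psi> z \<noteq> 0 \<or> Dt \<psi> z \<noteq> 0 \<or> Dx \<psi> z \<noteq> 0" "z' \<notin> W" for n z z'
    proof -
      have "z \<in> S" using S0[of z] that(1) by blast
      then have "z - z' \<notin> L" using shift[of z "z - z'"] that(2) by auto
      then show ?thesis using K0 by blast
    qed
    show "0 \<le> (\<integral>z. (\<integral>l. kruzhkov_integrand A' (eta' (snd z)) (f' z)
        (Dt \<psi> z * K n (z - z') + \<psi> z * Dt (K n) (z - z')) (K n (z - z') *\<^sub>R Dx \<psi> z + \<psi> z *\<^sub>R Dx (K n) (z - z'))
        (\<psi> z * K n (z - z')) l m \<partial>?N z) \<partial>lebesgue)" if "\<bar>m\<bar> \<le> C" for n z' m
      using entropy[OF assms(6) Nk Nb prod(1) prod(2) nonneg that, of n z'] unfolding prod(5,6) .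
    show "0 \<le> (\<integral>z'. (\<integral>m. kruzhkov_integrand A' (eta' (snd z')) (f' z')
        (- (\<psi> z * Dt (K n) (z - z'))) (- (\<psi> z *\<^sub>R Dx (K n) (z - z'))) (\<psi> z * K n (z - z')) m l \<partial>?S z') \<partial>lebesgue)"
      if "\<bar>l\<bar> \<le> C" for n z l
      using entropy[OF assms(7) Sk Sb prod(3) prod(4) nonneg that, of z n] unfolding prod(7,8) .
  qed (fact K(2) H' K(3,4,6))+
  then show ?thesis
    unfolding cd.comparison_integral[OF assms(8) psi_W Nk Nb Sk Sb] kd.I_def .
qed

end
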